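(* Let $\mathfrak{F}$ be a hereditary formation. If $\mathfrak{F}$ is recognized by $\Gamma_s$, then the following statements hold: (a) $\Gamma_s(\mathfrak{F})$ is undirected; (b) $\mathfrak{F}$ is a solubly saturated formation with the Shemetkov property.
   Context: All groups are finite; classes of groups are closed under isomorphism. $\pi(G)$ is the set of prime divisors of $|G|$. A formation is a class of groups $\mathfrak{F}$ closed under homomorphic images and such that $G/N_1,\dots,G/N_n\in\mathfrak{F}$ with $N_i\trianglelefteq G$ and $\bigcap_i N_i=1$ imply $G\in\mathfrak{F}$; it is hereditary if closed under subgroups. The Sylow graph $\Gamma_s(G)$ is the directed graph with vertex set $\pi(G)$ in which $(p,q)$ is an edge if and only if $q\in\pi(N_G(P)/PC_G(P))$ for a Sylow $p$-subgroup $P$ of $G$. For a class $\mathfrak{F}$, $\Gamma_s(\mathfrak{F})=\bigcup_{G\in\mathfrak{F}}\Gamma_s(G)$ (union of vertex sets and of edge sets). A graph is undirected if $(a,b)$ is an edge exactly when $(b,a)$ is an edge. Graphs are equal if they have the same vertices and edges. A class $\mathfrak{X}$ is recognized by a function $\Gamma$ from groups to graphs if $G_1\in\mathfrak{X}$ and $\Gamma(G_1)=\Gamma(G_2)$ imply $G_2\in\mathfrak{X}$. A Schmidt group is a non-nilpotent group all of whose proper subgroups are nilpotent. A group $G$ is $s$-critical for $\mathfrak{F}$ if $G\notin\mathfrak{F}$ but all proper subgroups of $G$ are in $\mathfrak{F}$. A formation has the Shemetkov property if every $s$-critical group for it is either a Schmidt group or a group of prime order. A formation $\mathfrak{F}$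 is solubly saturated if $G/\Phi(G_{\mathfrak{S}})\in\mathfrak{F}$ implies $G\in\mathfrak{F}$, where $G_{\mathfrak{S}}$ is the soluble radical of $G$ and $\Phi$ denotes the Frattini subgroup. *)

theory Defs
  imports
    "HOL-Algebra.Group_Action"
    "HOL-Algebra.Solvable_Groups"
    "HOL-Computational_Algebra.Primes"
    "Graph_Theory.Pair_Digraph"
begin

definition finite_group :: "('a, 'b) monoid_scheme \<Rightarrow> bool" where
  "finite_group G \<longleftrightarrow> group G \<and> finite (carrier G)"

definition prime_divisors :: "('a, 'b) monoid_scheme \<Rightarrow> nat set" where
  "prime_divisors G = prime_factors (order G)"

definition proper_subgroup :: "'a set \<Rightarrow> ('a, 'b) monoid_scheme \<Rightarrow> bool" where
  "proper_subgroup H G \<longleftrightarrow> subgroup H G \<and> H \<noteq> carrier G"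

definition maximal_subgroup :: "'a set \<Rightarrow> ('a, 'b) monoid_scheme \<Rightarrow> bool" where
  "maximal_subgroup M G \<longleftrightarrow>
     proper_subgroup M G \<and> (\<forall>H. subgroup H G \<and> M \<subseteq> H \<longrightarrow> H = M \<or> H = carrier G)"

(* The intersection with the carrier makes the Frattini subgroup of the trivial group,
   which has no maximal subgroups, the whole group. *)
definition frattini :: "('a, 'b) monoid_scheme \<Rightarrow> 'a set" where
  "frattini G = carrier G \<inter> \<Inter>{M. maximal_subgroup M G}"

definition soluble_radical :: "('a, 'b) monoid_scheme \<Rightarrow> 'a set" where
  "soluble_radical G = generate G (\<Union>{N. N \<lhd> G \<and> solvable (G\<lparr>carrier := N\<rparr>)})"

primrec lower_central :: "('a, 'b) monoid_scheme \<Rightarrow> nat \<Rightarrow> 'a set" where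
  "lower_central G 0 = carrier G"
| "lower_central G (Suc n) = generate G
     {x \<otimes>\<^bsub>G\<^esub> y \<otimes>\<^bsub>G\<^esub> inv\<^bsub>G\<^esub> x \<otimes>\<^bsub>G\<^esub> inv\<^bsub>G\<^esub> y | x y. x \<in> lower_central G n \<and> y \<in> carrier G}"

definition nilpotent_group :: "('a, 'b) monoid_scheme \<Rightarrow> bool" where
  "nilpotent_group G \<longleftrightarrow> (\<exists>n. lower_central G n = {\<one>\<^bsub>G\<^esub>})"

definition schmidt_group :: "('a, 'b) monoid_scheme \<Rightarrow> bool" where
  "schmidt_group G \<longleftrightarrow>
     \<not> nilpotent_group G \<and> (\<forall>H. proper_subgroup H G \<longrightarrow> nilpotent_group (G\<lparr>carrier := H\<rparr>))"

definition sylow_subgroup :: "nat \<Rightarrow> 'a set \<Rightarrow> ('a, 'b) monoid_scheme \<Rightarrow> bool" where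
  "sylow_subgroup p P G \<longleftrightarrow> subgroup P G \<and> card P = p ^ multiplicity p (order G)"

definition centralizer :: "('a, 'b) monoid_scheme \<Rightarrow> 'a set \<Rightarrow> 'a set" where
  "centralizer G H = {g \<in> carrier G. \<forall>h \<in> H. g \<otimes>\<^bsub>G\<^esub> h = h \<otimes>\<^bsub>G\<^esub> g}"

(* Sylow p-subgroups being conjugate, the choice of P does not matter. *)
definition sylow_graph :: "('a, 'b) monoid_scheme \<Rightarrow> nat pair_pre_digraph" where
  "sylow_graph G =
     \<lparr> pverts = prime_divisors G,
       parcs = {(p, q). p \<in> prime_divisors G \<and>
         (\<exists>P. sylow_subgroup p P G \<and>
              q \<in> prime_divisors
                    (G\<lparr>carrier := normalizer G P\<rparr> Mod (P <#>\<^bsub>G\<^esub> centralizer G P)))} \<rparr>"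

definition undirected :: "'v pair_pre_digraph \<Rightarrow> bool" where
  "undirected \<Gamma> \<longleftrightarrow> (\<forall>a b. (a, b) \<in> parcs \<Gamma> \<longleftrightarrow> (b, a) \<in> parcs \<Gamma>)"

(* Every finite group is isomorphic to one whose elements are natural numbers
   (finite_group_iso_nat), so an isomorphism-closed class of finite groups is given by
   its members with elements in nat. *)
definition group_class :: "nat monoid set \<Rightarrow> bool" where
  "group_class X \<longleftrightarrow>
     (\<forall>G \<in> X. finite_group G) \<and> (\<forall>G \<in> X. \<forall>H. group H \<and> G \<cong> H \<longrightarrow> H \<in> X)"

(* Membership for groups over other element types, such as the quotients G Mod N. *)
definition in_class :: "('a, 'b) monoid_scheme \<Rightarrow> nat monoid set \<Rightarrow> bool" where
  "in_class G X \<longleftrightarrow> (\<exists>H \<in> X. G \<cong> H)"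

lemma finite_group_iso_nat:
  fixes G :: "('a, 'b) monoid_scheme" (structure)
  assumes "finite_group G"
  shows "\<exists>H :: nat monoid. finite_group H \<and> G \<cong> H"
proof -
  interpret group G using assms by (simp add: finite_group_def)
  obtain f :: "'a \<Rightarrow> nat" where f: "inj_on f (carrier G)"
    using assms finite_imp_inj_to_nat_seg unfolding finite_group_def by metis
  define g where "g = the_inv_into (carrier G) f"
  have g: "\<And>x. x \<in> carrier G \<Longrightarrow> g (f x) = x"
    unfolding g_def using f by (simp add: the_inv_into_f_f)
  define H :: "nat monoid" where
    "H = \<lparr>carrier = f ` carrier G, monoid.mult = (\<lambda>x y. f (g x \<otimes> g y)), one = f \<one>\<rparr>"
  have iso: "f \<in> iso G H"
    using f g unfolding iso_iff H_def by (auto simp: hom_def)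
  have "group H"
  proof (rule groupI)
    fix x assume "x \<in> carrier H"
    then obtain a where a: "a \<in> carrier G" "x = f a" unfolding H_def by auto
    show "\<exists>y \<in> carrier H. y \<otimes>\<^bsub>H\<^esub> x = \<one>\<^bsub>H\<^esub>"
      using a g by (intro bexI[of _ "f (inv a)"]) (auto simp: H_def)
  qed (auto simp: H_def g m_assoc)
  moreover have "finite (carrier H)"
    using assms unfolding finite_group_def H_def by simp
  ultimately show ?thesis
    using iso unfolding finite_group_def is_iso_def by blast
qed

lemma in_class_iff:
  assumes "group_class X" "group G"
  shows "in_class G X \<longleftrightarrow> G \<in> X"
  using assms group.iso_sym iso_refl unfolding group_class_def in_class_def by blast

(* Formations are understood to be nonempty, i.e. to contain the trivial group. This is also
   the instance n = 0 of closure under subdirect products; the empty class would have the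
   trivial group as an s-critical group. *)
definition formation :: "nat monoid set \<Rightarrow> bool" where
  "formation F \<longleftrightarrow> group_class F \<and> F \<noteq> {} \<and>
     (\<forall>G \<in> F. \<forall>H :: nat monoid. group H \<and> epi G H \<noteq> {} \<longrightarrow> H \<in> F) \<and>
     (\<forall>G \<NN>. finite_group G \<and> finite \<NN> \<and> \<NN> \<noteq> {} \<and>
        (\<forall>N \<in> \<NN>. N \<lhd> G \<and> in_class (G Mod N) F) \<and> \<Inter>\<NN> = {\<one>\<^bsub>G\<^esub>} \<longrightarrow> G \<in> F)"

definition hereditary :: "nat monoid set \<Rightarrow> bool" where
  "hereditary F \<longleftrightarrow> (\<forall>G \<in> F. \<forall>H. subgroup H G \<longrightarrow> G\<lparr>carrier := H\<rparr> \<in> F)"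

definition class_sylow_graph :: "nat monoid set \<Rightarrow> nat pair_pre_digraph" where
  "class_sylow_graph F =
     \<lparr> pverts = (\<Union>G \<in> F. pverts (sylow_graph G)), parcs = (\<Union>G \<in> F. parcs (sylow_graph G)) \<rparr>"

definition recognized_by :: "nat monoid set \<Rightarrow> (nat monoid \<Rightarrow> 'v pair_pre_digraph) \<Rightarrow> bool" where
  "recognized_by X \<Gamma> \<longleftrightarrow>
     (\<forall>G1 G2. finite_group G1 \<and> finite_group G2 \<and> G1 \<in> X \<and> \<Gamma> G1 = \<Gamma> G2 \<longrightarrow> G2 \<in> X)"

definition s_critical :: "nat monoid \<Rightarrow> nat monoid set \<Rightarrow> bool" where
  "s_critical G F \<longleftrightarrow>
     finite_group G \<and> G \<notin> F \<and> (\<forall>H. proper_subgroup H G \<longrightarrow> G\<lparr>carrier := H\<rparr> \<in> F)"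

definition shemetkov_property :: "nat monoid set \<Rightarrow> bool" where
  "shemetkov_property F \<longleftrightarrow> (\<forall>G. s_critical G F \<longrightarrow> schmidt_group G \<or> prime (order G))"

definition solubly_saturated :: "nat monoid set \<Rightarrow> bool" where
  "solubly_saturated F \<longleftrightarrow>
     (\<forall>G. finite_group G \<and>
          in_class (G Mod frattini (G\<lparr>carrier := soluble_radical G\<rparr>)) F \<longrightarrow> G \<in> F)"

end

theory Submission
  imports Defs "HOL-Algebra.Sylow" "HOL-Algebra.Multiplicative_Group" "HOL-Algebra.Elementary_Groups"
    "HOL-Algebra.SndIsomorphismGrp"
begin

text \<open>
Write \<open>\<Gamma>\<close> for the Sylow graph of the class \<open>F\<close>. An arc \<open>p \<rightarrow> q\<close> of the Sylow graph of a group
means that some \<open>q\<close>-element \<open>x\<close> normalizes, but does not centralize, a Sylow \<open>p\<close>-subgroup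
(\<open>sylow_graph_arc_iff\<close>). Everything follows from one consequence of recognition: a finite group
belongs to \<open>F\<close> as soon as all its vertices and arcs belong to \<open>\<Gamma>\<close> (\<open>in_class_if_subgraph\<close>).
Indeed, if \<open>p \<rightarrow> q\<close> is an arc of \<open>\<Gamma>\<close>, witnessed by \<open>P\<close> and \<open>x\<close> in a member of \<open>F\<close>, then the
subgroup \<open>P\<langle>x\<rangle>\<close> lies in \<open>F\<close> and its graph consists of this arc alone; direct products take the union of
graphs, so every finite subgraph of \<open>\<Gamma>\<close> is the graph of a member of \<open>F\<close>.

\<^emph>\<open>The graph is undirected.\<close> Let \<open>p \<rightarrow> q\<close> be an arc of \<open>\<Gamma>\<close>. It suffices to find one group whose only arc
is \<open>p \<rightarrow> q\<close> and in which nevertheless a \<open>p\<close>-element acts nontrivially on some \<open>q\<close>-subgroup: the group is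
in \<open>F\<close> by its graph, and the action puts \<open>q \<rightarrow> p\<close> into \<open>\<Gamma>\<close>. Let \<open>H = D\<langle>x\<rangle>\<close> with a \<open>q\<close>-element \<open>x\<close> acting
without nontrivial fixed points on a \<open>p\<close>-group \<open>D \<noteq> 1\<close>, so that \<open>\<langle>x\<rangle>\<close> is self-normalizing in \<open>H\<close>. In the regular
wreath product of \<open>Z\<^sub>q\<close> by \<open>H\<close> the preimage of \<open>\<langle>x\<rangle>\<close> is a self-normalizing Sylow \<open>q\<close>-subgroup, so no arc
starts at \<open>q\<close>, while \<open>D\<close> acts faithfully on the base, which is a \<open>q\<close>-group.

\<^emph>\<open>Critical groups.\<close> An \<open>s\<close>-critical group \<open>G\<close> that is not of prime order has its vertices in \<open>\<Gamma>\<close>, so it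
has an arc \<open>p \<rightarrow> q\<close> outside \<open>\<Gamma>\<close>, witnessed by \<open>P\<close> and \<open>x\<close>. The subgroup \<open>P\<langle>x\<rangle>\<close> is not in \<open>F\<close>, hence it is
\<open>G\<close>. In a proper subgroup, which is in \<open>F\<close>, every \<open>q\<close>-element must centralize the normal Sylow
\<open>p\<close>-subgroup, so proper subgroups are nilpotent.

\<^emph>\<open>Saturation.\<close> Let \<open>R\<close> be the soluble radical of \<open>G\<close>, \<open>N\<close> the Frattini subgroup of \<open>R\<close>, and \<open>G/N\<close> in
\<open>F\<close>. Let a \<open>q\<close>-element \<open>x\<close> normalize a Sylow \<open>p\<close>-subgroup \<open>P\<close> of \<open>G\<close>. If \<open>x\<close> acts nontrivially on
\<open>PN/N\<close>, the arc is in \<open>\<Gamma>\<close>. Otherwise \<open>x\<close> centralizes \<open>P\<close> (\<open>coprime_action_trivial_mod_frattini\<close>), and there is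
no arc. The reason is an argument of Hall-Higman type in the soluble group \<open>R\<langle>x\<rangle>\<close>: after factoring out the
largest normal subgroup \<open>S\<close> of order prime to \<open>p\<close>, an element that centralizes the largest normal
\<open>p\<close>-subgroup modulo the Frattini part lies in that \<open>p\<close>-subgroup (\<open>self_centralizing_core\<close>). Hence
\<open>x \<in> S\<close>, so \<open>x\<close> centralizes the Sylow \<open>p\<close>-subgroup of \<open>N\<close>, and being of order prime to \<open>p\<close> it then
centralizes \<open>P\<close>. The same argument shows that every prime divisor of \<open>|N|\<close> divides \<open>|G/N|\<close>.
\<close>

section \<open>Conjugation, products of subgroups and elements of prime power order\<close>

lemma (in group) inv_mult_cancel:
  assumes "x \<in> carrier G" "y \<in> carrier G"
  shows "inv x \<otimes> (x \<otimes> y) = y" "x \<otimes> (inv x \<otimes> y) = y"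
  using assms by (simp_all flip: m_assoc)

lemma multiplicity_two_primes:
  fixes p q :: nat
  assumes "prime p" "prime q" "p \<noteq> q"
  shows "multiplicity p (p ^ a * q ^ b) = a" "multiplicity q (p ^ a * q ^ b) = b"
proof -
  have "\<not> p dvd q ^ b" "\<not> q dvd p ^ a" using assms by (metis prime_dvd_power primes_dvd_imp_eq)+
  then show "multiplicity p (p ^ a * q ^ b) = a" "multiplicity q (p ^ a * q ^ b) = b"
    using assms
    by (metis mult.commute multiplicity_prime_elem_times_other multiplicity_prime_power prime_imp_prime_elem)+
qed

lemma set_multI: "a \<in> A \<Longrightarrow> b \<in> B \<Longrightarrow> a \<otimes>\<^bsub>G\<^esub> b \<in> A <#>\<^bsub>G\<^esub> B"
  by (auto simp: set_mult_def)

lemma set_multE: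
  assumes "x \<in> A <#>\<^bsub>G\<^esub> B"
  obtains a b where "a \<in> A" "b \<in> B" "x = a \<otimes>\<^bsub>G\<^esub> b"
  using assms by (auto simp: set_mult_def)

lemma (in group) conj_eq_iff:
  assumes "g \<in> carrier G" "a \<in> carrier G" "b \<in> carrier G"
  shows "g \<otimes> a \<otimes> inv g = g \<otimes> b \<otimes> inv g \<longleftrightarrow> a = b"
  using assms by simp

lemma (in group) conj_mult:
  assumes "g \<in> carrier G" "a \<in> carrier G" "b \<in> carrier G"
  shows "g \<otimes> (a \<otimes> b) \<otimes> inv g = (g \<otimes> a \<otimes> inv g) \<otimes> (g \<otimes> b \<otimes> inv g)"
  using assms by (simp add: m_assoc inv_mult_cancel)

lemma (in group) commute_if_commutator_one:
  assumes "x \<in> carrier G" "y \<in> carrier G" "x \<otimes> y \<otimes> inv x \<otimes> inv y = \<one>"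
  shows "x \<otimes> y = y \<otimes> x"
proof -
  have "(x \<otimes> y) \<otimes> inv (y \<otimes> x) = \<one>" using assms by (simp add: m_assoc inv_mult_group)
  then show ?thesis using assms(1,2) by (metis inv_closed inv_equality inv_inv m_closed)
qed

lemma (in group) conj_conj:
  assumes "g \<in> carrier G" "h \<in> carrier G" "a \<in> carrier G"
  shows "(g \<otimes> h) \<otimes> a \<otimes> inv (g \<otimes> h) = g \<otimes> (h \<otimes> a \<otimes> inv h) \<otimes> inv g"
  using assms by (simp add: m_assoc inv_mult_group)

lemma (in group) conj_inv:
  assumes "g \<in> carrier G" "a \<in> carrier G"
  shows "g \<otimes> inv a \<otimes> inv g = inv (g \<otimes> a \<otimes> inv g)"
  using assms by (simp add: m_assoc inv_mult_group)

text \<open>Conjugation is injective, so on a finite set it is enough that it maps the set into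
itself.\<close>

lemma (in group) normalizer_iff:
  assumes "finite H" "H \<subseteq> carrier G"
  shows "g \<in> normalizer G H \<longleftrightarrow> g \<in> carrier G \<and> (\<forall>h\<in>H. g \<otimes> h \<otimes> inv g \<in> H)"
proof -
  have eq: "g <# H #> inv g = (\<lambda>h. g \<otimes> h \<otimes> inv g) ` H"
    by (auto simp: l_coset_def r_coset_def)
  have "(\<lambda>h. g \<otimes> h \<otimes> inv g) ` H = H"
    if "g \<in> carrier G" "\<forall>h\<in>H. g \<otimes> h \<otimes> inv g \<in> H"
  proof (rule endo_inj_surj[OF assms(1)])
    show "inj_on (\<lambda>h. g \<otimes> h \<otimes> inv g) H"
      using assms(2) that(1) by (auto simp: inj_on_def subset_iff)
  qed (use that in auto)
  then show ?thesis
    using assms by (auto simp: normalizer_def stabilizer_def eq)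
qed

lemma (in group) card_subgroup_dvd: "subgroup H G \<Longrightarrow> card H dvd order G"
  using lagrange dvd_triv_right by metis

lemma (in group) card_subgroup_dvd_card:
  assumes "subgroup A G" "subgroup B G" "A \<subseteq> B"
  shows "card A dvd card B"
  using group.card_subgroup_dvd[OF subgroup_imp_group[OF assms(2)] subgroup_incl[OF assms]]
  by (simp add: order_def)

lemma (in group) subgroup_set_mult:
  assumes A: "subgroup A G" and B: "subgroup B G"
    and conj: "\<And>a b. a \<in> A \<Longrightarrow> b \<in> B \<Longrightarrow> b \<otimes> a \<otimes> inv b \<in> A"
  shows "subgroup (A <#> B) G"
proof -
  note [simp] = subgroup.mem_carrier[OF A] subgroup.mem_carrier[OF B]
  have swap: "b \<otimes> a = (b \<otimes> a \<otimes> inv b) \<otimes> b" if "a \<in> A" "b \<in> B" for a b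
    using that by (simp add: m_assoc)
  show ?thesis
  proof (rule subgroupI)
    show "A <#> B \<subseteq> carrier G" by (auto simp: set_mult_def)
    show "A <#> B \<noteq> {}"
      using subgroup.one_closed[OF A] subgroup.one_closed[OF B] by (auto simp: set_mult_def)
  next
    fix x assume "x \<in> A <#> B"
    then obtain a b where ab: "a \<in> A" "b \<in> B" "x = a \<otimes> b" by (auto simp: set_mult_def)
    have "inv x = (inv b \<otimes> inv a \<otimes> inv (inv b)) \<otimes> inv b"
      using ab by (simp add: inv_mult_group m_assoc)
    moreover have "inv b \<otimes> inv a \<otimes> inv (inv b) \<in> A"
      using ab conj subgroup.m_inv_closed[OF A] subgroup.m_inv_closed[OF B] by blast
    ultimately show "inv x \<in> A <#> B"
      using ab subgroup.m_inv_closed[OF B] by (auto simp: set_mult_def)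
  next
    fix x y assume "x \<in> A <#> B" "y \<in> A <#> B"
    then obtain a b c d where ab: "a \<in> A" "b \<in> B" "x = a \<otimes> b" "c \<in> A" "d \<in> B" "y = c \<otimes> d"
      by (auto simp: set_mult_def)
    have "x \<otimes> y = (a \<otimes> (b \<otimes> c \<otimes> inv b)) \<otimes> (b \<otimes> d)"
      using ab by (simp add: m_assoc inv_mult_cancel)
    moreover have "a \<otimes> (b \<otimes> c \<otimes> inv b) \<in> A"
      using ab conj subgroup.m_closed[OF A] by simp
    moreover have "b \<otimes> d \<in> B" using ab subgroup.m_closed[OF B] by simp
    ultimately show "x \<otimes> y \<in> A <#> B" using set_multI by metis
  qed
qed

lemma (in group) subset_set_mult_left:
  assumes "A \<subseteq> carrier G" "subgroup B G"
  shows "A \<subseteq> A <#> B"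
proof
  fix a assume a: "a \<in> A"
  then have "a \<otimes> \<one> \<in> A <#> B" using subgroup.one_closed[OF assms(2)] by (intro set_multI)
  moreover have "a \<in> carrier G" using a assms(1) by blast
  ultimately show "a \<in> A <#> B" by (simp only: r_one)
qed

lemma (in group) subset_set_mult_right:
  assumes "subgroup A G" "B \<subseteq> carrier G"
  shows "B \<subseteq> A <#> B"
proof
  fix b assume b: "b \<in> B"
  then have "\<one> \<otimes> b \<in> A <#> B" using subgroup.one_closed[OF assms(1)] by (intro set_multI)
  moreover have "b \<in> carrier G" using b assms(2) by blast
  ultimately show "b \<in> A <#> B" by (simp only: l_one)
qed

lemma (in group) card_set_mult:
  assumes A: "subgroup A G" and B: "subgroup B G" and AB: "A \<inter> B = {\<one>}"
  shows "card (A <#> B) = card A * card B"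
proof -
  note [simp] = subgroup.mem_carrier[OF A] subgroup.mem_carrier[OF B]
  interpret group_disjoint_sum G A B
    using A B by (simp add: group_disjoint_sum_def is_group)
  have "inj_on (\<lambda>(a, b). a \<otimes> b) (A \<times> B)"
    using AB cancel by (auto simp: inj_on_def)
  moreover have "A <#> B = (\<lambda>(a, b). a \<otimes> b) ` (A \<times> B)"
    by (auto simp: set_mult_def)
  ultimately show ?thesis
    by (simp add: card_image card_cartesian_product)
qed

lemma (in group) pow_coprime_eq_one:
  assumes "x \<in> carrier G" "x [^] (m::nat) = \<one>" "x [^] (n::nat) = \<one>" "coprime m n"
  shows "x = \<one>"
proof -
  have "ord x dvd m" "ord x dvd n" using assms pow_eq_id by auto
  then have "ord x = 1" using assms(4) coprime_common_divisor_nat by blast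
  then show ?thesis using assms(1) ord_eq_1 by blast
qed

lemma (in group) pow_card_subgroup_eq_one:
  assumes "subgroup H G" "x \<in> H"
  shows "x [^] card H = \<one>"
  using group.pow_order_eq_1[OF subgroup_imp_group[OF assms(1)], of x] assms
  by (simp add: order_def nat_pow_consistent[symmetric])

lemma (in group) nat_pow_mem_subgroup:
  assumes "subgroup H G" "x \<in> H"
  shows "x [^] (n::nat) \<in> H"
  using assms by (induction n) (auto simp: subgroup.one_closed subgroup.m_closed)

lemma (in group) coprime_card_Int:
  assumes "subgroup A G" "subgroup B G" "coprime (card A) (card B)"
  shows "A \<inter> B = {\<one>}"
proof -
  have "x = \<one>" if "x \<in> A" "x \<in> B" for x
    using pow_coprime_eq_one[of x, OF _ pow_card_subgroup_eq_one pow_card_subgroup_eq_one assms(3)]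
      assms(1,2) that subgroup.mem_carrier by metis
  then show ?thesis using assms(1,2) by (auto simp: subgroup.one_closed)
qed

text \<open>Membership in a \<open>p\<close>-group is expressed by a power rather than by the order of the
element, because this form passes directly through homomorphisms, subgroups and direct products.\<close>

definition p_element :: "('a, 'b) monoid_scheme \<Rightarrow> nat \<Rightarrow> 'a \<Rightarrow> bool" where
  "p_element G p x \<longleftrightarrow> x \<in> carrier G \<and> (\<exists>k. x [^]\<^bsub>G\<^esub> p ^ k = \<one>\<^bsub>G\<^esub>)"

definition p_subgroup :: "nat \<Rightarrow> 'a set \<Rightarrow> ('a, 'b) monoid_scheme \<Rightarrow> bool" where
  "p_subgroup p P G \<longleftrightarrow> subgroup P G \<and> (\<exists>k. card P = p ^ k)"

lemma sylow_imp_p_subgroup: "sylow_subgroup p P G \<Longrightarrow> p_subgroup p P G"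
  by (auto simp: sylow_subgroup_def p_subgroup_def)

lemma (in group) p_subgroup_p_element:
  "p_subgroup p P G \<Longrightarrow> x \<in> P \<Longrightarrow> p_element G p x"
  unfolding p_subgroup_def p_element_def
  using pow_card_subgroup_eq_one subgroup.mem_carrier by metis

lemma (in group) p_element_coprime_pow:
  assumes "p_element G p x" "x [^] (n::nat) = \<one>" "coprime p n"
  shows "x = \<one>"
  using assms pow_coprime_eq_one unfolding p_element_def by (metis coprime_power_left_iff)

lemma (in group) p_element_unique:
  assumes "p_element G p x" "p_element G q x" "prime p" "prime q" "p \<noteq> q"
  shows "x = \<one>"
proof -
  obtain k where "x [^] q ^ k = \<one>" using assms(2) by (auto simp: p_element_def)
  moreover have "coprime p (q ^ k)" using assms by (simp add: primes_coprime)
  ultimately show ?thesis using p_element_coprime_pow[OF assms(1)] by blast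
qed

lemma (in group_hom) p_element_hom: "p_element G p x \<Longrightarrow> p_element H p (h x)"
  unfolding p_element_def using hom_nat_pow hom_closed hom_one by metis

lemma (in group) p_element_subgroup_iff:
  assumes "subgroup H G"
  shows "p_element (G\<lparr>carrier := H\<rparr>) p x \<longleftrightarrow> x \<in> H \<and> p_element G p x"
  using subgroup.mem_carrier[OF assms]
  by (auto simp: p_element_def nat_pow_consistent[symmetric])

lemma (in group) p_element_generate:
  assumes "p_element G p x" "prime p"
  shows "p_subgroup p (generate G {x}) G"
proof -
  from assms obtain k where x: "x \<in> carrier G" "x [^] p ^ k = \<one>" by (auto simp: p_element_def)
  then have "ord x dvd p ^ k" by (simp add: pow_eq_id)
  then obtain j where "ord x = p ^ j" using assms(2) divides_primepow_nat by blast
  then show ?thesis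
    using x generate_is_subgroup generate_pow_card[of x] by (auto simp: p_subgroup_def)
qed

lemma (in group) mem_generate_self: "x \<in> generate G {x}"
  by (simp add: generate.incl)

lemma (in group) centralizer_subgroup:
  assumes "H \<subseteq> carrier G"
  shows "subgroup (centralizer G H) G"
proof (rule subgroupI)
  show "centralizer G H \<noteq> {}" using assms by (auto simp: centralizer_def intro!: exI[of _ \<one>])
next
  fix g assume "g \<in> centralizer G H"
  then have g: "g \<in> carrier G" "\<And>h. h \<in> H \<Longrightarrow> g \<otimes> h = h \<otimes> g" by (auto simp: centralizer_def)
  have "inv g \<otimes> h = h \<otimes> inv g" if "h \<in> H" for h
  proof -
    have h: "h \<in> carrier G" using assms that by blast
    have "inv g \<otimes> h = inv g \<otimes> (h \<otimes> g) \<otimes> inv g" using g(1) h by (simp add: m_assoc)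
    also have "\<dots> = inv g \<otimes> (g \<otimes> h) \<otimes> inv g" using g that by simp
    also have "\<dots> = h \<otimes> inv g" using g(1) h by (simp flip: m_assoc)
    finally show ?thesis .
  qed
  then show "inv g \<in> centralizer G H" using g by (simp add: centralizer_def)
next
  fix g k assume "g \<in> centralizer G H" "k \<in> centralizer G H"
  then have g: "g \<in> carrier G" "k \<in> carrier G"
    "\<And>h. h \<in> H \<Longrightarrow> g \<otimes> h = h \<otimes> g" "\<And>h. h \<in> H \<Longrightarrow> k \<otimes> h = h \<otimes> k" by (auto simp: centralizer_def)
  have "g \<otimes> k \<otimes> h = h \<otimes> (g \<otimes> k)" if h: "h \<in> H" for h
  proof -
    have h': "h \<in> carrier G" using assms h by blast
    have "g \<otimes> k \<otimes> h = g \<otimes> (h \<otimes> k)" using g h h' by (simp add: m_assoc)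
    also have "\<dots> = h \<otimes> g \<otimes> k" using g h h' by (simp flip: m_assoc)
    finally show ?thesis using g h' by (simp add: m_assoc)
  qed
  then show "g \<otimes> k \<in> centralizer G H" using g by (simp add: centralizer_def)
qed (auto simp: centralizer_def)

lemma (in group) generate_singleton_commutes:
  assumes x: "x \<in> carrier G" and y: "y \<in> generate G {x}" and u: "u \<in> carrier G" "x \<otimes> u = u \<otimes> x"
  shows "y \<otimes> u = u \<otimes> y"
proof -
  have "generate G {x} \<subseteq> centralizer G {u}"
    using generate_subgroup_incl[OF _ centralizer_subgroup[of "{u}"], of "{x}"] x u
    by (simp add: centralizer_def)
  then show ?thesis using y by (auto simp: centralizer_def)
qed

lemma (in group) generate_singleton_normalizes:
  assumes x: "x \<in> carrier G" and H: "H \<subseteq> carrier G" "finite H"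
    and n: "\<And>h. h \<in> H \<Longrightarrow> x \<otimes> h \<otimes> inv x \<in> H" and y: "y \<in> generate G {x}" and h: "h \<in> H"
  shows "y \<otimes> h \<otimes> inv y \<in> H"
proof -
  have "x \<in> normalizer G H" using x H n normalizer_iff by blast
  then have "generate G {x} \<subseteq> normalizer G H"
    using generate_subgroup_incl normalizer_imp_subgroup[OF H(1)] by blast
  then show ?thesis using y h H normalizer_iff by blast
qed

section \<open>Sylow's theorems\<close>

text \<open>The orbits of a \<open>p\<close>-group have \<open>p\<close>-power length, so an orbit that is
not a fixed point has length divisible by \<open>p\<close>.\<close>

lemma (in group) prime_dvd_card_nonfixed_points:
  assumes p: "prime p" and ord: "order G = p ^ n" and E: "finite E"
    and closed: "\<And>g e. g \<in> carrier G \<Longrightarrow> e \<in> E \<Longrightarrow> act g e \<in> E"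
    and one: "\<And>e. e \<in> E \<Longrightarrow> act \<one> e = e"
    and mult: "\<And>g h e. g \<in> carrier G \<Longrightarrow> h \<in> carrier G \<Longrightarrow> e \<in> E \<Longrightarrow> act (g \<otimes> h) e = act g (act h e)"
  shows "p dvd card (E - {e \<in> E. \<forall>g\<in>carrier G. act g e = e})"
proof -
  let ?\<phi> = "\<lambda>g. restrict (act g) E"
  have bij: "bij_betw (act g) E E" if "g \<in> carrier G" for g
  proof (rule bij_betw_byWitness[where f' = "act (inv g)"])
    show "\<forall>a\<in>E. act (inv g) (act g a) = a" "\<forall>a\<in>E. act g (act (inv g) a) = a"
      using that by (auto simp: mult[symmetric] one)
  qed (use closed that in auto)
  have Bij: "?\<phi> g \<in> Bij E" if "g \<in> carrier G" for g
    using bij[OF that] bij_betw_cong[of E "?\<phi> g" "act g" E] by (auto simp: Bij_def)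
  interpret act: group_action G E ?\<phi>
  proof (intro group_action.intro group_hom.intro group_hom_axioms.intro is_group group_BijGroup)
    show "?\<phi> \<in> hom G (BijGroup E)"
    proof (rule homI)
      show "?\<phi> g \<in> carrier (BijGroup E)" if "g \<in> carrier G" for g
        using Bij[OF that] by (simp add: BijGroup_def)
      show "?\<phi> (g \<otimes> h) = ?\<phi> g \<otimes>\<^bsub>BijGroup E\<^esub> ?\<phi> h"
        if "g \<in> carrier G" "h \<in> carrier G" for g h
        using Bij that
        by (simp add: BijGroup_def) (rule ext, simp add: compose_def restrict_def mult closed)
    qed
  qed
  let ?Fix = "{e \<in> E. \<forall>g\<in>carrier G. act g e = e}"
  let ?C = "{R \<in> orbits G E ?\<phi>. \<not> R \<subseteq> ?Fix}"
  have orb: "orbit G ?\<phi> e = {act g e | g. g \<in> carrier G}" if "e \<in> E" for e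
    using that by (auto simp: orbit_def)
  have "\<Union>?C = E - ?Fix"
  proof (intro equalityI subsetI)
    fix e assume "e \<in> \<Union>?C"
    then obtain a where a: "a \<in> E" "e \<in> orbit G ?\<phi> a" "\<not> orbit G ?\<phi> a \<subseteq> ?Fix"
      by (auto simp: orbits_def)
    then have e: "e \<in> E" using orb closed by auto
    moreover have "e \<notin> ?Fix"
    proof
      assume f: "e \<in> ?Fix"
      have "a \<in> orbit G ?\<phi> e" using act.orbit_sym a e by blast
      then have "a = e" using orb[OF e] f by auto
      then have "orbit G ?\<phi> a \<subseteq> ?Fix" using orb[OF e] f by auto
      then show False using a by blast
    qed
    ultimately show "e \<in> E - ?Fix" by blast
  next
    fix e assume e: "e \<in> E - ?Fix"
    then have "e \<in> orbit G ?\<phi> e" using act.orbit_refl by blast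
    then show "e \<in> \<Union>?C" using e by (auto simp: orbits_def)
  qed
  moreover have "p dvd card (\<Union>?C)"
  proof (rule dvd_partition)
    show "finite (\<Union>?C)" using E calculation by simp
    show "\<forall>c1\<in>?C. \<forall>c2\<in>?C. c1 \<noteq> c2 \<longrightarrow> c1 \<inter> c2 = {}"
      using act.disjoint_union by auto
    show "\<forall>c\<in>?C. p dvd card c"
    proof
      fix c assume "c \<in> ?C"
      then obtain a where a: "a \<in> E" "c = orbit G ?\<phi> a" "\<not> c \<subseteq> ?Fix" by (auto simp: orbits_def)
      have "card c dvd p ^ n"
        using act.orbit_stabilizer_theorem[OF a(1)] a(2) ord by (metis dvd_triv_left)
      then obtain j where j: "card c = p ^ j" using p divides_primepow_nat by blast
      have "card c \<noteq> 1"
      proof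
        assume "card c = 1"
        then obtain z where z: "c = {z}" using card_1_singletonE by blast
        then have "c = {a}" using act.orbit_refl[OF a(1)] a(2) by simp
        then have "a \<in> ?Fix" using a orb[OF a(1)] by auto
        then show False using \<open>c = {a}\<close> a by blast
      qed
      then have "j \<noteq> 0" using j by (cases j) auto
      then show "p dvd card c" using j by (simp add: dvd_power)
    qed
  qed
  ultimately show ?thesis by simp
qed

lemma (in group) sylow_subgroup_exists:
  assumes "finite (carrier G)" "prime p"
  shows "\<exists>P. sylow_subgroup p P G"
proof -
  have "order G \<noteq> 0" using assms(1) order_gt_0_iff_finite by simp
  obtain m where "order G = p ^ multiplicity p (order G) * m"
    using multiplicity_dvd by (metis dvdE)
  then show ?thesis
    using sylow_thm[OF assms(2) is_group _ assms(1)] by (auto simp: sylow_subgroup_def)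
qed

lemma (in group) subgroup_of_prime_order:
  assumes "finite (carrier G)" "prime p" "p dvd order G"
  shows "\<exists>H. subgroup H G \<and> card H = p"
proof -
  obtain m where m: "order G = p ^ 1 * m" using assms(3) by auto
  then show ?thesis using sylow_thm[OF assms(2) is_group m assms(1)] by simp
qed

lemma (in group) cauchy:
  assumes "finite (carrier G)" "prime p" "p dvd order G"
  shows "\<exists>x\<in>carrier G. x \<noteq> \<one> \<and> x [^] p = \<one>"
proof -
  obtain H where H: "subgroup H G" "card H = p" using subgroup_of_prime_order[OF assms] by blast
  have "\<exists>x\<in>H. x \<noteq> \<one>"
  proof (rule ccontr)
    assume "\<not> ?thesis"
    then have "H \<subseteq> {\<one>}" by blast
    then have "card H \<le> 1" using card_mono[of "{\<one>}" H] by simp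
    then show False using H(2) prime_gt_1_nat[OF assms(2)] by simp
  qed
  then show ?thesis
    using H pow_card_subgroup_eq_one subgroup.mem_carrier by metis
qed

lemma prime_power_if_unique_prime_divisor:
  fixes n p :: nat
  assumes "n \<noteq> 0" "prime p" "\<And>q. prime q \<Longrightarrow> q dvd n \<Longrightarrow> q = p"
  shows "n = p ^ multiplicity p n"
proof -
  obtain m where m: "n = p ^ multiplicity p n * m" "\<not> p dvd m"
    using multiplicity_decompose'[of n p] assms(1,2) by (metis not_prime_unit)
  have "m = 1"
  proof (rule ccontr)
    assume "m \<noteq> 1"
    then obtain q where "prime q" "q dvd m" using prime_factor_nat by blast
    then show False using m assms(3) by (metis dvd_mult)
  qed
  then show ?thesis using m by simp
qed

text \<open>By Cauchy's theorem no other prime divides the order.\<close>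

lemma (in group) p_subgroup_if_p_elements:
  assumes fin: "finite (carrier G)" and p: "prime p" and H: "subgroup H G"
    and pe: "\<And>x. x \<in> H \<Longrightarrow> p_element G p x"
  shows "p_subgroup p H G"
proof -
  interpret H: group "G\<lparr>carrier := H\<rparr>" by (rule subgroup_imp_group[OF H])
  have finH: "finite H" using fin H subgroup.subset finite_subset by blast
  have "q = p" if q: "prime q" "q dvd card H" for q
  proof (rule ccontr)
    assume ne: "q \<noteq> p"
    obtain x where x: "x \<in> H" "x \<noteq> \<one>" "x [^] q = \<one>"
      using H.cauchy[of q] q finH by (auto simp: order_def nat_pow_consistent[symmetric])
    then show False
      using p_element_coprime_pow[OF pe, of x q] p q(1) ne by (simp add: primes_coprime)
  qed
  moreover have "card H \<noteq> 0" using finH subgroup.one_closed[OF H] by auto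
  ultimately show ?thesis
    using prime_power_if_unique_prime_divisor[OF _ p] H unfolding p_subgroup_def by blast
qed

lemma (in group) sylow_index_not_dvd:
  assumes fin: "finite (carrier G)" and p: "prime p" and P: "sylow_subgroup p P G"
  shows "\<not> p dvd card (rcosets P)"
proof
  assume "p dvd card (rcosets P)"
  moreover have "card (rcosets P) * card P = order G" using P lagrange[of P] unfolding sylow_subgroup_def by blast
  ultimately have "p * p ^ multiplicity p (order G) dvd order G"
    using P by (metis mult_dvd_mono dvd_refl sylow_subgroup_def)
  then have "p ^ Suc (multiplicity p (order G)) dvd order G" by simp
  moreover have "order G \<noteq> 0" using fin order_gt_0_iff_finite by simp
  ultimately show False
    using p by (metis multiplicity_geI not_less_eq_eq order_refl not_prime_unit)
qed

text \<open>The group \<open>K\<close> permutes the cosets of \<open>P\<close>. Their number is prime to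
\<open>p\<close>, so some coset \<open>P g\<close> is fixed, and this says that \<open>g\<close> conjugates
\<open>K\<close> into \<open>P\<close>.\<close>

lemma (in group) p_subgroup_conj_into_sylow:
  assumes fin: "finite (carrier G)" and p: "prime p"
    and P: "sylow_subgroup p P G" and K: "p_subgroup p K G"
  shows "\<exists>g\<in>carrier G. \<forall>k\<in>K. g \<otimes> k \<otimes> inv g \<in> P"
proof -
  have PG: "subgroup P G" and KG: "subgroup K G" using P K by (auto simp: sylow_subgroup_def p_subgroup_def)
  obtain n where n: "card K = p ^ n" using K by (auto simp: p_subgroup_def)
  note [simp] = subgroup.mem_carrier[OF KG]
  interpret K: group "G\<lparr>carrier := K\<rparr>" by (rule subgroup_imp_group[OF KG])
  let ?E = "rcosets P"
  let ?act = "\<lambda>k X. X #> inv k"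
  let ?Fix = "{e \<in> ?E. \<forall>g\<in>carrier (G\<lparr>carrier := K\<rparr>). ?act g e = e}"
  have sub: "X \<subseteq> carrier G" if "X \<in> ?E" for X
    using that rcosets_subset_PowG[OF PG] by blast
  have finE: "finite ?E" using fin rcosets_subset_PowG[OF PG] finite_subset by blast
  have "p dvd card (?E - ?Fix)"
  proof (rule K.prime_dvd_card_nonfixed_points[OF p])
    show "order (G\<lparr>carrier := K\<rparr>) = p ^ n" using n by (simp add: order_def)
    show "finite ?E" by (rule finE)
  next
    fix g e assume "g \<in> carrier (G\<lparr>carrier := K\<rparr>)" "e \<in> ?E"
    then show "e #> inv g \<in> ?E"
      using subgroup.subset[OF PG] by (auto simp: RCOSETS_def coset_mult_assoc intro!: exI[of _ "_ \<otimes> inv g"])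
  next
    fix e assume "e \<in> ?E"
    then show "e #> inv \<one>\<^bsub>G\<lparr>carrier := K\<rparr>\<^esub> = e" using sub by simp
  next
    fix g h e assume "g \<in> carrier (G\<lparr>carrier := K\<rparr>)" "h \<in> carrier (G\<lparr>carrier := K\<rparr>)" "e \<in> ?E"
    then show "e #> inv (g \<otimes>\<^bsub>G\<lparr>carrier := K\<rparr>\<^esub> h) = e #> inv h #> inv g"
      using sub by (simp add: coset_mult_assoc inv_mult_group)
  qed
  have "?Fix \<noteq> {}"
  proof
    assume "?Fix = {}"
    with \<open>p dvd card (?E - ?Fix)\<close> have "p dvd card ?E" by (simp only: Diff_empty)
    then show False using sylow_index_not_dvd[OF fin p P] by contradiction
  qed
  then obtain g where g: "g \<in> carrier G" "\<And>k. k \<in> K \<Longrightarrow> P #> g #> inv k = P #> g"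
    by (auto simp: RCOSETS_def)
  have "g \<otimes> k \<otimes> inv g \<in> P" if k: "k \<in> K" for k
  proof -
    have ik: "inv k \<in> K" using k subgroup.m_inv_closed[OF KG] by blast
    have "P #> (g \<otimes> k) = P #> g"
      using g(2)[OF ik] g(1) k subgroup.subset[OF PG] by (simp add: coset_mult_assoc)
    moreover have "g \<otimes> k \<in> P #> (g \<otimes> k)" using rcos_self[OF _ PG] g(1) k by simp
    ultimately have "g \<otimes> k \<in> P #> g" by simp
    then obtain u where "u \<in> P" "g \<otimes> k = u \<otimes> g" by (auto simp: r_coset_def)
    then show ?thesis using g(1) k subgroup.mem_carrier[OF PG] by (simp add: m_assoc)
  qed
  then show ?thesis using g(1) by blast
qed

lemma (in group) normal_p_subgroup_le_sylow:
  assumes fin: "finite (carrier G)" and p: "prime p"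
    and P: "sylow_subgroup p P G" and K: "p_subgroup p K G" and n: "K \<lhd> G"
  shows "K \<subseteq> P"
proof
  fix x assume x: "x \<in> K"
  obtain g where g: "g \<in> carrier G" "\<forall>k\<in>K. g \<otimes> k \<otimes> inv g \<in> P"
    using p_subgroup_conj_into_sylow[OF fin p P K] by blast
  have xG: "x \<in> carrier G" using x K subgroup.mem_carrier by (auto simp: p_subgroup_def)
  have "inv g \<otimes> x \<otimes> g \<in> K" using normal.inv_op_closed1[OF n g(1) x] .
  then have "g \<otimes> (inv g \<otimes> x \<otimes> g) \<otimes> inv g \<in> P" using g by blast
  then show "x \<in> P" using g(1) xG by (simp add: m_assoc inv_mult_cancel)
qed

lemma (in group) subgroup_conj_image:
  assumes "g \<in> carrier G" "subgroup Q G"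
  shows "subgroup ((\<lambda>x. g \<otimes> x \<otimes> inv g) ` Q) G"
proof -
  interpret h: group_hom G G "\<lambda>x. g \<otimes> x \<otimes> inv g"
    using assms(1) by unfold_locales (auto simp: hom_def conj_mult)
  show ?thesis using h.subgroup_img_is_subgroup[OF assms(2)] .
qed

lemma (in group) card_conj_image:
  assumes "g \<in> carrier G" "Q \<subseteq> carrier G"
  shows "card ((\<lambda>x. g \<otimes> x \<otimes> inv g) ` Q) = card Q"
  using assms by (intro card_image) (auto simp: inj_on_def subset_iff)

lemma (in group) sylow_conj_image:
  assumes "g \<in> carrier G" "sylow_subgroup p Q G"
  shows "sylow_subgroup p ((\<lambda>x. g \<otimes> x \<otimes> inv g) ` Q) G"
  using assms subgroup_conj_image card_conj_image[OF assms(1) subgroup.subset] by (simp add: sylow_subgroup_def)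

lemma (in group) sylow_conjugate:
  assumes fin: "finite (carrier G)" and p: "prime p"
    and P: "sylow_subgroup p P G" and Q: "sylow_subgroup p Q G"
  shows "\<exists>g\<in>carrier G. (\<lambda>x. g \<otimes> x \<otimes> inv g) ` Q = P"
proof -
  obtain g where g: "g \<in> carrier G" "\<forall>k\<in>Q. g \<otimes> k \<otimes> inv g \<in> P"
    using p_subgroup_conj_into_sylow[OF fin p P sylow_imp_p_subgroup[OF Q]] by blast
  have "finite P" using P fin subgroup.subset finite_subset unfolding sylow_subgroup_def by metis
  moreover have "(\<lambda>x. g \<otimes> x \<otimes> inv g) ` Q \<subseteq> P" using g by blast
  moreover have "card ((\<lambda>x. g \<otimes> x \<otimes> inv g) ` Q) = card P"
    using card_conj_image[OF g(1) subgroup.subset, of Q] P Q by (simp add: sylow_subgroup_def)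
  ultimately have "(\<lambda>x. g \<otimes> x \<otimes> inv g) ` Q = P" by (rule card_subset_eq)
  then show ?thesis using g(1) by blast
qed

lemma (in group) sylow_in_subgroup:
  assumes fin: "finite (carrier G)" and p: "prime p"
    and P: "sylow_subgroup p P G" and H: "subgroup H G" "P \<subseteq> H"
  shows "sylow_subgroup p P (G\<lparr>carrier := H\<rparr>)"
proof -
  have PG: "subgroup P G" and cP: "card P = p ^ multiplicity p (order G)"
    using P by (auto simp: sylow_subgroup_def)
  have o: "order G \<noteq> 0" using fin order_gt_0_iff_finite by simp
  have d: "card H dvd order G" using H card_subgroup_dvd by blast
  have "card P dvd card H" using card_subgroup_dvd_card[OF PG H] .
  moreover have "card H \<noteq> 0" using d o by auto
  ultimately have "multiplicity p (order G) \<le> multiplicity p (card H)"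
    using cP p by (metis multiplicity_geI not_prime_unit)
  moreover have "multiplicity p (card H) \<le> multiplicity p (order G)"
    using d o by (rule dvd_imp_multiplicity_le)
  ultimately show ?thesis
    using cP subgroup_incl[OF PG H] by (simp add: sylow_subgroup_def order_def)
qed

text \<open>Within the normalizer of \<open>P\<close> some conjugate of \<open>x\<close> lies in
\<open>P\<close>, and there \<open>P\<close> is normal.\<close>

lemma (in group) p_element_normalizing_sylow:
  assumes fin: "finite (carrier G)" and p: "prime p"
    and P: "sylow_subgroup p P G" and x: "p_element G p x" "x \<in> normalizer G P"
  shows "x \<in> P"
proof -
  let ?N = "normalizer G P"
  have PG: "subgroup P G" using P by (auto simp: sylow_subgroup_def)
  have finP: "finite P" using fin PG subgroup.subset finite_subset by blast
  note niff = normalizer_iff[OF finP subgroup.subset[OF PG]]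
  have N: "subgroup ?N G" using normalizer_imp_subgroup subgroup.subset[OF PG] .
  have PN: "P \<subseteq> ?N"
    using niff PG by (auto intro!: subgroup.m_closed[OF PG] subgroup.m_inv_closed[OF PG] dest: subgroup.mem_carrier)
  interpret N: group "G\<lparr>carrier := ?N\<rparr>" by (rule subgroup_imp_group[OF N])
  have finN: "finite ?N" using fin N subgroup.subset finite_subset by blast
  have SN: "sylow_subgroup p P (G\<lparr>carrier := ?N\<rparr>)" using sylow_in_subgroup[OF fin p P N PN] .
  have "p_subgroup p (generate (G\<lparr>carrier := ?N\<rparr>) {x}) (G\<lparr>carrier := ?N\<rparr>)"
    using N.p_element_generate p x p_element_subgroup_iff[OF N] by blast
  then obtain g where g: "g \<in> ?N" "\<forall>k\<in>generate (G\<lparr>carrier := ?N\<rparr>) {x}. g \<otimes> k \<otimes> inv g \<in> P"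
    using N.p_subgroup_conj_into_sylow[OF _ p SN, of "generate (G\<lparr>carrier := ?N\<rparr>) {x}"]
      finN m_inv_consistent[OF N] by auto
  have gG: "g \<in> carrier G" and xG: "x \<in> carrier G" using g x subgroup.mem_carrier[OF N] by auto
  have "g \<otimes> x \<otimes> inv g \<in> P" using g N.mem_generate_self by blast
  moreover have "inv g \<in> ?N" using g subgroup.m_inv_closed[OF N] by blast
  ultimately have "inv g \<otimes> (g \<otimes> x \<otimes> inv g) \<otimes> inv (inv g) \<in> P" using niff by blast
  then show ?thesis using gG xG by (simp add: m_assoc inv_mult_cancel)
qed

lemma (in group) subgroup_le_normalizer:
  assumes "finite (carrier G)" "subgroup Q G"
  shows "Q \<subseteq> normalizer G Q"
proof
  fix q assume q: "q \<in> Q"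
  have "finite Q" using assms subgroup.subset finite_subset by blast
  moreover have "q \<otimes> x \<otimes> inv q \<in> Q" if "x \<in> Q" for x
    using q that subgroup.m_closed[OF assms(2)] subgroup.m_inv_closed[OF assms(2)] by simp
  ultimately show "q \<in> normalizer G Q"
    using normalizer_iff[of Q q] subgroup.subset[OF assms(2)] q by blast
qed

lemma (in group) normalizer_of_normal:
  assumes "P \<lhd> G" "finite P"
  shows "normalizer G P = carrier G"
  using assms normalizer_iff[OF assms(2)] normal_inv_iff subgroup.subset by blast

lemma (in group) p_element_in_normal_sylow:
  assumes fin: "finite (carrier G)" and p: "prime p"
    and P: "sylow_subgroup p P G" "P \<lhd> G" and x: "p_element G p x"
  shows "x \<in> P"
proof -
  have "finite P" using fin P(1) subgroup.subset finite_subset unfolding sylow_subgroup_def by metis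
  then show ?thesis
    using p_element_normalizing_sylow[OF fin p P(1) x] normalizer_of_normal[OF P(2)] x
    by (simp add: p_element_def)
qed

text \<open>A conjugate of \<open>Q\<close> is again a Sylow subgroup of \<open>D\<close>, hence it is
already conjugate to \<open>Q\<close> by an element of \<open>D\<close>.\<close>

lemma (in group) frattini_argument:
  assumes fin: "finite (carrier G)" and p: "prime p"
    and D: "D \<lhd> G" and Q: "sylow_subgroup p Q (G\<lparr>carrier := D\<rparr>)"
  shows "D <#> normalizer G Q = carrier G"
proof -
  have DG: "subgroup D G" using D normal_imp_subgroup by blast
  interpret D: group "G\<lparr>carrier := D\<rparr>" by (rule subgroup_imp_group[OF DG])
  have finD: "finite D" using fin DG subgroup.subset finite_subset by blast
  have QD: "subgroup Q (G\<lparr>carrier := D\<rparr>)" and cQ: "card Q = p ^ multiplicity p (card D)"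
    using Q by (auto simp: sylow_subgroup_def order_def)
  have QG: "subgroup Q G" using incl_subgroup[OF DG QD] .
  have QsD: "Q \<subseteq> D" using subgroup.subset[OF QD] by simp
  have finQ: "finite Q" using QsD finD finite_subset by blast
  note niff = normalizer_iff[OF finQ subgroup.subset[OF QG]]
  have "g \<in> D <#> normalizer G Q" if g: "g \<in> carrier G" for g
  proof -
    let ?R = "(\<lambda>x. g \<otimes> x \<otimes> inv g) ` Q"
    have RD: "?R \<subseteq> D" using QsD D g normal_inv_iff by blast
    have "subgroup ?R (G\<lparr>carrier := D\<rparr>)"
      using subgroup_incl[OF subgroup_conj_image[OF g QG] DG RD] .
    moreover have "card ?R = card Q" using card_conj_image[OF g subgroup.subset[OF QG]] .
    ultimately have "sylow_subgroup p ?R (G\<lparr>carrier := D\<rparr>)"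
      using cQ by (simp add: sylow_subgroup_def order_def)
    then obtain d where d: "d \<in> D" "(\<lambda>x. d \<otimes> x \<otimes> inv d) ` ?R = Q"
      using D.sylow_conjugate[OF _ p Q, of ?R] finD m_inv_consistent[OF DG] by auto
    have dG: "d \<in> carrier G" using d subgroup.mem_carrier[OF DG] by blast
    have "(d \<otimes> g) \<otimes> x \<otimes> inv (d \<otimes> g) \<in> Q" if x: "x \<in> Q" for x
      using conj_conj[OF dG g subgroup.mem_carrier[OF QG x]] d(2) x by auto
    then have "d \<otimes> g \<in> normalizer G Q" using niff dG g by simp
    moreover have "inv d \<in> D" using d subgroup.m_inv_closed[OF DG] by blast
    ultimately have "inv d \<otimes> (d \<otimes> g) \<in> D <#> normalizer G Q" by (rule set_multI[rotated])
    then show ?thesis using dG g by (simp add: inv_mult_cancel)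
  qed
  moreover have "D <#> normalizer G Q \<subseteq> carrier G"
    using subgroup.mem_carrier[OF DG] niff by (auto simp: set_mult_def)
  ultimately show ?thesis by blast
qed

section \<open>Coprime action and nilpotent groups\<close>

text \<open>If \<open>x\<close> multiplies \<open>u\<close> by an element \<open>n\<close> that it
centralizes, then \<open>x\<^sup>k\<close> multiplies \<open>u\<close> by \<open>n\<^sup>k\<close>. The
exponent \<open>m\<close> gives \<open>n\<^sup>m = 1\<close>, which forces \<open>n = 1\<close>. All
arguments on coprime action below rest on this.\<close>

lemma (in group) coprime_action_trivial:
  assumes x: "x \<in> carrier G" and u: "u \<in> carrier G" and n: "p_element G p n"
    and comm: "x \<otimes> n = n \<otimes> x" and eq: "x \<otimes> u \<otimes> inv x = n \<otimes> u"
    and m: "x [^] (m::nat) = \<one>" "coprime p m"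
  shows "x \<otimes> u \<otimes> inv x = u"
proof -
  have nG: "n \<in> carrier G" using n by (simp add: p_element_def)
  have eq': "x \<otimes> u = n \<otimes> u \<otimes> x" using eq x u nG inv_solve_right' by auto
  have commk: "x [^] k \<otimes> n = n \<otimes> x [^] k" for k :: nat
    using generate_singleton_commutes[OF x _ nG comm] generate_pow[OF x] x
    by (metis (mono_tags, lifting) int_pow_int mem_Collect_eq UNIV_I)
  have "x [^] k \<otimes> u = n [^] k \<otimes> u \<otimes> x [^] k" for k :: nat
  proof (induction k)
    case 0
    then show ?case using u by simp
  next
    case (Suc k)
    have "x [^] Suc k \<otimes> u = x [^] k \<otimes> (n \<otimes> u \<otimes> x)" using x u eq' by (simp add: m_assoc)
    also have "\<dots> = n \<otimes> (x [^] k \<otimes> u) \<otimes> x" using commk x u nG by (simp flip: m_assoc)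
    also have "\<dots> = n \<otimes> n [^] k \<otimes> u \<otimes> (x [^] k \<otimes> x)" using Suc x u nG by (simp add: m_assoc)
    also have "\<dots> = n [^] Suc k \<otimes> u \<otimes> x [^] Suc k" using nG nat_pow_Suc2 by simp
    finally show ?case .
  qed
  from this[of m] have "u = n [^] m \<otimes> u" using m x u nG by simp
  then have "n [^] m = \<one>" using nG u by simp
  then have "n = \<one>" using p_element_coprime_pow[OF n _ m(2)] by simp
  then show ?thesis using eq u by simp
qed

lemma (in group) quotient_group_hom: "M \<lhd> G \<Longrightarrow> group_hom G (G Mod M) (\<lambda>x. M #> x)"
  using normal.r_coset_hom_Mod normal.factorgroup_is_group
  by (auto simp: group_hom_def group_hom_axioms_def)

lemma (in group) r_coset_eq_iff_mem:
  assumes "subgroup M G" "x \<in> carrier G"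
  shows "M #> x = M \<longleftrightarrow> x \<in> M"
  using assms coset_join1 coset_join2 subgroup.subset by metis

lemma (in group) commutes_mod_iff:
  assumes M: "M \<lhd> G" and z: "z \<in> carrier G" "g \<in> carrier G"
  shows "z \<otimes> g \<otimes> inv z \<otimes> inv g \<in> M \<longleftrightarrow> (M #> z) <#> (M #> g) = (M #> g) <#> (M #> z)"
proof -
  interpret \<pi>: group_hom G "G Mod M" "\<lambda>x. M #> x" by (rule quotient_group_hom[OF M])
  let ?Q = "G Mod M"
  have "z \<otimes> g \<otimes> inv z \<otimes> inv g \<in> carrier G" using z by simp
  then have "z \<otimes> g \<otimes> inv z \<otimes> inv g \<in> M \<longleftrightarrow> M #> (z \<otimes> g \<otimes> inv z \<otimes> inv g) = \<one>\<^bsub>?Q\<^esub>"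
    unfolding one_FactGroup using r_coset_eq_iff_mem[OF normal_imp_subgroup[OF M]] by blast
  also have "M #> (z \<otimes> g \<otimes> inv z \<otimes> inv g) = M #> ((z \<otimes> g) \<otimes> inv (g \<otimes> z))"
    using z by (simp add: m_assoc inv_mult_group)
  also have "\<dots> = (M #> (z \<otimes> g)) \<otimes>\<^bsub>?Q\<^esub> inv\<^bsub>?Q\<^esub> (M #> (g \<otimes> z))"
    using z \<pi>.hom_mult[of "z \<otimes> g" "inv (g \<otimes> z)"] \<pi>.hom_inv[of "g \<otimes> z"] by (simp only: m_closed inv_closed)
  also have "\<dots> = \<one>\<^bsub>?Q\<^esub> \<longleftrightarrow> (M #> (z \<otimes> g)) = (M #> (g \<otimes> z))"
    using z \<pi>.hom_closed \<pi>.H.inv_solve_right[of "\<one>\<^bsub>?Q\<^esub>" "M #> (z \<otimes> g)" "M #> (g \<otimes> z)"]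
    by (metis \<pi>.H.inv_closed \<pi>.H.l_one \<pi>.H.one_closed m_closed)
  also have "\<dots> \<longleftrightarrow> (M #> z) <#> (M #> g) = (M #> g) <#> (M #> z)"
    using \<pi>.hom_mult z by simp
  finally show ?thesis .
qed

text \<open>The kernel of the conjugation action of \<open>G\<close> on the section
\<open>TM/M\<close>.\<close>

lemma (in group) centralizer_mod_normal:
  assumes M: "M \<lhd> G" and T: "T \<lhd> G"
  shows "{z \<in> carrier G. \<forall>t\<in>T. z \<otimes> t \<otimes> inv z \<otimes> inv t \<in> M} \<lhd> G" (is "?C \<lhd> G")
proof -
  have MG: "subgroup M G" and TG: "subgroup T G" using M T normal_imp_subgroup by auto
  note [simp] = subgroup.mem_carrier[OF MG] subgroup.mem_carrier[OF TG]
  have Mn: "g \<otimes> m \<otimes> inv g \<in> M" if "g \<in> carrier G" "m \<in> M" for g m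
    using that M normal_inv_iff by blast
  have Tn: "g \<otimes> m \<otimes> inv g \<in> T" if "g \<in> carrier G" "m \<in> T" for g m
    using that T normal_inv_iff by blast
  have "subgroup ?C G"
  proof (rule subgroupI)
    show "?C \<noteq> {}" using subgroup.one_closed[OF MG] by (auto intro!: exI[of _ \<one>])
  next
    fix z assume z: "z \<in> ?C"
    have "inv z \<otimes> t \<otimes> inv (inv z) \<otimes> inv t \<in> M" if t: "t \<in> T" for t
    proof -
      have "inv (z \<otimes> t \<otimes> inv z \<otimes> inv t) \<in> M" using z t subgroup.m_inv_closed[OF MG] by blast
      then have "inv z \<otimes> inv (z \<otimes> t \<otimes> inv z \<otimes> inv t) \<otimes> inv (inv z) \<in> M" using z Mn by blast
      then show ?thesis using z t by (simp add: m_assoc inv_mult_group inv_mult_cancel)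
    qed
    then show "inv z \<in> ?C" using z by blast
  next
    fix z w assume zw: "z \<in> ?C" "w \<in> ?C"
    have "(z \<otimes> w) \<otimes> t \<otimes> inv (z \<otimes> w) \<otimes> inv t \<in> M" if t: "t \<in> T" for t
    proof -
      have "(z \<otimes> (w \<otimes> t \<otimes> inv w \<otimes> inv t) \<otimes> inv z) \<otimes> (z \<otimes> t \<otimes> inv z \<otimes> inv t) \<in> M"
        using zw t Mn[of z "w \<otimes> t \<otimes> inv w \<otimes> inv t"] by (blast intro: subgroup.m_closed[OF MG])
      then show ?thesis using zw t by (simp add: m_assoc inv_mult_group inv_mult_cancel)
    qed
    then show "z \<otimes> w \<in> ?C" using zw by blast
  qed auto
  moreover have "g \<otimes> z \<otimes> inv g \<in> ?C" if g: "g \<in> carrier G" and z: "z \<in> ?C" for g z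
  proof -
    have "(g \<otimes> z \<otimes> inv g) \<otimes> t \<otimes> inv (g \<otimes> z \<otimes> inv g) \<otimes> inv t \<in> M" if t: "t \<in> T" for t
    proof -
      define s where "s = inv g \<otimes> t \<otimes> g"
      have s: "s \<in> T" using Tn[of "inv g" t] g t by (simp add: s_def)
      have "g \<otimes> (z \<otimes> s \<otimes> inv z \<otimes> inv s) \<otimes> inv g \<in> M"
        using z s g by (intro Mn) auto
      then show ?thesis using z t g by (simp add: s_def m_assoc inv_mult_group inv_mult_cancel)
    qed
    then show ?thesis using g z by blast
  qed
  ultimately show ?thesis using normal_inv_iff by blast
qed

text \<open>The centre of the \<open>p\<close>-group \<open>G/M\<close> is nontrivial: it consists of the
fixed points of \<open>G\<close> acting on \<open>G/M\<close> by conjugation, and their number is positive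
and divisible by \<open>p\<close>.\<close>

lemma (in group) p_group_center_mod_normal:
  assumes fin: "finite (carrier G)" and p: "prime p" and ord: "order G = p ^ n"
    and M: "M \<lhd> G" "M \<noteq> carrier G"
  shows "\<exists>z\<in>carrier G - M. \<forall>g\<in>carrier G. z \<otimes> g \<otimes> inv z \<otimes> inv g \<in> M"
proof -
  let ?Q = "G Mod M"
  interpret \<pi>: group_hom G ?Q "\<lambda>x. M #> x" by (rule quotient_group_hom[OF M(1)])
  have MG: "subgroup M G" using M(1) normal_imp_subgroup by blast
  let ?act = "\<lambda>g X. (M #> g) \<otimes>\<^bsub>?Q\<^esub> X \<otimes>\<^bsub>?Q\<^esub> inv\<^bsub>?Q\<^esub> (M #> g)"
  let ?Fix = "{e \<in> carrier ?Q. \<forall>g\<in>carrier G. ?act g e = e}"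
  have finQ: "finite (carrier ?Q)" using fin by (simp add: carrier_FactGroup)
  have dv: "p dvd card (carrier ?Q - ?Fix)"
    using finQ by (intro prime_dvd_card_nonfixed_points[OF p ord])
      (simp_all add: \<pi>.H.m_assoc \<pi>.H.inv_mult_group del: mult_FactGroup one_FactGroup coset_mult_one)
  have cQ: "card (carrier ?Q) * card M = order G"
    using lagrange[OF MG] by (simp add: FactGroup_def)
  have "p dvd card (carrier ?Q)"
  proof -
    have "card (carrier ?Q) dvd p ^ n" using cQ ord by (metis dvd_triv_left)
    then obtain j where j: "card (carrier ?Q) = p ^ j" using p divides_primepow_nat by blast
    have "j \<noteq> 0"
    proof
      assume "j = 0"
      then have "card M = card (carrier G)" using cQ j by (simp add: order_def)
      then show False using card_subset_eq[OF fin subgroup.subset[OF MG]] M(2) by blast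
    qed
    then show ?thesis using j by (simp add: dvd_power)
  qed
  moreover have "card (carrier ?Q) = card (carrier ?Q - ?Fix) + card ?Fix"
  proof -
    have "?Fix \<subseteq> carrier ?Q" by blast
    then show ?thesis using finQ card_Diff_subset[of ?Fix "carrier ?Q"] card_mono[of "carrier ?Q" ?Fix]
        finite_subset[of ?Fix "carrier ?Q"] by linarith
  qed
  ultimately have "p dvd card (carrier ?Q - ?Fix) + card ?Fix" by (simp only:)
  then have pF: "p dvd card ?Fix" using dvd_add_right_iff[OF dv] by blast
  have "\<one>\<^bsub>?Q\<^esub> \<in> ?Fix" by (simp del: one_FactGroup mult_FactGroup)
  have "?Fix \<noteq> {\<one>\<^bsub>?Q\<^esub>}"
  proof
    assume "?Fix = {\<one>\<^bsub>?Q\<^esub>}"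
    then have "p dvd 1" using pF by simp
    then show False using p by simp
  qed
  then obtain X where X: "X \<in> ?Fix" "X \<noteq> \<one>\<^bsub>?Q\<^esub>" using \<open>\<one>\<^bsub>?Q\<^esub> \<in> ?Fix\<close> by blast
  then obtain z where z: "z \<in> carrier G" "X = M #> z" by (auto simp: carrier_FactGroup)
  have "z \<notin> M" using X(2) z r_coset_eq_iff_mem[OF MG z(1)] by auto
  moreover have "z \<otimes> g \<otimes> inv z \<otimes> inv g \<in> M" if g: "g \<in> carrier G" for g
  proof -
    have "?act g X = X" using X(1) g by blast
    then have "(M #> g) \<otimes>\<^bsub>?Q\<^esub> X = X \<otimes>\<^bsub>?Q\<^esub> (M #> g)"
      using \<pi>.H.inv_solve_right'[of X "(M #> g) \<otimes>\<^bsub>?Q\<^esub> X" "M #> g"] g z \<pi>.hom_closed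
      by (metis \<pi>.H.m_closed)
    then show ?thesis using commutes_mod_iff[OF M(1) z(1) g] z(2) by simp
  qed
  ultimately show ?thesis using z(1) by blast
qed

text \<open>Climb the lower central series from its trivial term. If \<open>x\<close> centralizes the part
of \<open>P\<close> in one term, then it multiplies an element of \<open>P\<close> in the preceding term by
a commutator that it centralizes, so the lemma on coprime action applies.\<close>

lemma (in group) nilpotent_coprime_commute:
  assumes nil: "nilpotent_group G" and P: "p_subgroup p P G"
    and x: "x \<in> carrier G" "x [^] (m::nat) = \<one>" "coprime p m"
    and norm: "\<And>u. u \<in> P \<Longrightarrow> x \<otimes> u \<otimes> inv x \<in> P" and u: "u \<in> P"
  shows "x \<otimes> u = u \<otimes> x"
proof -
  obtain n where n: "lower_central G n = {\<one>}" using nil by (auto simp: nilpotent_group_def)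
  have PG: "subgroup P G" using P by (auto simp: p_subgroup_def)
  note [simp] = subgroup.mem_carrier[OF PG]
  have "\<forall>u \<in> P \<inter> lower_central G (n - j). x \<otimes> u \<otimes> inv x = u" for j
  proof (induction j)
    case 0
    then show ?case using n x by simp
  next
    case (Suc j)
    show ?case
    proof (cases "n - j")
      case 0
      then show ?thesis using Suc by simp
    next
      case (Suc i)
      then have i: "n - Suc j = i" by simp
      show ?thesis
      proof
        fix u assume u: "u \<in> P \<inter> lower_central G (n - Suc j)"
        let ?c = "x \<otimes> u \<otimes> inv x \<otimes> inv u"
        have cG: "u \<otimes> x \<otimes> inv u \<otimes> inv x \<in> lower_central G (n - j)"
          using u x(1) by (auto simp: i \<open>n - j = Suc i\<close> intro!: generate.incl)
        moreover have "?c \<in> P"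
          using u norm subgroup.m_closed[OF PG] subgroup.m_inv_closed[OF PG] by blast
        moreover have "inv ?c = u \<otimes> x \<otimes> inv u \<otimes> inv x"
          using u x(1) by (simp add: m_assoc inv_mult_group)
        ultimately have "inv ?c \<in> P \<inter> lower_central G (n - j)"
          using subgroup.m_inv_closed[OF PG] by (metis IntI)
        then have *: "x \<otimes> inv ?c \<otimes> inv x = inv ?c" using Suc.IH by blast
        have "x \<otimes> ?c = ?c \<otimes> x"
        proof -
          have "inv (x \<otimes> ?c \<otimes> inv x) = inv ?c" using * conj_inv[of x ?c] x(1) u by simp
          then have "x \<otimes> ?c \<otimes> inv x = ?c" using x(1) u by (metis IntD1 \<open>?c \<in> P\<close> inv_closed inv_inv m_closed subgroup.mem_carrier[OF PG])
          then show ?thesis using x(1) u inv_solve_right' by simp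
        qed
        moreover have "p_element G p ?c" using p_subgroup_p_element[OF P \<open>?c \<in> P\<close>] .
        moreover have "x \<otimes> u \<otimes> inv x = ?c \<otimes> u" using x(1) u by (simp add: m_assoc)
        ultimately show "x \<otimes> u \<otimes> inv x = u"
          using coprime_action_trivial[of x u p ?c m] x u by simp
      qed
    qed
  qed
  from this[of n] have "x \<otimes> u \<otimes> inv x = u" using u by simp
  then show ?thesis using x(1) u inv_solve_right' by simp
qed

primrec upper_central :: "('a, 'b) monoid_scheme \<Rightarrow> nat \<Rightarrow> 'a set" where
  "upper_central G 0 = {\<one>\<^bsub>G\<^esub>}"
| "upper_central G (Suc n) = {z \<in> carrier G. \<forall>g\<in>carrier G.
     z \<otimes>\<^bsub>G\<^esub> g \<otimes>\<^bsub>G\<^esub> inv\<^bsub>G\<^esub> z \<otimes>\<^bsub>G\<^esub> inv\<^bsub>G\<^esub> g \<in> upper_central G n}"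

lemma (in group) upper_central_normal: "upper_central G n \<lhd> G"
proof (induction n)
  case (Suc n)
  then show ?case using centralizer_mod_normal[OF Suc normal_self] by simp
qed (simp add: one_is_normal)

text \<open>The hypothesis says that proper quotients have a nontrivial centre. Then the upper central
series grows strictly until it reaches \<open>G\<close>, and the lower central series descends at least as
fast.\<close>

lemma (in group) nilpotent_if_central_chain:
  assumes fin: "finite (carrier G)"
    and step: "\<And>M. M \<lhd> G \<Longrightarrow> M \<noteq> carrier G \<Longrightarrow>
      \<exists>z\<in>carrier G - M. \<forall>g\<in>carrier G. z \<otimes> g \<otimes> inv z \<otimes> inv g \<in> M"
  shows "nilpotent_group G"
proof -
  have sub: "upper_central G n \<subseteq> carrier G" for n
    using upper_central_normal normal_imp_subgroup subgroup.subset by blast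
  have mono: "upper_central G n \<subseteq> upper_central G (Suc n)" for n
  proof
    fix z assume z: "z \<in> upper_central G n"
    have U: "subgroup (upper_central G n) G" using upper_central_normal normal_imp_subgroup by blast
    have "z \<otimes> g \<otimes> inv z \<otimes> inv g \<in> upper_central G n" if g: "g \<in> carrier G" for g
    proof -
      have zG: "z \<in> carrier G" using z sub by blast
      have "g \<otimes> inv z \<otimes> inv g \<in> upper_central G n"
        using z g upper_central_normal normal_inv_iff subgroup.m_inv_closed[OF U] by blast
      then have "z \<otimes> (g \<otimes> inv z \<otimes> inv g) \<in> upper_central G n" using z subgroup.m_closed[OF U] by blast
      then show ?thesis using zG g by (simp add: m_assoc)
    qed
    then show "z \<in> upper_central G (Suc n)" using z sub by auto
  qed
  have "upper_central G n = carrier G \<or> n < card (upper_central G n)" for n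
  proof (induction n)
    case 0
    then show ?case by simp
  next
    case (Suc n)
    show ?case
    proof (cases "upper_central G n = carrier G")
      case True
      then show ?thesis using mono[of n] sub[of "Suc n"] by blast
    next
      case False
      then obtain z where "z \<in> carrier G - upper_central G n" "z \<in> upper_central G (Suc n)"
        using step[OF upper_central_normal False] by auto
      then have "upper_central G n \<subset> upper_central G (Suc n)" using mono[of n] by blast
      then have "card (upper_central G n) < card (upper_central G (Suc n))"
        using psubset_card_mono[OF finite_subset[OF sub fin]] by blast
      then show ?thesis using Suc False by simp
    qed
  qed
  moreover have "card (upper_central G n) \<le> card (carrier G)" for n using card_mono[OF fin sub] .
  ultimately obtain n where n: "upper_central G n = carrier G" by (meson not_le)
  have "lower_central G i \<subseteq> upper_central G (n - i)" if "i \<le> n" for i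
    using that
  proof (induction i)
    case 0
    then show ?case using n by simp
  next
    case (Suc i)
    then have eq: "n - i = Suc (n - Suc i)" by simp
    have U: "subgroup (upper_central G (n - Suc i)) G" using upper_central_normal normal_imp_subgroup by blast
    have IH: "lower_central G i \<subseteq> upper_central G (Suc (n - Suc i))" using Suc eq by simp
    show ?case
      unfolding lower_central.simps
    proof (rule generate_subgroup_incl[OF _ U])
      show "{x \<otimes> y \<otimes> inv x \<otimes> inv y |x y. x \<in> lower_central G i \<and> y \<in> carrier G}
        \<subseteq> upper_central G (n - Suc i)" using IH by auto
    qed
  qed
  from this[of n] have "lower_central G n \<subseteq> {\<one>}" by simp
  moreover have "\<one> \<in> lower_central G n" by (cases n) (auto intro: generate.one)
  ultimately show ?thesis unfolding nilpotent_group_def by blast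
qed

text \<open>Every element of \<open>G\<close> acts on \<open>A\<close> like an element of \<open>A\<close>,
so an element of \<open>A\<close> that is central modulo \<open>M\<close> in \<open>A\<close> is central
modulo \<open>M\<close> in \<open>G\<close>.\<close>

lemma (in group) p_subgroup_center_mod_normal:
  assumes fin: "finite (carrier G)" and p: "prime p" and A: "p_subgroup p A G"
    and M: "M \<lhd> G" "\<not> A \<subseteq> M"
    and dec: "\<And>g. g \<in> carrier G \<Longrightarrow> \<exists>a\<in>A. \<exists>b\<in>carrier G. g = a \<otimes> b \<and> (\<forall>a\<in>A. a \<otimes> b = b \<otimes> a)"
  shows "\<exists>z\<in>carrier G - M. \<forall>g\<in>carrier G. z \<otimes> g \<otimes> inv z \<otimes> inv g \<in> M"
proof -
  have AG: "subgroup A G" using A by (auto simp: p_subgroup_def)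
  obtain n where n: "card A = p ^ n" using A by (auto simp: p_subgroup_def)
  interpret A: group "G\<lparr>carrier := A\<rparr>" by (rule subgroup_imp_group[OF AG])
  note [simp] = subgroup.mem_carrier[OF AG]
  have finA: "finite A" using fin AG subgroup.subset finite_subset by blast
  have MA: "M \<inter> A \<lhd> G\<lparr>carrier := A\<rparr>" using normal_Int_subgroup[OF AG M(1)] by simp
  obtain z where z: "z \<in> A - M" "\<And>a. a \<in> A \<Longrightarrow> z \<otimes> a \<otimes> inv z \<otimes> inv a \<in> M"
    using A.p_group_center_mod_normal[OF _ p _ MA, of n] finA n M(2) m_inv_consistent[OF AG]
    by (auto simp: order_def)
  have "z \<otimes> g \<otimes> inv z \<otimes> inv g \<in> M" if g: "g \<in> carrier G" for g
  proof -
    obtain a b where ab: "a \<in> A" "b \<in> carrier G" "g = a \<otimes> b" "\<And>a. a \<in> A \<Longrightarrow> a \<otimes> b = b \<otimes> a"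
      using dec[OF g] by blast
    have iz: "inv z \<in> A" using z(1) subgroup.m_inv_closed[OF AG] by blast
    have "z \<otimes> g \<otimes> inv z \<otimes> inv g = z \<otimes> a \<otimes> (b \<otimes> inv z) \<otimes> (inv b \<otimes> inv a)"
      unfolding ab(3) using ab(1,2) z(1) by (simp add: m_assoc inv_mult_group)
    also have "b \<otimes> inv z = inv z \<otimes> b" using ab(4)[OF iz] by simp
    also have "z \<otimes> a \<otimes> (inv z \<otimes> b) \<otimes> (inv b \<otimes> inv a) = z \<otimes> a \<otimes> inv z \<otimes> inv a"
      using ab(1,2) z(1) by (simp add: m_assoc inv_mult_cancel)
    finally show ?thesis using z(2) ab(1) by simp
  qed
  moreover have "z \<in> carrier G - M" using z(1) by simp
  ultimately show ?thesis by blast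
qed

text \<open>A proper normal subgroup fails to contain one of the two factors, and this factor supplies an
element that is central modulo the normal subgroup.\<close>

lemma (in group) nilpotent_commuting_product:
  assumes fin: "finite (carrier G)" and pq: "prime p" "prime q"
    and A: "p_subgroup p A G" and B: "p_subgroup q B G" and AB: "carrier G = A <#> B"
    and comm: "\<And>a b. a \<in> A \<Longrightarrow> b \<in> B \<Longrightarrow> a \<otimes> b = b \<otimes> a"
  shows "nilpotent_group G"
proof (rule nilpotent_if_central_chain[OF fin])
  fix M assume M: "M \<lhd> G" "M \<noteq> carrier G"
  have AG: "subgroup A G" "subgroup B G" "subgroup M G"
    using A B M normal_imp_subgroup by (auto simp: p_subgroup_def)
  have "\<not> (A \<subseteq> M \<and> B \<subseteq> M)"
  proof
    assume "A \<subseteq> M \<and> B \<subseteq> M"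
    then have "x \<in> M" if "x \<in> A <#> B" for x
      using that \<open>A \<subseteq> M \<and> B \<subseteq> M\<close> by (elim set_multE) (auto intro: subgroup.m_closed[OF AG(3)])
    then have "carrier G \<subseteq> M" using AB by blast
    then show False using M(2) subgroup.subset[OF AG(3)] by blast
  qed
  then consider "\<not> A \<subseteq> M" | "\<not> B \<subseteq> M" by blast
  then show "\<exists>z\<in>carrier G - M. \<forall>g\<in>carrier G. z \<otimes> g \<otimes> inv z \<otimes> inv g \<in> M"
  proof cases
    case 1
    then show ?thesis
    proof (rule p_subgroup_center_mod_normal[OF fin pq(1) A M(1)])
      fix g assume "g \<in> carrier G"
      then obtain a b where "a \<in> A" "b \<in> B" "g = a \<otimes> b" unfolding AB by (elim set_multE)
      then show "\<exists>a\<in>A. \<exists>b\<in>carrier G. g = a \<otimes> b \<and> (\<forall>a\<in>A. a \<otimes> b = b \<otimes> a)"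
        using comm subgroup.mem_carrier[OF AG(2)] by blast
    qed
  next
    case 2
    then show ?thesis
    proof (rule p_subgroup_center_mod_normal[OF fin pq(2) B M(1)])
      fix g assume "g \<in> carrier G"
      then obtain a b where "a \<in> A" "b \<in> B" "g = a \<otimes> b" unfolding AB by (elim set_multE)
      then show "\<exists>a\<in>B. \<exists>b\<in>carrier G. g = a \<otimes> b \<and> (\<forall>a\<in>B. a \<otimes> b = b \<otimes> a)"
        using comm subgroup.mem_carrier[OF AG(1)] by (intro bexI[of _ b] bexI[of _ a]) auto
    qed
  qed
qed

section \<open>Soluble groups and normal subgroups of nongenerators\<close>

lemma (in group_hom) card_img_mult_kernel:
  "card (h ` carrier G) * card (kernel G H h) = order G"
proof -
  interpret im: group "H\<lparr>carrier := h ` carrier G\<rparr>"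
    using H.subgroup_imp_group[OF img_is_subgroup] .
  interpret h': group_hom G "H\<lparr>carrier := h ` carrier G\<rparr>" h
    by unfold_locales (auto simp: hom_def)
  have ker: "kernel G (H\<lparr>carrier := h ` carrier G\<rparr>) h = kernel G H h"
    by (simp add: kernel_def)
  have "card (carrier (G Mod kernel G H h)) = card (h ` carrier G)"
    using iso_same_card[OF h'.FactGroup_iso] ker by simp
  then show ?thesis using G.lagrange[OF subgroup_kernel] by (simp add: FactGroup_def)
qed

lemma (in group_hom) card_subgroup_img_mult:
  assumes "subgroup P G"
  shows "card (h ` P) * card (P \<inter> kernel G H h) = card P"
proof -
  interpret P: group "G\<lparr>carrier := P\<rparr>" using G.subgroup_imp_group[OF assms] .
  interpret h': group_hom "G\<lparr>carrier := P\<rparr>" H h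
    using subgroup.mem_carrier[OF assms] by unfold_locales (auto simp: hom_def)
  have "kernel (G\<lparr>carrier := P\<rparr>) H h = P \<inter> kernel G H h"
    using subgroup.mem_carrier[OF assms] by (auto simp: kernel_def)
  then show ?thesis using h'.card_img_mult_kernel by (simp add: order_def)
qed

lemma (in group_hom) p_subgroup_img:
  assumes "p_subgroup p P G" "prime p"
  shows "p_subgroup p (h ` P) H"
proof -
  from assms obtain k where P: "subgroup P G" "card P = p ^ k" by (auto simp: p_subgroup_def)
  then have "card (h ` P) dvd p ^ k" using card_subgroup_img_mult by (metis dvd_triv_left)
  then obtain j where "card (h ` P) = p ^ j" using assms(2) divides_primepow_nat by blast
  then show ?thesis using subgroup_img_is_subgroup[OF P(1)] by (auto simp: p_subgroup_def)
qed

text \<open>The order of \<open>P\<close> is the product of the orders of its image and of its part in the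
kernel. Each divides the \<open>p\<close>-part of the respective group, and the product of these
\<open>p\<close>-parts is the order of \<open>P\<close>, so each equals the \<open>p\<close>-part that it
divides.\<close>

lemma (in group_hom) sylow_img:
  assumes fin: "finite (carrier G)" and p: "prime p" and P: "sylow_subgroup p P G"
    and surj: "h ` carrier G = carrier H"
  shows "sylow_subgroup p (h ` P) H"
proof -
  let ?K = "kernel G H h"
  have PG: "subgroup P G" and cP: "card P = p ^ multiplicity p (order G)"
    using P by (auto simp: sylow_subgroup_def)
  have o: "order G \<noteq> 0" using fin G.order_gt_0_iff_finite by simp
  have eq: "order H * card ?K = order G" using card_img_mult_kernel surj by (simp add: order_def)
  have nz: "order H \<noteq> 0" "card ?K \<noteq> 0" using eq o by (metis mult_zero_left, metis mult_zero_right)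
  have m: "multiplicity p (order G) = multiplicity p (order H) + multiplicity p (card ?K)"
    using prime_elem_multiplicity_mult_distrib[of p "order H" "card ?K"] nz p eq
    by (metis prime_imp_prime_elem)
  obtain a where a: "card (h ` P) = p ^ a"
    using p_subgroup_img[OF sylow_imp_p_subgroup[OF P] p] by (auto simp: p_subgroup_def)
  have e: "card (h ` P) * card (P \<inter> ?K) = card P" using card_subgroup_img_mult[OF PG] .
  have "card (P \<inter> ?K) dvd card P" using e by (metis dvd_triv_right)
  then obtain b where b: "card (P \<inter> ?K) = p ^ b" using cP p divides_primepow_nat by metis
  have "a + b = multiplicity p (order G)"
    using e a b cP p by (metis power_add power_inject_exp prime_gt_1_nat)
  moreover have "p ^ b dvd card ?K"
    using b G.card_subgroup_dvd_card[OF G.subgroups_Inter_pair[OF PG subgroup_kernel] subgroup_kernel]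
    by simp
  then have "b \<le> multiplicity p (card ?K)" using nz p by (metis multiplicity_geI not_prime_unit)
  moreover have "p ^ a dvd order H"
    using a H.card_subgroup_dvd[OF subgroup_img_is_subgroup[OF PG]] by simp
  then have "a \<le> multiplicity p (order H)" using nz p by (metis multiplicity_geI not_prime_unit)
  ultimately have "a = multiplicity p (order H)" using m by linarith
  then show ?thesis using a subgroup_img_is_subgroup[OF PG] by (simp add: sylow_subgroup_def)
qed

lemma (in group_hom) vimage_subgroup:
  assumes "subgroup Y H"
  shows "subgroup {g \<in> carrier G. h g \<in> Y} G"
proof (rule G.subgroupI)
  show "{g \<in> carrier G. h g \<in> Y} \<noteq> {}"
    using subgroup.one_closed[OF assms] by (auto intro!: exI[of _ "\<one>\<^bsub>G\<^esub>"])
qed (use subgroup.m_closed[OF assms] subgroup.m_inv_closed[OF assms] in auto)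

lemma (in group_hom) vimage_normal:
  assumes "Y \<lhd> H"
  shows "{g \<in> carrier G. h g \<in> Y} \<lhd> G"
proof -
  have "h (x \<otimes> g \<otimes> inv x) \<in> Y" if "x \<in> carrier G" "g \<in> carrier G" "h g \<in> Y" for x g
    using that normal.inv_op_closed2[OF assms, of "h x" "h g"] by simp
  then show ?thesis
    using vimage_subgroup[OF normal_imp_subgroup[OF assms]] G.normal_inv_iff by simp
qed

lemma (in group) set_mult_subset_subgroup:
  "subgroup H G \<Longrightarrow> A \<subseteq> H \<Longrightarrow> B \<subseteq> H \<Longrightarrow> A <#> B \<subseteq> H"
  by (auto simp: set_mult_def intro: subgroup.m_closed)

text \<open>The witness is the intersection of all Sylow \<open>p\<close>-subgroups, the group usually
called \<open>O\<^sub>p(G)\<close>.\<close>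

lemma (in group) p_core_exists:
  assumes fin: "finite (carrier G)" and p: "prime p"
  shows "\<exists>T. T \<lhd> G \<and> p_subgroup p T G \<and> (\<forall>P. sylow_subgroup p P G \<longrightarrow> T \<subseteq> P)
    \<and> (\<forall>D. D \<lhd> G \<longrightarrow> p_subgroup p D G \<longrightarrow> D \<subseteq> T)"
proof -
  let ?S = "{P. sylow_subgroup p P G}"
  let ?T = "\<Inter>?S"
  obtain P where P: "sylow_subgroup p P G" using sylow_subgroup_exists[OF fin p] by blast
  have T: "subgroup ?T G" using P by (intro subgroups_Inter) (auto simp: sylow_subgroup_def)
  have "g \<otimes> t \<otimes> inv g \<in> Q" if g: "g \<in> carrier G" and t: "t \<in> ?T" and Q: "sylow_subgroup p Q G" for g t Q
  proof -
    have "t \<in> (\<lambda>x. inv g \<otimes> x \<otimes> inv (inv g)) ` Q" using sylow_conj_image[OF _ Q, of "inv g"] g t by blast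
    then obtain x where x: "x \<in> Q" "t = inv g \<otimes> x \<otimes> inv (inv g)" by blast
    then have "g \<otimes> t \<otimes> inv g = x"
      using g Q subgroup.mem_carrier[of Q G x] by (simp add: m_assoc inv_mult_cancel sylow_subgroup_def)
    then show ?thesis using x by simp
  qed
  then have n: "?T \<lhd> G" using T normal_inv_iff by blast
  have "p_element G p x" if "x \<in> ?T" for x
    using that P p_subgroup_p_element[OF sylow_imp_p_subgroup[OF P]] by blast
  then have "p_subgroup p ?T G" using p_subgroup_if_p_elements[OF fin p T] by blast
  then show ?thesis using n normal_p_subgroup_le_sylow[OF fin p] by (intro exI[of _ ?T]) blast
qed

text \<open>Let \<open>k\<close> be the least positive exponent that takes \<open>a\<close> into
\<open>T\<close>, and \<open>r\<close> a prime divisor of \<open>k\<close>; then \<open>m = k / r\<close>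
works.\<close>

lemma (in group) least_power_prime:
  assumes fin: "finite (carrier G)" and T: "subgroup T G" and a: "a \<in> carrier G - T"
  shows "\<exists>(r::nat) m. prime r \<and> a [^] (m::nat) \<notin> T \<and> (a [^] m) [^] r \<in> T"
proof -
  define k where "k = (LEAST n::nat. 0 < n \<and> a [^] n \<in> T)"
  have "order G > 0" using fin order_gt_0_iff_finite by blast
  then have "0 < order G \<and> a [^] order G \<in> T"
    using pow_order_eq_1 a subgroup.one_closed[OF T] by simp
  then have k: "0 < k" "a [^] k \<in> T" unfolding k_def by (metis (mono_tags, lifting) LeastI)+
  have least: "a [^] n \<notin> T" if "0 < n" "n < k" for n
    using that not_less_Least unfolding k_def by blast
  have "k \<noteq> 1" using k a by auto
  then obtain r where r: "prime r" "r dvd k" using prime_factor_nat by blast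
  then obtain m where m: "k = m * r" by (metis dvd_div_mult_self)
  have "0 < m" "m < k" using m k r prime_gt_1_nat[OF r(1)] by auto
  then show ?thesis using least[of m] k r m a nat_pow_pow by (intro exI[of _ r] exI[of _ m]) simp
qed

text \<open>The last term \<open>A\<close> of the derived series of \<open>C\<close> that is not contained
in \<open>T\<close> is abelian modulo \<open>T\<close>. Hence its elements whose \<open>r\<close>-th power
lies in \<open>T\<close> form a subgroup, for any prime \<open>r\<close>, and for a suitable
\<open>r\<close> it is not contained in \<open>T\<close>.\<close>

lemma (in group) solvable_layer:
  assumes fin: "finite (carrier G)" and sol: "solvable G"
    and T: "T \<lhd> G" and C: "C \<lhd> G" "\<not> C \<subseteq> T"
  shows "\<exists>D r. D \<lhd> G \<and> D \<subseteq> C \<and> \<not> D \<subseteq> T \<and> prime r \<and> (\<forall>d\<in>D. d [^] (r::nat) \<in> T)"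
proof -
  define A where "A = (\<lambda>i. (derived G ^^ i) C)"
  have TG: "subgroup T G" using T normal_imp_subgroup by blast
  have An: "A i \<lhd> G" for i
    by (induction i) (auto simp: A_def C(1) derived_is_normal)
  have AG: "subgroup (A i) G" for i using An normal_imp_subgroup by blast
  have AC: "A i \<subseteq> C" for i
    unfolding A_def by (induction i) (auto intro: derived_incl dest: subsetD[OF derived_incl[OF _ normal_imp_subgroup[OF C(1)]]])
  obtain n where n: "(derived G ^^ n) (carrier G) = {\<one>}"
    using sol solvable_iff_trivial_derived_seq by blast
  have "A n \<subseteq> {\<one>}"
    unfolding A_def n[symmetric]
    by (rule mono_exp_of_derived[OF subgroup.subset[OF normal_imp_subgroup[OF C(1)]]])
  then have "A n \<subseteq> T" using subgroup.one_closed[OF TG] by blast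
  then have ex: "\<exists>n. A n \<subseteq> T" by blast
  define i where "i = (LEAST n. A n \<subseteq> T)"
  have i: "A i \<subseteq> T" unfolding i_def using ex by (rule LeastI_ex)
  have "i \<noteq> 0" using i C(2) by (auto simp: A_def)
  then obtain j where j: "i = Suc j" using not0_implies_Suc by blast
  have Aj: "\<not> A j \<subseteq> T" using not_less_Least[of j "\<lambda>n. A n \<subseteq> T"] j by (simp add: i_def)
  have comm: "a \<otimes> b \<otimes> inv a \<otimes> inv b \<in> T" if "a \<in> A j" "b \<in> A j" for a b
  proof -
    have "a \<otimes> b \<otimes> inv a \<otimes> inv b \<in> derived G (A j)"
      using that unfolding derived_def by (intro generate.incl) blast
    then show ?thesis using i j by (auto simp: A_def)
  qed
  obtain a where a: "a \<in> A j" "a \<notin> T" using Aj by blast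
  note AjG = subgroup.mem_carrier[OF AG[of j]]
  obtain r m :: nat where r: "prime r" "a [^] (m::nat) \<notin> T" "(a [^] m) [^] r \<in> T"
    using least_power_prime[OF fin TG, of a] a AjG by blast
  interpret \<pi>: group_hom G "G Mod T" "\<lambda>x. T #> x" by (rule quotient_group_hom[OF T])
  define D where "D = {d \<in> A j. d [^] r \<in> T}"
  have piff: "d [^] r \<in> T \<longleftrightarrow> (T #> d) [^]\<^bsub>G Mod T\<^esub> r = \<one>\<^bsub>G Mod T\<^esub>" if "d \<in> A j" for d
  proof -
    have "d [^] r \<in> carrier G" using AjG[OF that] by simp
    then have "d [^] r \<in> T \<longleftrightarrow> T #> (d [^] r) = T" using r_coset_eq_iff_mem[OF TG] by blast
    then show ?thesis using \<pi>.hom_nat_pow[OF AjG[OF that]] by simp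
  qed
  have "subgroup D G"
  proof (rule subgroupI)
    show "D \<subseteq> carrier G" using AjG by (auto simp: D_def)
    show "D \<noteq> {}"
      using subgroup.one_closed[OF AG] subgroup.one_closed[OF TG] by (auto simp: D_def intro!: exI[of _ \<one>])
  next
    fix d assume "d \<in> D"
    then show "inv d \<in> D"
      using subgroup.m_inv_closed[OF AG] subgroup.m_inv_closed[OF TG] AjG by (auto simp: D_def nat_pow_inv)
  next
    fix d e assume de: "d \<in> D" "e \<in> D"
    then have mem: "d \<in> A j" "e \<in> A j" by (auto simp: D_def)
    note c = AjG[OF mem(1)] AjG[OF mem(2)]
    have "(T #> d) \<otimes>\<^bsub>G Mod T\<^esub> (T #> e) = (T #> e) \<otimes>\<^bsub>G Mod T\<^esub> (T #> d)"
      using commutes_mod_iff[OF T c] comm[OF mem] by simp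
    then have "((T #> d) \<otimes>\<^bsub>G Mod T\<^esub> (T #> e)) [^]\<^bsub>G Mod T\<^esub> r
        = (T #> d) [^]\<^bsub>G Mod T\<^esub> r \<otimes>\<^bsub>G Mod T\<^esub> (T #> e) [^]\<^bsub>G Mod T\<^esub> r"
      using \<pi>.H.pow_mult_distrib c \<pi>.hom_closed by blast
    also have "\<dots> = \<one>\<^bsub>G Mod T\<^esub>"
      using de piff[OF mem(1)] piff[OF mem(2)] \<pi>.H.l_one[OF \<pi>.H.one_closed] by (simp only: D_def mem_Collect_eq)
    finally have "(T #> (d \<otimes> e)) [^]\<^bsub>G Mod T\<^esub> r = \<one>\<^bsub>G Mod T\<^esub>"
      using \<pi>.hom_mult[OF c] by simp
    then show "d \<otimes> e \<in> D"
      using piff[of "d \<otimes> e"] subgroup.m_closed[OF AG mem] by (simp add: D_def)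
  qed
  moreover have "g \<otimes> d \<otimes> inv g \<in> D" if g: "g \<in> carrier G" and d: "d \<in> D" for g d
  proof -
    have dj: "d \<in> A j" "d [^] r \<in> T" using d by (auto simp: D_def)
    interpret c: group_hom G G "\<lambda>x. g \<otimes> x \<otimes> inv g"
      using g by unfold_locales (auto simp: hom_def conj_mult)
    have "(g \<otimes> d \<otimes> inv g) [^] r = g \<otimes> d [^] r \<otimes> inv g" using c.hom_nat_pow[OF AjG[OF dj(1)]] by simp
    moreover have "g \<otimes> d [^] r \<otimes> inv g \<in> T" using normal.inv_op_closed2[OF T g dj(2)] .
    moreover have "g \<otimes> d \<otimes> inv g \<in> A j" using normal.inv_op_closed2[OF An g dj(1)] .
    ultimately show ?thesis by (simp add: D_def)
  qed
  ultimately have "D \<lhd> G" using normal_inv_iff by blast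
  moreover have "a [^] m \<in> D"
    using r(3) nat_pow_mem_subgroup[OF AG a(1)] by (simp add: D_def)
  ultimately show ?thesis using r(1,2) AC[of j] by (intro exI[of _ D] exI[of _ r]) (auto simp: D_def)
qed

text \<open>The quotient \<open>D/U\<close> is an \<open>r\<close>-group, so the orders of \<open>U\<close>
and \<open>Q\<close> multiply up to the order of \<open>D\<close>.\<close>

lemma (in group) sylow_complement_mod:
  assumes fin: "finite (carrier G)" and pr: "prime p" "prime r" "p \<noteq> r"
    and D: "subgroup D G" and U: "U \<lhd> G\<lparr>carrier := D\<rparr>" "p_subgroup p U G"
    and pow: "\<And>d. d \<in> D \<Longrightarrow> d [^] r \<in> U"
    and Q: "sylow_subgroup r Q (G\<lparr>carrier := D\<rparr>)"
  shows "U <#> Q = D"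
proof -
  let ?D = "G\<lparr>carrier := D\<rparr>"
  interpret D: group ?D by (rule subgroup_imp_group[OF D])
  interpret \<pi>: group_hom ?D "?D Mod U" "\<lambda>x. U #>\<^bsub>?D\<^esub> x" by (rule D.quotient_group_hom[OF U(1)])
  have UD: "subgroup U ?D" using U(1) normal_imp_subgroup by blast
  have UG: "subgroup U G" using incl_subgroup[OF D UD] .
  have QD: "subgroup Q ?D" and cQ: "card Q = r ^ multiplicity r (card D)"
    using Q by (auto simp: sylow_subgroup_def order_def)
  have QG: "subgroup Q G" using incl_subgroup[OF D QD] .
  have sub: "U \<subseteq> D" "Q \<subseteq> D" using subgroup.subset[OF UD] subgroup.subset[OF QD] by auto
  have finD: "finite D" using fin D subgroup.subset finite_subset by blast
  have finM: "finite (carrier (?D Mod U))" using finD by (simp add: carrier_FactGroup)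
  have "p_element (?D Mod U) r X" if "X \<in> carrier (?D Mod U)" for X
  proof -
    from that obtain d where d: "d \<in> D" "X = U #>\<^bsub>?D\<^esub> d" by (auto simp: carrier_FactGroup)
    have "d [^]\<^bsub>?D\<^esub> r \<in> U" using pow[OF d(1)] by (simp add: nat_pow_consistent[symmetric])
    then have "U #>\<^bsub>?D\<^esub> (d [^]\<^bsub>?D\<^esub> r) = U"
      using D.r_coset_eq_iff_mem[OF UD, of "d [^]\<^bsub>?D\<^esub> r"] sub by auto
    then have "X [^]\<^bsub>?D Mod U\<^esub> r ^ 1 = \<one>\<^bsub>?D Mod U\<^esub>"
      using \<pi>.hom_nat_pow[of d r] d by simp
    then show ?thesis using that unfolding p_element_def by blast
  qed
  then obtain b where b: "card (carrier (?D Mod U)) = r ^ b"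
    using \<pi>.H.p_subgroup_if_p_elements[OF finM pr(2) \<pi>.H.subgroup_self] by (auto simp: p_subgroup_def)
  obtain a where a: "card U = p ^ a" using U(2) by (auto simp: p_subgroup_def)
  have cD: "card D = r ^ b * p ^ a"
    using D.lagrange[OF UD] a b by (simp add: FactGroup_def order_def)
  have "multiplicity r (card D) = b"
    unfolding cD by (rule multiplicity_two_primes(1)[OF pr(2,1) pr(3)[symmetric]])
  then have cQ': "card Q = r ^ b" using cQ by simp
  have "coprime (card U) (card Q)" using a cQ' pr by (simp add: primes_coprime)
  then have "U \<inter> Q = {\<one>}" using coprime_card_Int[OF UG QG] by blast
  then have "card (U <#> Q) = card D" using card_set_mult[OF UG QG] a cQ' cD by simp
  moreover have "U <#> Q \<subseteq> D" using set_mult_subset_subgroup[OF D sub] .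
  ultimately show ?thesis using card_subset_eq[OF finD] by blast
qed

text \<open>A form of the Hall-Higman lemma. Let \<open>C\<close> be the group of all elements that
centralize \<open>T\<close> modulo \<open>N\<close>. If \<open>C\<close> is not contained in
\<open>T\<close>, it contains a normal subgroup \<open>D\<close> of \<open>G\<close>, not contained in
\<open>T\<close>, such that \<open>D / (D \<inter> T)\<close> is an \<open>r\<close>-group for a prime
\<open>r\<close>. Maximality of \<open>T\<close> excludes \<open>r = p\<close>. Otherwise let
\<open>Q\<close> be a Sylow \<open>r\<close>-subgroup of \<open>D\<close>. Since \<open>Q\<close>
centralizes \<open>D \<inter> T\<close> modulo \<open>N\<close>, the product \<open>NQ\<close> is normal in
\<open>G\<close>. The Frattini argument gives \<open>G = N N\<^sub>G(Q)\<close>, and because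
\<open>N\<close> consists of nongenerators, \<open>Q\<close> is normal in \<open>G\<close>. So
\<open>Q\<close> is trivial, a contradiction.\<close>

lemma (in group) self_centralizing_core:
  assumes fin: "finite (carrier G)" and p: "prime p" and sol: "solvable G"
    and noq: "\<And>r Q. prime r \<Longrightarrow> r \<noteq> p \<Longrightarrow> p_subgroup r Q G \<Longrightarrow> Q \<lhd> G \<Longrightarrow> Q = {\<one>}"
    and N: "N \<lhd> G" "p_subgroup p N G"
    and ng: "\<And>H. subgroup H G \<Longrightarrow> N <#> H = carrier G \<Longrightarrow> H = carrier G"
    and T: "T \<lhd> G" "p_subgroup p T G"
    and Tmax: "\<And>D. D \<lhd> G \<Longrightarrow> p_subgroup p D G \<Longrightarrow> D \<subseteq> T"
    and g: "g \<in> carrier G" "\<And>t. t \<in> T \<Longrightarrow> g \<otimes> t \<otimes> inv g \<otimes> inv t \<in> N"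
  shows "g \<in> T"
proof (rule ccontr)
  assume "g \<notin> T"
  define C where "C = {z \<in> carrier G. \<forall>t\<in>T. z \<otimes> t \<otimes> inv z \<otimes> inv t \<in> N}"
  have "C \<lhd> G" unfolding C_def by (rule centralizer_mod_normal[OF N(1) T(1)])
  moreover have "g \<in> C" using g by (simp add: C_def)
  ultimately obtain D r where D: "D \<lhd> G" "D \<subseteq> C" "\<not> D \<subseteq> T" and r: "prime r"
    and pow: "\<And>d. d \<in> D \<Longrightarrow> d [^] (r::nat) \<in> T"
    using solvable_layer[OF fin sol T(1), of C] \<open>g \<notin> T\<close> by blast
  have TG: "subgroup T G" and NG: "subgroup N G" and DG: "subgroup D G"
    using T N D normal_imp_subgroup by auto
  have dG: "d \<in> carrier G" if "d \<in> D" for d using subgroup.mem_carrier[OF DG that] .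
  (* the hypothesis on normal subgroups covers the primes other than p; maximality of T covers p itself *)
  have "r \<noteq> p"
  proof
    assume rp: "r = p"
    have "p_element G p d" if d: "d \<in> D" for d
    proof -
      obtain k where "(d [^] r) [^] p ^ k = \<one>"
        using p_subgroup_p_element[OF T(2) pow[OF d]] by (auto simp: p_element_def)
      then have "d [^] p ^ Suc k = \<one>" using rp dG[OF d] by (simp add: nat_pow_pow)
      then show ?thesis using dG[OF d] unfolding p_element_def by blast
    qed
    then have "p_subgroup p D G" using p_subgroup_if_p_elements[OF fin p DG] by blast
    then show False using Tmax[OF D(1)] D(3) by blast
  qed
  let ?D = "G\<lparr>carrier := D\<rparr>"
  interpret D: group ?D by (rule subgroup_imp_group[OF DG])
  have finD: "finite D" using fin DG subgroup.subset finite_subset by blast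
  obtain Q where Q: "sylow_subgroup r Q ?D" using D.sylow_subgroup_exists[OF _ r] finD by auto
  have QD: "subgroup Q ?D" using Q by (simp add: sylow_subgroup_def)
  have QG: "subgroup Q G" using incl_subgroup[OF DG QD] .
  have QsD: "Q \<subseteq> D" using subgroup.subset[OF QD] by simp
  obtain b where b: "card Q = r ^ b" using Q by (auto simp: sylow_subgroup_def)
  have pQ: "p_subgroup r Q G" using QG b by (auto simp: p_subgroup_def)
  have finQ: "finite Q" using finD QsD finite_subset by blast
  note niff = normalizer_iff[OF finQ subgroup.subset[OF QG]]
  define U where "U = T \<inter> D"
  have UG: "subgroup U G" using subgroups_Inter_pair[OF TG DG] by (simp add: U_def)
  have pU: "p_subgroup p U G"
    using p_subgroup_if_p_elements[OF fin p UG] p_subgroup_p_element[OF T(2)] by (simp add: U_def)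
  have "U \<lhd> ?D" unfolding U_def using normal_Int_subgroup[OF DG T(1)] by simp
  moreover have "d [^] r \<in> U" if "d \<in> D" for d
    using pow[OF that] nat_pow_mem_subgroup[OF DG that] by (simp add: U_def)
  ultimately have UQ: "U <#> Q = D"
    using sylow_complement_mod[OF fin p r _ DG _ pU _ Q] \<open>r \<noteq> p\<close> by simp
  have FD: "D <#> normalizer G Q = carrier G" by (rule frattini_argument[OF fin r D(1) Q])
  define NQ where "NQ = N <#> Q"
  have NQG: "subgroup NQ G"
    unfolding NQ_def using subgroup_set_mult[OF NG QG] normal.inv_op_closed2[OF N(1)] subgroup.mem_carrier[OF QG] by blast
  have NsNQ: "N \<subseteq> NQ"
    unfolding NQ_def by (rule subset_set_mult_left[OF subgroup.subset[OF NG] QG])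
  have QsNQ: "Q \<subseteq> NQ"
    unfolding NQ_def by (rule subset_set_mult_right[OF NG subgroup.subset[OF QG]])
  (* conjugation by T moves Q only within N Q, because Q centralizes T modulo N *)
  have tq: "t \<otimes> q \<otimes> inv t \<in> NQ" if t: "t \<in> T" and q: "q \<in> Q" for t q
  proof -
    have c: "t \<in> carrier G" "q \<in> carrier G" using subgroup.mem_carrier[OF TG t] subgroup.mem_carrier[OF QG q] by auto
    have "q \<otimes> t \<otimes> inv q \<otimes> inv t \<in> N" using t q QsD D(2) by (auto simp: C_def)
    then have "inv (q \<otimes> t \<otimes> inv q \<otimes> inv t) \<in> N" using subgroup.m_inv_closed[OF NG] by blast
    then have "inv (q \<otimes> t \<otimes> inv q \<otimes> inv t) \<otimes> q \<in> NQ" unfolding NQ_def using q by (rule set_multI)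
    then show ?thesis using c by (simp add: m_assoc inv_mult_group)
  qed
  (* an arbitrary element is a product of elements of T, of Q and of the normalizer of Q *)
  have conjQ: "x \<otimes> q \<otimes> inv x \<in> NQ" if x: "x \<in> carrier G" and q: "q \<in> Q" for x q
  proof -
    have "x \<in> D <#> normalizer G Q" using x FD by simp
    then obtain d n where dn: "d \<in> D" "n \<in> normalizer G Q" "x = d \<otimes> n" by (elim set_multE)
    have "d \<in> U <#> Q" using dn UQ by simp
    then obtain t s where ts: "t \<in> U" "s \<in> Q" "d = t \<otimes> s" by (elim set_multE)
    have c: "t \<in> carrier G" "s \<in> carrier G" "n \<in> carrier G" "q \<in> carrier G"
      using ts dn q niff subgroup.mem_carrier[OF UG] subgroup.mem_carrier[OF QG] by auto
    have "n \<otimes> q \<otimes> inv n \<in> Q" using dn q niff by blast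
    then have "s \<otimes> (n \<otimes> q \<otimes> inv n) \<otimes> inv s \<in> Q"
      using ts(2) subgroup.m_closed[OF QG] subgroup.m_inv_closed[OF QG] by blast
    then have "t \<otimes> (s \<otimes> (n \<otimes> q \<otimes> inv n) \<otimes> inv s) \<otimes> inv t \<in> NQ" using tq ts(1) U_def by blast
    moreover have "t \<otimes> (s \<otimes> (n \<otimes> q \<otimes> inv n) \<otimes> inv s) \<otimes> inv t = x \<otimes> q \<otimes> inv x"
      unfolding dn(3) ts(3) using c by (simp add: m_assoc inv_mult_group)
    ultimately show ?thesis by simp
  qed
  have "x \<otimes> y \<otimes> inv x \<in> NQ" if x: "x \<in> carrier G" and y: "y \<in> NQ" for x y
  proof -
    obtain n q where nq: "n \<in> N" "q \<in> Q" "y = n \<otimes> q" using y unfolding NQ_def by (elim set_multE)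
    have "x \<otimes> n \<otimes> inv x \<in> NQ" using normal.inv_op_closed2[OF N(1) x nq(1)] NsNQ by blast
    then have "(x \<otimes> n \<otimes> inv x) \<otimes> (x \<otimes> q \<otimes> inv x) \<in> NQ"
      using subgroup.m_closed[OF NQG] conjQ[OF x nq(2)] by blast
    then show ?thesis using conj_mult[OF x] nq subgroup.mem_carrier[OF NG] subgroup.mem_carrier[OF QG] by simp
  qed
  then have NQn: "NQ \<lhd> G" using NQG normal_inv_iff by blast
  obtain a where a: "card N = p ^ a" using N(2) by (auto simp: p_subgroup_def)
  have "coprime (card N) (card Q)" using a b p r \<open>r \<noteq> p\<close> by (simp add: primes_coprime)
  then have "N \<inter> Q = {\<one>}" using coprime_card_Int[OF NG QG] by blast
  then have "card NQ = p ^ a * r ^ b" unfolding NQ_def using card_set_mult[OF NG QG] a b by simp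
  moreover have "multiplicity r (p ^ a * r ^ b) = b"
    by (rule multiplicity_two_primes(2)[OF p r \<open>r \<noteq> p\<close>[symmetric]])
  ultimately have "sylow_subgroup r Q (G\<lparr>carrier := NQ\<rparr>)"
    using subgroup_incl[OF QG NQG QsNQ] b by (simp add: sylow_subgroup_def order_def)
  then have F: "NQ <#> normalizer G Q = carrier G" by (rule frattini_argument[OF fin r NQn])
  have nQG: "subgroup (normalizer G Q) G" using normalizer_imp_subgroup[OF subgroup.subset[OF QG]] .
  have QsN: "Q \<subseteq> normalizer G Q"
    using subgroup_le_normalizer[OF fin QG] .
  (* as Q lies in its normalizer, N Q can be replaced by N in the Frattini argument *)
  have "carrier G \<subseteq> N <#> normalizer G Q"
  proof
    fix x assume "x \<in> carrier G"
    then have "x \<in> NQ <#> normalizer G Q" using F by simp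
    then obtain y m where ym: "y \<in> NQ" "m \<in> normalizer G Q" "x = y \<otimes> m" by (elim set_multE)
    then obtain n q where nq: "n \<in> N" "q \<in> Q" "y = n \<otimes> q" unfolding NQ_def by (elim set_multE)
    have "q \<otimes> m \<in> normalizer G Q" using subgroup.m_closed[OF nQG] QsN nq ym by blast
    then have "n \<otimes> (q \<otimes> m) \<in> N <#> normalizer G Q" using nq(1) by (intro set_multI)
    then show "x \<in> N <#> normalizer G Q"
      using ym nq subgroup.mem_carrier[OF NG] subgroup.mem_carrier[OF QG] subgroup.mem_carrier[OF nQG]
      by (simp add: m_assoc)
  qed
  moreover have "N <#> normalizer G Q \<subseteq> carrier G"
    using set_mult_subset_subgroup[OF subgroup_self] subgroup.subset[OF NG] subgroup.subset[OF nQG] by blast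
  ultimately have "normalizer G Q = carrier G" using ng[OF nQG] by blast
  then have "Q \<lhd> G" using niff QG normal_inv_iff by blast
  then have "Q = {\<one>}" using noq[OF r \<open>r \<noteq> p\<close> pQ] by blast
  then have "D \<subseteq> U" using UQ subgroup.mem_carrier[OF UG] by (auto simp: set_mult_def)
  then show False using D(3) U_def by blast
qed

text \<open>Let \<open>S\<close> be a normal subgroup of largest order prime to \<open>p\<close>. Then
\<open>G/S\<close> has no nontrivial normal \<open>r\<close>-subgroup with \<open>r \<noteq> p\<close>, so
the preceding lemma applies to it; the subgroup \<open>T\<close> of that lemma is contained in the Sylow
subgroup \<open>PS/S\<close>.\<close>

lemma (in group) mod_frattini_core:
  assumes fin: "finite (carrier G)" and p: "prime p" and sol: "solvable G"
    and N: "N \<lhd> G" "p_subgroup p N G"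
    and ng: "\<And>H. subgroup H G \<Longrightarrow> N <#> H = carrier G \<Longrightarrow> H = carrier G"
    and P: "sylow_subgroup p P G"
  shows "\<exists>S. S \<lhd> G \<and> coprime p (card S) \<and>
    (\<forall>x\<in>carrier G. (\<forall>u\<in>P. x \<otimes> u \<otimes> inv x \<otimes> inv u \<in> N) \<longrightarrow> x \<in> S <#> P)"
proof -
  define \<S> where "\<S> = {S. S \<lhd> G \<and> coprime p (card S)}"
  have "{\<one>} \<in> \<S>" by (simp add: \<S>_def one_is_normal)
  moreover have "S \<subseteq> carrier G" if "S \<in> \<S>" for S
    using that subgroup.subset[OF normal_imp_subgroup] by (auto simp: \<S>_def)
  then have "finite \<S>" using fin by (intro finite_subset[of \<S> "Pow (carrier G)"]) auto
  ultimately have "Max (card ` \<S>) \<in> card ` \<S>" "\<And>S'. S' \<in> \<S> \<Longrightarrow> card S' \<le> Max (card ` \<S>)"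
    by (auto intro!: Max_in)
  then obtain S where S: "S \<in> \<S>" and Smax: "\<And>S'. S' \<in> \<S> \<Longrightarrow> card S' \<le> card S" by fastforce
  have Sn: "S \<lhd> G" and Sc: "coprime p (card S)" using S by (auto simp: \<S>_def)
  have SG: "subgroup S G" using Sn normal_imp_subgroup by blast
  let ?Q = "G Mod S"
  interpret \<pi>: group_hom G ?Q "\<lambda>x. S #> x" by (rule quotient_group_hom[OF Sn])
  have surj: "(\<lambda>x. S #> x) ` carrier G = carrier ?Q" by (simp add: carrier_FactGroup)
  have finQ: "finite (carrier ?Q)" using fin by (simp add: carrier_FactGroup)
  have solQ: "solvable ?Q" using \<pi>.surj_hom_imp_solvable[OF surj sol] .
  have ker: "kernel G ?Q (\<lambda>x. S #> x) = S"
    using r_coset_eq_iff_mem[OF SG] subgroup.mem_carrier[OF SG] by (auto simp: kernel_def)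
  have noq: "Y = {\<one>\<^bsub>?Q\<^esub>}" if r: "prime r" "r \<noteq> p" and Y: "p_subgroup r Y ?Q" "Y \<lhd> ?Q" for r Y
  proof -
    let ?V = "{g \<in> carrier G. S #> g \<in> Y}"
    have V: "?V \<lhd> G" by (rule \<pi>.vimage_normal[OF Y(2)])
    have VG: "subgroup ?V G" using V normal_imp_subgroup by blast
    have YQ: "subgroup Y ?Q" using Y(2) normal_imp_subgroup by blast
    have "S \<subseteq> ?V"
      using coset_join2[OF subgroup.mem_carrier[OF SG] SG] subgroup.mem_carrier[OF SG]
        subgroup.one_closed[OF YQ] by (auto simp: subset_iff)
    then have VS: "?V \<inter> kernel G ?Q (\<lambda>x. S #> x) = S" using ker by blast
    have "Y \<subseteq> (\<lambda>x. S #> x) ` carrier G" using subgroup.subset[OF YQ] surj by simp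
    then have "(\<lambda>x. S #> x) ` ?V = Y" by auto
    then have cV: "card Y * card S = card ?V" using \<pi>.card_subgroup_img_mult[OF VG] VS by simp
    obtain k where k: "card Y = r ^ k" using Y(1) by (auto simp: p_subgroup_def)
    (* the preimage of Y has order |Y| |S|, still prime to p, so by the choice of S it is S *)
    have "coprime p (card Y * card S)" using k r p Sc by (simp add: primes_coprime)
    then have "coprime p (card ?V)" using cV by simp
    then have "?V \<in> \<S>" using V by (simp add: \<S>_def)
    then have "card Y * card S \<le> card S" using Smax[of ?V] cV by simp
    moreover have "finite S" using fin subgroup.subset[OF SG] finite_subset by blast
    then have "card S > 0" using subgroup.one_closed[OF SG] by (auto simp: card_gt_0_iff)
    ultimately have "card Y \<le> 1" by simp
    moreover have "finite Y" using finQ subgroup.subset[OF YQ] finite_subset by blast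
    ultimately have "\<And>y. y \<in> Y \<Longrightarrow> y = \<one>\<^bsub>?Q\<^esub>"
      using subgroup.one_closed[OF YQ] card_le_Suc0_iff_eq[of Y] by simp
    then show ?thesis using subgroup.one_closed[OF YQ] by blast
  qed
  obtain T where T: "T \<lhd> ?Q" "p_subgroup p T ?Q" and TP: "\<And>P. sylow_subgroup p P ?Q \<Longrightarrow> T \<subseteq> P"
    and Tmax: "\<And>D. D \<lhd> ?Q \<Longrightarrow> p_subgroup p D ?Q \<Longrightarrow> D \<subseteq> T"
    using \<pi>.H.p_core_exists[OF finQ p] by blast
  have PG: "subgroup P G" and NG: "subgroup N G"
    using P N normal_imp_subgroup by (auto simp: sylow_subgroup_def)
  have TsP: "T \<subseteq> (\<lambda>x. S #> x) ` P" using TP[OF \<pi>.sylow_img[OF fin p P surj]] .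
  have ngQ: "H = carrier ?Q" if H: "subgroup H ?Q" and eq: "(\<lambda>x. S #> x) ` N <#>\<^bsub>?Q\<^esub> H = carrier ?Q" for H
  proof -
    let ?V = "{g \<in> carrier G. S #> g \<in> H}"
    have V: "subgroup ?V G" by (rule \<pi>.vimage_subgroup[OF H])
    have "carrier G \<subseteq> N <#> ?V"
    proof
      fix x assume x: "x \<in> carrier G"
      then have "S #> x \<in> (\<lambda>x. S #> x) ` N <#>\<^bsub>?Q\<^esub> H" using eq \<pi>.hom_closed by simp
      then obtain n h where n: "n \<in> N" "h \<in> H" "S #> x = (S #> n) \<otimes>\<^bsub>?Q\<^esub> h"
        by (elim set_multE imageE) (use that in blast)
      have nG: "n \<in> carrier G" using n subgroup.mem_carrier[OF NG] by blast
      have "S #> (inv n \<otimes> x) = inv\<^bsub>?Q\<^esub> (S #> n) \<otimes>\<^bsub>?Q\<^esub> (S #> x)"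
        using \<pi>.hom_mult[of "inv n" x] \<pi>.hom_inv[OF nG] nG x by simp
      also have "\<dots> = h"
        unfolding n(3) using \<pi>.H.inv_mult_cancel(1)[OF \<pi>.hom_closed[OF nG]] n(2) subgroup.mem_carrier[OF H] by blast
      finally have "inv n \<otimes> x \<in> ?V" using n(2) nG x by simp
      then have "n \<otimes> (inv n \<otimes> x) \<in> N <#> ?V" using n(1) by (intro set_multI)
      then show "x \<in> N <#> ?V" using nG x by (simp add: inv_mult_cancel)
    qed
    moreover have "N <#> ?V \<subseteq> carrier G"
      by (rule set_mult_subset_subgroup[OF subgroup_self subgroup.subset[OF NG] subgroup.subset[OF V]])
    ultimately have "?V = carrier G" using ng[OF V] by blast
    then have "S #> x \<in> H" if "x \<in> carrier G" for x using that by blast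
    then have "carrier ?Q \<subseteq> H" unfolding surj[symmetric] by blast
    then show ?thesis using subgroup.subset[OF H] by blast
  qed
  have "x \<in> S <#> P" if x: "x \<in> carrier G" and xN: "\<forall>u\<in>P. x \<otimes> u \<otimes> inv x \<otimes> inv u \<in> N" for x
  proof -
    have "S #> x \<in> T"
    proof (rule \<pi>.H.self_centralizing_core[OF finQ p solQ noq _ _ ngQ T Tmax])
      show "(\<lambda>x. S #> x) ` N \<lhd> ?Q"
        using normal.surj_hom_normal_subgroup[OF N(1) \<pi>.group_hom_axioms surj] .
      show "p_subgroup p ((\<lambda>x. S #> x) ` N) ?Q" using \<pi>.p_subgroup_img[OF N(2) p] .
      show "S #> x \<in> carrier ?Q" using x \<pi>.hom_closed by blast
    next
      fix t assume "t \<in> T"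
      then obtain u where u: "u \<in> P" "t = S #> u" using TsP by blast
      have uG: "u \<in> carrier G" using u subgroup.mem_carrier[OF PG] by blast
      have "(S #> x) \<otimes>\<^bsub>?Q\<^esub> t \<otimes>\<^bsub>?Q\<^esub> inv\<^bsub>?Q\<^esub> (S #> x) \<otimes>\<^bsub>?Q\<^esub> inv\<^bsub>?Q\<^esub> t
          = S #> (x \<otimes> u \<otimes> inv x \<otimes> inv u)"
        unfolding u(2) using x uG by (simp only: \<pi>.hom_mult \<pi>.hom_inv m_closed inv_closed)
      then show "(S #> x) \<otimes>\<^bsub>?Q\<^esub> t \<otimes>\<^bsub>?Q\<^esub> inv\<^bsub>?Q\<^esub> (S #> x) \<otimes>\<^bsub>?Q\<^esub> inv\<^bsub>?Q\<^esub> t \<in> (\<lambda>x. S #> x) ` N"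
        using xN u by auto
    qed
    then obtain u where u: "u \<in> P" "S #> x = S #> u" using TsP by blast
    have "x \<in> S #> x" using rcos_self[OF x SG] .
    then have "x \<in> S #> u" using u(2) by simp
    then show ?thesis using u(1) by (auto simp: r_coset_def set_mult_def)
  qed
  then show ?thesis using Sn Sc by blast
qed

section \<open>The soluble radical and its Frattini subgroup\<close>

lemma (in group) solvable_subgroup_iff:
  assumes "subgroup N G"
  shows "solvable (G\<lparr>carrier := N\<rparr>) \<longleftrightarrow> solvable_seq G N"
proof -
  interpret N: group "G\<lparr>carrier := N\<rparr>" by (rule subgroup_imp_group[OF assms])
  interpret i: group_hom "G\<lparr>carrier := N\<rparr>" G "\<lambda>x. x"
    using subgroup.mem_carrier[OF assms] by unfold_locales (auto simp: hom_def)
  show ?thesis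
    using i.solvable_img_imp_solvable[OF N.subgroup_self] i.solvable_imp_solvable_img[of N]
    by (auto simp: solvable_def)
qed

lemma (in group) solvable_normal_product:
  assumes A: "A \<lhd> G" "solvable_seq G A" and B: "subgroup B G" "solvable_seq G B"
  shows "solvable_seq G (A <#> B)"
proof -
  interpret \<pi>: group_hom G "G Mod A" "\<lambda>x. A #> x" by (rule quotient_group_hom[OF A(1)])
  have AG: "subgroup A G" using A(1) normal_imp_subgroup by blast
  have AB: "subgroup (A <#> B) G"
    using subgroup_set_mult[OF AG B(1)] normal.inv_op_closed2[OF A(1)] subgroup.mem_carrier[OF B(1)] by blast
  have eq: "A #> (a \<otimes> b) = A #> b" if "a \<in> A" "b \<in> B" for a b
  proof -
    have c: "a \<in> carrier G" "b \<in> carrier G"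
      using subgroup.mem_carrier[OF AG that(1)] subgroup.mem_carrier[OF B(1) that(2)] by auto
    have "A #> a = A" using r_coset_eq_iff_mem[OF AG c(1)] that(1) by blast
    then show ?thesis using coset_mult_assoc[OF subgroup.subset[OF AG] c] by simp
  qed
  have "(\<lambda>x. A #> x) ` (A <#> B) = (\<lambda>x. A #> x) ` B"
  proof (intro equalityI subsetI)
    fix X assume "X \<in> (\<lambda>x. A #> x) ` (A <#> B)"
    then show "X \<in> (\<lambda>x. A #> x) ` B" using eq by (auto simp: set_mult_def)
  next
    fix X assume "X \<in> (\<lambda>x. A #> x) ` B"
    then obtain b where b: "b \<in> B" "X = A #> (\<one> \<otimes> b)" using subgroup.mem_carrier[OF B(1)] by auto
    moreover have "\<one> \<otimes> b \<in> A <#> B" using b(1) subgroup.one_closed[OF AG] by (intro set_multI)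
    ultimately show "X \<in> (\<lambda>x. A #> x) ` (A <#> B)" by blast
  qed
  then have s: "solvable_seq (G Mod A) ((\<lambda>x. A #> x) ` (A <#> B))"
    using \<pi>.solvable_imp_solvable_img[OF B(2)] by simp
  interpret i: group_hom G G "\<lambda>x. x" by unfold_locales (auto simp: hom_def)
  have AsAB: "A \<subseteq> A <#> B" by (rule subset_set_mult_left[OF subgroup.subset[OF AG] B(1)])
  have "kernel G (G Mod A) (\<lambda>x. A #> x) \<subseteq> A"
  proof
    fix x assume "x \<in> kernel G (G Mod A) (\<lambda>x. A #> x)"
    then have "x \<in> carrier G" "A #> x = A" unfolding kernel_def one_FactGroup by blast+
    then show "x \<in> A" using r_coset_eq_iff_mem[OF AG] by blast
  qed
  then show ?thesis
    using solvable_seq_condition[OF i.group_hom_axioms \<pi>.group_hom_axioms _ _ AB A(2) s] AsAB by simp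
qed

text \<open>A soluble normal subgroup of largest order contains all the others, because the product of two
of them is soluble.\<close>

lemma (in group) soluble_radical_normal_solvable:
  assumes fin: "finite (carrier G)"
  shows "soluble_radical G \<lhd> G" "solvable_seq G (soluble_radical G)"
proof -
  define \<N> where "\<N> = {N. N \<lhd> G \<and> solvable (G\<lparr>carrier := N\<rparr>)}"
  have iff: "N \<in> \<N> \<longleftrightarrow> N \<lhd> G \<and> solvable_seq G N" for N
    using solvable_subgroup_iff normal_imp_subgroup unfolding \<N>_def by blast
  have "N \<subseteq> carrier G" if "N \<in> \<N>" for N
    using that subgroup.subset[OF normal_imp_subgroup] by (auto simp: iff)
  then have "finite \<N>" using fin by (intro finite_subset[of \<N> "Pow (carrier G)"]) auto
  moreover have "{\<one>} \<in> \<N>" by (simp add: iff one_is_normal solvable_seq.unity)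
  ultimately have "Max (card ` \<N>) \<in> card ` \<N>" "\<And>N. N \<in> \<N> \<Longrightarrow> card N \<le> Max (card ` \<N>)"
    by (auto intro!: Max_in)
  then obtain R where R: "R \<in> \<N>" and Rmax: "\<And>N. N \<in> \<N> \<Longrightarrow> card N \<le> card R" by fastforce
  have RG: "R \<lhd> G" "solvable_seq G R" using R iff by auto
  have Rs: "subgroup R G" using RG normal_imp_subgroup by blast
  have le: "N \<subseteq> R" if N: "N \<in> \<N>" for N
  proof -
    have NG: "N \<lhd> G" "solvable_seq G N" using N iff by auto
    have Ns: "subgroup N G" using NG normal_imp_subgroup by blast
    have "R <#> N \<lhd> G" using normal_subgroup_set_mult_closed[OF RG(1) NG(1)] .
    then have "R <#> N \<in> \<N>" using solvable_normal_product[OF RG Ns NG(2)] iff by blast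
    then have "card (R <#> N) \<le> card R" by (rule Rmax)
    moreover have "R \<subseteq> R <#> N" by (rule subset_set_mult_left[OF subgroup.subset[OF Rs] Ns])
    moreover have "R <#> N \<subseteq> carrier G" by (rule setmult_subset_G[OF subgroup.subset[OF Rs] subgroup.subset[OF Ns]])
    then have "finite (R <#> N)" using fin finite_subset by blast
    ultimately have eq: "R <#> N = R" using card_seteq[of "R <#> N" R] by blast
    then show ?thesis using subset_set_mult_right[OF Rs subgroup.subset[OF Ns]] by simp
  qed
  have "\<Union>\<N> = R" using le R by blast
  moreover have "generate G R = R"
    by (rule equalityI[OF generate_subgroup_incl[OF subset_refl Rs]]) (rule subsetI, rule generate.incl)
  ultimately have "soluble_radical G = R" by (simp add: soluble_radical_def \<N>_def)
  then show "soluble_radical G \<lhd> G" "solvable_seq G (soluble_radical G)" using RG by auto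
qed

lemma (in group) cyclic_extension:
  assumes R: "R \<lhd> G" and x: "x \<in> carrier G"
  shows "subgroup (R <#> generate G {x}) G" "R \<subseteq> R <#> generate G {x}" "x \<in> R <#> generate G {x}"
proof -
  have RG: "subgroup R G" using R normal_imp_subgroup by blast
  have X: "subgroup (generate G {x}) G" using generate_is_subgroup x by blast
  show "subgroup (R <#> generate G {x}) G"
    using subgroup_set_mult[OF RG X] normal.inv_op_closed2[OF R] subgroup.mem_carrier[OF X] by blast
  show "R \<subseteq> R <#> generate G {x}" by (rule subset_set_mult_left[OF subgroup.subset[OF RG] X])
  show "x \<in> R <#> generate G {x}"
    using subset_set_mult_right[OF RG subgroup.subset[OF X]] mem_generate_self by blast
qed

lemma (in group) cyclic_extension_coset:
  assumes fin: "finite (carrier G)" and R: "R \<lhd> G" and x: "x \<in> carrier G"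
    and y: "y \<in> R <#> generate G {x}"
  shows "\<exists>k. R #> y = (R #> x) [^]\<^bsub>G Mod R\<^esub> (k::nat)"
proof -
  interpret \<pi>: group_hom G "G Mod R" "\<lambda>x. R #> x" by (rule quotient_group_hom[OF R])
  have RG: "subgroup R G" using R normal_imp_subgroup by blast
  obtain r z where rz: "r \<in> R" "z \<in> generate G {x}" "y = r \<otimes> z" using y by (elim set_multE)
  obtain k :: nat where k: "z = x [^] k" using rz(2) generate_pow_on_finite_carrier[OF fin x] by blast
  have c: "r \<in> carrier G" "x [^] k \<in> carrier G" using subgroup.mem_carrier[OF RG rz(1)] x by auto
  have "R #> r = R" using r_coset_eq_iff_mem[OF RG c(1)] rz(1) by blast
  then have "R #> y = R #> (x [^] k)"
    using coset_mult_assoc[OF subgroup.subset[OF RG] c] rz(3) k by simp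
  then show ?thesis using \<pi>.hom_nat_pow[OF x] by metis
qed

text \<open>The quotient by \<open>R\<close> is cyclic, so the derived subgroup lies in
\<open>R\<close>.\<close>

lemma (in group) solvable_cyclic_extension:
  assumes fin: "finite (carrier G)" and R: "R \<lhd> G" "solvable_seq G R" and x: "x \<in> carrier G"
  shows "solvable_seq G (R <#> generate G {x})"
proof -
  interpret \<pi>: group_hom G "G Mod R" "\<lambda>x. R #> x" by (rule quotient_group_hom[OF R(1)])
  let ?K = "R <#> generate G {x}"
  have RG: "subgroup R G" using R normal_imp_subgroup by blast
  have K: "subgroup ?K G" using cyclic_extension[OF R(1) x] by blast
  have "a \<otimes> b \<otimes> inv a \<otimes> inv b \<in> R" if ab: "a \<in> ?K" "b \<in> ?K" for a b
  proof -
    have c: "a \<in> carrier G" "b \<in> carrier G" using ab subgroup.mem_carrier[OF K] by auto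
    obtain k l :: nat where kl: "R #> a = (R #> x) [^]\<^bsub>G Mod R\<^esub> k" "R #> b = (R #> x) [^]\<^bsub>G Mod R\<^esub> l"
      using cyclic_extension_coset[OF fin R(1) x] ab by meson
    have "(R #> a) \<otimes>\<^bsub>G Mod R\<^esub> (R #> b) = (R #> b) \<otimes>\<^bsub>G Mod R\<^esub> (R #> a)"
      unfolding kl using \<pi>.H.nat_pow_mult[OF \<pi>.hom_closed[OF x]] by (simp add: add.commute del: mult_FactGroup)
    then show ?thesis using commutes_mod_iff[OF R(1) c] by simp
  qed
  then have "derived_set G ?K \<subseteq> R" by blast
  then have dR: "derived G ?K \<subseteq> R" unfolding derived_def by (rule generate_subgroup_incl[OF _ RG])
  obtain n where "(derived G ^^ n) R = {\<one>}" using solvable_imp_trivial_derived_seq[OF R(2)] by blast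
  then have "(derived G ^^ n) (derived G ?K) \<subseteq> {\<one>}" using mono_exp_of_derived[OF dR, of n] by simp
  then have "(derived G ^^ Suc n) ?K \<subseteq> {\<one>}" by (simp add: funpow_swap1)
  moreover have "\<one> \<in> (derived G ^^ Suc n) ?K"
    using subgroup.one_closed[OF exp_of_derived_is_subgroup[OF K]] by blast
  ultimately have "(derived G ^^ Suc n) ?K = {\<one>}" by blast
  then show ?thesis by (rule trivial_derived_seq_imp_solvable[OF K])
qed

text \<open>A proper subgroup is contained in a maximal one, which contains the Frattini subgroup as
well.\<close>

lemma (in group) frattini_nongenerator:
  assumes fin: "finite (carrier G)" and H: "subgroup H G"
    and eq: "frattini G <#> H = carrier G"
  shows "H = carrier G"
proof (rule ccontr)
  assume ne: "H \<noteq> carrier G"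
  define \<M> where "\<M> = {M. subgroup M G \<and> H \<subseteq> M \<and> M \<noteq> carrier G}"
  have "H \<in> \<M>" using H ne by (simp add: \<M>_def)
  moreover have "finite \<M>"
    using fin subgroup.subset by (intro finite_subset[of \<M> "Pow (carrier G)"]) (auto simp: \<M>_def)
  ultimately obtain M where M: "M \<in> \<M>" and max: "\<And>M'. M' \<in> \<M> \<Longrightarrow> M \<subseteq> M' \<Longrightarrow> M' = M"
    using finite_has_maximal[of \<M>] by blast
  have MG: "subgroup M G" and HM: "H \<subseteq> M" and Mne: "M \<noteq> carrier G" using M by (auto simp: \<M>_def)
  have "maximal_subgroup M G"
    unfolding maximal_subgroup_def proper_subgroup_def
  proof (intro conjI allI impI MG Mne)
    fix L
    assume L: "subgroup L G \<and> M \<subseteq> L"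
    show "L = M \<or> L = carrier G"
    proof (cases "L = carrier G")
      case False
      then have "L \<in> \<M>" using L HM by (auto simp: \<M>_def)
      then show ?thesis using max L by blast
    qed simp
  qed
  then have "frattini G \<subseteq> M" by (auto simp: frattini_def)
  then have "frattini G <#> H \<subseteq> M" using set_mult_subset_subgroup[OF MG _ HM] by blast
  then show False using eq Mne subgroup.subset[OF MG] by blast
qed

lemma (in group) subgroup_of_subgroup_iff:
  assumes "subgroup R G"
  shows "subgroup M (G\<lparr>carrier := R\<rparr>) \<longleftrightarrow> subgroup M G \<and> M \<subseteq> R"
  using incl_subgroup[OF assms, of M] subgroup_incl[OF _ assms, of M] subgroup.subset[of M "G\<lparr>carrier := R\<rparr>"]
  by auto

lemma (in group) maximal_subgroup_conj:
  assumes R: "R \<lhd> G" and g: "g \<in> carrier G" and M: "maximal_subgroup M (G\<lparr>carrier := R\<rparr>)"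
  shows "maximal_subgroup ((\<lambda>x. g \<otimes> x \<otimes> inv g) ` M) (G\<lparr>carrier := R\<rparr>)"
proof -
  have RG: "subgroup R G" using R normal_imp_subgroup by blast
  note iff = subgroup_of_subgroup_iff[OF RG]
  have conj_conj_inv: "(\<lambda>x. inv h \<otimes> x \<otimes> inv (inv h)) ` (\<lambda>x. h \<otimes> x \<otimes> inv h) ` L = L"
    if h: "h \<in> carrier G" and L: "L \<subseteq> carrier G" for h L
  proof -
    have "inv h \<otimes> (h \<otimes> x \<otimes> inv h) \<otimes> inv (inv h) = x" if "x \<in> L" for x
      using h L that subsetD[OF L that] by (simp add: m_assoc inv_mult_cancel)
    then show ?thesis by (auto simp: image_image)
  qed
  have cR: "(\<lambda>x. h \<otimes> x \<otimes> inv h) ` L \<subseteq> R" if "h \<in> carrier G" "L \<subseteq> R" for h L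
    using that normal.inv_op_closed2[OF R] by blast
  have MG: "subgroup M G" and MR: "M \<subseteq> R" "M \<noteq> R"
    and max: "\<And>H. subgroup H G \<Longrightarrow> H \<subseteq> R \<Longrightarrow> M \<subseteq> H \<Longrightarrow> H = M \<or> H = R"
    using M by (auto simp: maximal_subgroup_def proper_subgroup_def iff)
  let ?M = "(\<lambda>x. g \<otimes> x \<otimes> inv g) ` M"
  have sub: "L \<subseteq> carrier G" if "L \<subseteq> R" for L using that subgroup.subset[OF RG] by blast
  have ig: "inv g \<in> carrier G" using g by simp
  have conj_inv_conj: "(\<lambda>x. g \<otimes> x \<otimes> inv g) ` (\<lambda>x. inv g \<otimes> x \<otimes> inv (inv g)) ` L = L" if "L \<subseteq> R" for L
    using conj_conj_inv[OF ig sub[OF that]] g by simp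
  have "?M \<noteq> R"
  proof
    assume e: "?M = R"
    have "M = (\<lambda>x. inv g \<otimes> x \<otimes> inv (inv g)) ` R" using conj_conj_inv[OF g sub[OF MR(1)]] e by simp
    also have "\<dots> = R"
    proof
      show "(\<lambda>x. inv g \<otimes> x \<otimes> inv (inv g)) ` R \<subseteq> R" using cR[OF ig subset_refl] .
      have "(\<lambda>x. inv g \<otimes> x \<otimes> inv (inv g)) ` (\<lambda>x. g \<otimes> x \<otimes> inv g) ` R = R" by (rule conj_conj_inv[OF g sub[OF subset_refl]])
      then show "R \<subseteq> (\<lambda>x. inv g \<otimes> x \<otimes> inv (inv g)) ` R" using cR[OF g subset_refl] by (metis image_mono)
    qed
    finally show False using MR(2) by contradiction
  qed
  moreover have "H = ?M \<or> H = R" if H: "subgroup H G" "H \<subseteq> R" "?M \<subseteq> H" for H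
  proof -
    let ?H = "(\<lambda>x. inv g \<otimes> x \<otimes> inv (inv g)) ` H"
    have "M \<subseteq> ?H" using conj_conj_inv[OF g sub[OF MR(1)]] image_mono[OF H(3)] by metis
    then consider "?H = M" | "?H = R" using max[OF subgroup_conj_image[OF ig H(1)] cR[OF ig H(2)]] by blast
    then show ?thesis
    proof cases
      case 1
      then show ?thesis using conj_inv_conj[OF H(2)] by simp
    next
      case 2
      then have "(\<lambda>x. g \<otimes> x \<otimes> inv g) ` R = H" using conj_inv_conj[OF H(2)] by simp
      moreover have "R \<subseteq> (\<lambda>x. g \<otimes> x \<otimes> inv g) ` R"
        using conj_inv_conj[OF subset_refl] cR[OF ig subset_refl] by (metis image_mono)
      ultimately show ?thesis using H(2) by blast
    qed
  qed
  moreover have "subgroup ?M G" using subgroup_conj_image[OF g MG] .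
  ultimately show ?thesis using cR[OF g MR(1)] by (auto simp: maximal_subgroup_def proper_subgroup_def iff)
qed

lemma (in group) frattini_normal:
  assumes R: "R \<lhd> G"
  shows "frattini (G\<lparr>carrier := R\<rparr>) \<lhd> G" "frattini (G\<lparr>carrier := R\<rparr>) \<subseteq> R"
proof -
  let ?M = "{M. maximal_subgroup M (G\<lparr>carrier := R\<rparr>)}"
  let ?N = "frattini (G\<lparr>carrier := R\<rparr>)"
  have RG: "subgroup R G" using R normal_imp_subgroup by blast
  have eq: "?N = \<Inter>(insert R ?M)" by (auto simp: frattini_def)
  show "?N \<subseteq> R" using eq by blast
  have N: "subgroup ?N G" unfolding eq
    by (rule subgroups_Inter) (auto simp: RG maximal_subgroup_def proper_subgroup_def subgroup_of_subgroup_iff[OF RG])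
  have "g \<otimes> n \<otimes> inv g \<in> M" if g: "g \<in> carrier G" and n: "n \<in> ?N" and M: "M \<in> ?M" for g n M
  proof -
    have MG: "subgroup M G" using M by (auto simp: maximal_subgroup_def proper_subgroup_def subgroup_of_subgroup_iff[OF RG])
    have "n \<in> (\<lambda>x. inv g \<otimes> x \<otimes> inv (inv g)) ` M"
      using maximal_subgroup_conj[OF R, of "inv g" M] M g n by (auto simp: frattini_def)
    then obtain x where x: "x \<in> M" "n = inv g \<otimes> x \<otimes> inv (inv g)" by blast
    then have "g \<otimes> n \<otimes> inv g = x"
      using g subgroup.mem_carrier[OF MG x(1)] by (simp add: m_assoc inv_mult_cancel)
    then show ?thesis using x by simp
  qed
  moreover have "g \<otimes> n \<otimes> inv g \<in> R" if "g \<in> carrier G" "n \<in> ?N" for g n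
    using normal.inv_op_closed2[OF R] that by (simp add: frattini_def)
  ultimately show "?N \<lhd> G" using N normal_inv_iff by (auto simp: frattini_def)
qed

text \<open>By the modular law \<open>R\<close> is the product of its Frattini subgroup and \<open>H
\<inter> R\<close>, so \<open>H\<close> contains \<open>R\<close>. The lemma is stated for all
\<open>K\<close> between \<open>R\<close> and \<open>G\<close>, since it will be applied to
\<open>R\<close>, to \<open>R\<langle>x\<rangle>\<close> and to \<open>G\<close>.\<close>

lemma (in group) frattini_normal_nongenerator:
  assumes fin: "finite (carrier G)" and R: "R \<lhd> G" and N: "N \<subseteq> frattini (G\<lparr>carrier := R\<rparr>)"
    and K: "subgroup K G" "R \<subseteq> K" and H: "subgroup H G" "H \<subseteq> K" and eq: "K \<subseteq> N <#> H"
  shows "H = K"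
proof -
  let ?F = "frattini (G\<lparr>carrier := R\<rparr>)"
  have RG: "subgroup R G" using R normal_imp_subgroup by blast
  have FG: "subgroup ?F G" using frattini_normal[OF R] normal_imp_subgroup by blast
  interpret R: group "G\<lparr>carrier := R\<rparr>" by (rule subgroup_imp_group[OF RG])
  have HR: "subgroup (H \<inter> R) (G\<lparr>carrier := R\<rparr>)"
    using subgroup_incl[OF subgroups_Inter_pair[OF H(1) RG] RG] by simp
  have "R \<subseteq> ?F <#> (H \<inter> R)"
  proof
    fix r assume r: "r \<in> R"
    then have "r \<in> N <#> H" using K(2) eq by blast
    then obtain n h where nh: "n \<in> N" "h \<in> H" "r = n \<otimes> h" by (elim set_multE)
    have nF: "n \<in> ?F" using nh N by blast
    then have nR: "n \<in> R" using frattini_normal[OF R] by blast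
    have c: "n \<in> carrier G" "h \<in> carrier G" using subgroup.mem_carrier[OF RG nR] subgroup.mem_carrier[OF H(1) nh(2)] by auto
    have "inv n \<otimes> r \<in> R" using r nR subgroup.m_closed[OF RG] subgroup.m_inv_closed[OF RG] by blast
    then have "h \<in> R" using nh(3) c by (simp add: inv_mult_cancel)
    then show "r \<in> ?F <#> (H \<inter> R)" using nF nh by (auto intro: set_multI)
  qed
  moreover have "?F <#> (H \<inter> R) \<subseteq> R"
    by (rule set_mult_subset_subgroup[OF RG]) (use frattini_normal[OF R] in auto)
  ultimately have "?F <#> (H \<inter> R) = R" by blast
  then have "H \<inter> R = R" using R.frattini_nongenerator[OF _ HR] finite_subset[OF subgroup.subset[OF RG] fin] by simp
  then have "R \<subseteq> H" by blast
  then have "N \<subseteq> H" using N frattini_normal[OF R] by blast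
  then have "N <#> H \<subseteq> H" using set_mult_subset_subgroup[OF H(1)] by blast
  then show ?thesis using eq H(2) by blast
qed

text \<open>Some conjugate of a Sylow subgroup of \<open>R\<close> is contained in \<open>P\<close>.\<close>

lemma (in group) sylow_Int_normal:
  assumes fin: "finite (carrier G)" and p: "prime p" and P: "sylow_subgroup p P G" and R: "R \<lhd> G"
  shows "sylow_subgroup p (P \<inter> R) (G\<lparr>carrier := R\<rparr>)"
proof -
  have RG: "subgroup R G" using R normal_imp_subgroup by blast
  have PG: "subgroup P G" using P by (simp add: sylow_subgroup_def)
  have PR: "subgroup (P \<inter> R) G" using subgroups_Inter_pair[OF PG RG] .
  have finR: "finite R" using fin subgroup.subset[OF RG] finite_subset by blast
  interpret R: group "G\<lparr>carrier := R\<rparr>" by (rule subgroup_imp_group[OF RG])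
  obtain Q where Q: "sylow_subgroup p Q (G\<lparr>carrier := R\<rparr>)" using R.sylow_subgroup_exists[OF _ p] finR by auto
  have QR: "subgroup Q (G\<lparr>carrier := R\<rparr>)" and cQ: "card Q = p ^ multiplicity p (card R)"
    using Q by (auto simp: sylow_subgroup_def order_def)
  have QG: "subgroup Q G" and QsR: "Q \<subseteq> R" using QR subgroup_of_subgroup_iff[OF RG] by auto
  have "p_subgroup p Q G" using QG cQ by (auto simp: p_subgroup_def)
  then obtain g where g: "g \<in> carrier G" "\<forall>k\<in>Q. g \<otimes> k \<otimes> inv g \<in> P"
    using p_subgroup_conj_into_sylow[OF fin p P] by blast
  have "(\<lambda>x. g \<otimes> x \<otimes> inv g) ` Q \<subseteq> P \<inter> R" using g QsR normal.inv_op_closed2[OF R g(1)] by blast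
  moreover have "finite (P \<inter> R)" using finR by blast
  ultimately have "card Q \<le> card (P \<inter> R)"
    using card_mono[of "P \<inter> R" "(\<lambda>x. g \<otimes> x \<otimes> inv g) ` Q"] card_conj_image[OF g(1) subgroup.subset[OF QG]] by simp
  moreover obtain a where a: "card (P \<inter> R) = p ^ a"
    using card_subgroup_dvd_card[OF PR PG] P p divides_primepow_nat unfolding sylow_subgroup_def by (metis inf_le1)
  moreover have "p ^ a dvd card R" using card_subgroup_dvd_card[OF PR RG] a by simp
  moreover have "card R \<noteq> 0" using finR subgroup.one_closed[OF RG] by auto
  then have "a \<le> multiplicity p (card R)"
    using \<open>p ^ a dvd card R\<close> p by (metis multiplicity_geI not_prime_unit)
  then have "p ^ a \<le> p ^ multiplicity p (card R)" using prime_gt_0_nat[OF p] by (simp add: power_increasing)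
  ultimately have "card (P \<inter> R) = p ^ multiplicity p (card R)" using cQ by simp
  then show ?thesis using subgroup_incl[OF PR RG] by (simp add: sylow_subgroup_def order_def)
qed

text \<open>Nilpotency of the Frattini subgroup: by the Frattini argument \<open>G\<close> is the product of
nongenerators and the normalizer of \<open>Q\<close>.\<close>

lemma (in group) sylow_frattini_normal:
  assumes fin: "finite (carrier G)" and p: "prime p" and R: "R \<lhd> G"
    and Q: "sylow_subgroup p Q (G\<lparr>carrier := frattini (G\<lparr>carrier := R\<rparr>)\<rparr>)"
  shows "Q \<lhd> G"
proof -
  let ?N = "frattini (G\<lparr>carrier := R\<rparr>)"
  have N: "?N \<lhd> G" and NR: "?N \<subseteq> R" using frattini_normal[OF R] by auto
  have NG: "subgroup ?N G" using N normal_imp_subgroup by blast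
  have QG: "subgroup Q G" using Q subgroup_of_subgroup_iff[OF NG] by (simp add: sylow_subgroup_def)
  have finQ: "finite Q" using fin subgroup.subset[OF QG] finite_subset by blast
  have n: "subgroup (normalizer G Q) G" using normalizer_imp_subgroup[OF subgroup.subset[OF QG]] .
  have "normalizer G Q = carrier G"
    by (rule frattini_normal_nongenerator[OF fin R subset_refl subgroup_self _ n])
      (use subgroup.subset[OF normal_imp_subgroup[OF R]] subgroup.subset[OF n] frattini_argument[OF fin p N Q] in auto)
  then show ?thesis
    using normalizer_iff[OF finQ subgroup.subset[OF QG]] QG normal_inv_iff by blast
qed

text \<open>A \<open>p\<close>-element of \<open>R\<langle>x\<rangle>\<close> has trivial image in the
quotient by \<open>R\<close>, a cyclic group generated by an element whose order is prime to
\<open>p\<close>.\<close>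

lemma (in group) sylow_cyclic_extension:
  assumes fin: "finite (carrier G)" and p: "prime p" and R: "R \<lhd> G"
    and x: "x \<in> carrier G" "x [^] (m::nat) = \<one>" "coprime p m"
    and Q: "sylow_subgroup p Q (G\<lparr>carrier := R\<rparr>)"
  shows "sylow_subgroup p Q (G\<lparr>carrier := R <#> generate G {x}\<rparr>)"
proof -
  let ?K = "R <#> generate G {x}"
  have RG: "subgroup R G" using R normal_imp_subgroup by blast
  have K: "subgroup ?K G" and RK: "R \<subseteq> ?K" using cyclic_extension[OF R x(1)] by auto
  have finK: "finite ?K" using fin subgroup.subset[OF K] finite_subset by blast
  interpret K: group "G\<lparr>carrier := ?K\<rparr>" by (rule subgroup_imp_group[OF K])
  interpret \<pi>: group_hom G "G Mod R" "\<lambda>x. R #> x" by (rule quotient_group_hom[OF R])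
  obtain P where P: "sylow_subgroup p P (G\<lparr>carrier := ?K\<rparr>)" using K.sylow_subgroup_exists[OF _ p] finK by auto
  have PK: "subgroup P G" "P \<subseteq> ?K" and cP: "card P = p ^ multiplicity p (card ?K)"
    using P subgroup_of_subgroup_iff[OF K] by (auto simp: sylow_subgroup_def order_def)
  have pP: "p_subgroup p P G" using PK cP by (auto simp: p_subgroup_def)
  have "P \<subseteq> R"
  proof
    fix y assume y: "y \<in> P"
    have yG: "y \<in> carrier G" using subgroup.mem_carrier[OF PK(1) y] .
    obtain k :: nat where k: "R #> y = (R #> x) [^]\<^bsub>G Mod R\<^esub> k"
      using cyclic_extension_coset[OF fin R x(1)] y PK(2) by blast
    have "(R #> x) [^]\<^bsub>G Mod R\<^esub> m = \<one>\<^bsub>G Mod R\<^esub>" using \<pi>.hom_nat_pow[OF x(1), of m] x(2) \<pi>.hom_one by metis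
    then have "(R #> y) [^]\<^bsub>G Mod R\<^esub> m = \<one>\<^bsub>G Mod R\<^esub>"
      unfolding k using \<pi>.H.nat_pow_pow[OF \<pi>.hom_closed[OF x(1)]] \<pi>.H.nat_pow_one by (metis mult.commute)
    then have "R #> y = \<one>\<^bsub>G Mod R\<^esub>"
      using \<pi>.H.p_element_coprime_pow[OF \<pi>.p_element_hom[OF p_subgroup_p_element[OF pP y]] _ x(3)] by blast
    then show "y \<in> R" using r_coset_eq_iff_mem[OF RG yG] by simp
  qed
  then have "p ^ multiplicity p (card ?K) dvd card R" using card_subgroup_dvd_card[OF PK(1) RG] cP by simp
  moreover have "card R \<noteq> 0" using finite_subset[OF RK finK] subgroup.one_closed[OF RG] by auto
  ultimately have "multiplicity p (card ?K) \<le> multiplicity p (card R)"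
    using p by (metis multiplicity_geI not_prime_unit)
  moreover have "card ?K \<noteq> 0" using finK subgroup.one_closed[OF K] by auto
  then have "multiplicity p (card R) \<le> multiplicity p (card ?K)"
    using card_subgroup_dvd_card[OF RG K RK] by (intro dvd_imp_multiplicity_le)
  ultimately have "multiplicity p (card R) = multiplicity p (card ?K)" by simp
  moreover have "subgroup Q G" "Q \<subseteq> R" using Q subgroup_of_subgroup_iff[OF RG] by (auto simp: sylow_subgroup_def)
  ultimately show ?thesis
    using Q RK subgroup_of_subgroup_iff[OF K] by (auto simp: sylow_subgroup_def order_def)
qed

text \<open>The group-theoretic heart of saturation. With \<open>N\<close> the Frattini subgroup of
\<open>R\<close>, an element \<open>x\<close> of order prime to \<open>p\<close> that acts trivially on
\<open>PN/N\<close> acts trivially on \<open>P\<close>. The commutators of \<open>x\<close> with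
\<open>P\<close> lie in the normal Sylow \<open>p\<close>-subgroup \<open>Q\<close> of \<open>N\<close>. In
the soluble group \<open>R\<langle>x\<rangle>\<close> the element \<open>x\<close> is then forced into a
normal subgroup \<open>S\<close> of order prime to \<open>p\<close>, so it centralizes \<open>Q\<close>, and
the lemma on coprime action finishes the proof.\<close>

lemma (in group) coprime_action_trivial_mod_frattini:
  assumes fin: "finite (carrier G)" and p: "prime p" and R: "R \<lhd> G" "solvable_seq G R"
    and P: "sylow_subgroup p P G"
    and x: "x \<in> carrier G" "x [^] (m::nat) = \<one>" "coprime p m"
    and norm: "\<And>u. u \<in> P \<Longrightarrow> x \<otimes> u \<otimes> inv x \<in> P"
    and mod: "\<And>u. u \<in> P \<Longrightarrow> x \<otimes> u \<otimes> inv x \<otimes> inv u \<in> frattini (G\<lparr>carrier := R\<rparr>)"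
    and u: "u \<in> P"
  shows "x \<otimes> u \<otimes> inv x = u"
proof -
  let ?N = "frattini (G\<lparr>carrier := R\<rparr>)"
  let ?K = "R <#> generate G {x}"
  let ?GK = "G\<lparr>carrier := ?K\<rparr>"
  have N: "?N \<lhd> G" and NR: "?N \<subseteq> R" using frattini_normal[OF R(1)] by auto
  have RG: "subgroup R G" and NG: "subgroup ?N G" using R(1) N normal_imp_subgroup by auto
  have PG: "subgroup P G" using P by (simp add: sylow_subgroup_def)
  have K: "subgroup ?K G" and RK: "R \<subseteq> ?K" and xK: "x \<in> ?K" using cyclic_extension[OF R(1) x(1)] by auto
  have finK: "finite ?K" using fin subgroup.subset[OF K] finite_subset by blast
  have finN: "finite ?N" using fin subgroup.subset[OF NG] finite_subset by blast
  interpret K: group ?GK by (rule subgroup_imp_group[OF K])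
  interpret N: group "G\<lparr>carrier := ?N\<rparr>" by (rule subgroup_imp_group[OF NG])
  obtain Q where Q: "sylow_subgroup p Q (G\<lparr>carrier := ?N\<rparr>)" using N.sylow_subgroup_exists[OF _ p] finN by auto
  have Qn: "Q \<lhd> G" by (rule sylow_frattini_normal[OF fin p R(1) Q])
  have QN: "subgroup Q G" "Q \<subseteq> ?N" using Q subgroup_of_subgroup_iff[OF NG] by (auto simp: sylow_subgroup_def)
  have pQ: "p_subgroup p Q G" using Q QN(1) by (auto simp: sylow_subgroup_def p_subgroup_def)
  have QK: "Q \<subseteq> ?K" using QN(2) NR RK by blast
  have pQK: "p_subgroup p Q ?GK" using pQ QK subgroup_of_subgroup_iff[OF K] by (auto simp: p_subgroup_def)
  have modQ: "x \<otimes> u \<otimes> inv x \<otimes> inv u \<in> Q" if u: "u \<in> P" for u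
  proof -
    have "x \<otimes> u \<otimes> inv x \<otimes> inv u \<in> P"
      using norm[OF u] u subgroup.m_closed[OF PG] subgroup.m_inv_closed[OF PG] by blast
    then have "p_element G p (x \<otimes> u \<otimes> inv x \<otimes> inv u)"
      using p_subgroup_p_element[OF sylow_imp_p_subgroup[OF P]] by blast
    then have "p_element (G\<lparr>carrier := ?N\<rparr>) p (x \<otimes> u \<otimes> inv x \<otimes> inv u)"
      using mod[OF u] p_element_subgroup_iff[OF NG] by blast
    moreover have "Q \<lhd> G\<lparr>carrier := ?N\<rparr>" using normal_restrict_supergroup[OF NG Qn QN(2)] .
    ultimately show ?thesis using N.p_element_in_normal_sylow[OF _ p Q] finN by simp
  qed
  have solK: "solvable ?GK"
    using solvable_subgroup_iff[OF K] solvable_cyclic_extension[OF fin R x(1)] by blast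
  have sPR: "sylow_subgroup p (P \<inter> R) ?GK"
    by (rule sylow_cyclic_extension[OF fin p R(1) x sylow_Int_normal[OF fin p P R(1)]])
  have ng: "H = carrier ?GK" if H: "subgroup H ?GK" and eq: "Q <#>\<^bsub>?GK\<^esub> H = carrier ?GK" for H
  proof -
    have "subgroup H G" "H \<subseteq> ?K" using H subgroup_of_subgroup_iff[OF K] by auto
    then have "H = ?K" by (rule frattini_normal_nongenerator[OF fin R(1) QN(2) K RK]) (use eq in simp)
    then show ?thesis by simp
  qed
  obtain S where S: "S \<lhd> ?GK" "coprime p (card S)"
    and SP: "\<And>y. y \<in> ?K \<Longrightarrow> (\<forall>u\<in>P \<inter> R. y \<otimes> u \<otimes> inv y \<otimes> inv u \<in> Q) \<Longrightarrow> y \<in> S <#> (P \<inter> R)"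
  proof -
    have "inv\<^bsub>?GK\<^esub> v = inv v" if "v \<in> R" for v using m_inv_consistent[OF K] that RK by blast
    moreover obtain S where "S \<lhd> ?GK" "coprime p (card S)"
      "\<forall>y\<in>carrier ?GK. (\<forall>u\<in>P \<inter> R. y \<otimes>\<^bsub>?GK\<^esub> u \<otimes>\<^bsub>?GK\<^esub> inv\<^bsub>?GK\<^esub> y \<otimes>\<^bsub>?GK\<^esub> inv\<^bsub>?GK\<^esub> u \<in> Q)
        \<longrightarrow> y \<in> S <#>\<^bsub>?GK\<^esub> (P \<inter> R)"
      using K.mod_frattini_core[OF _ p solK normal_restrict_supergroup[OF K Qn QK] pQK ng sPR] finK by auto
    ultimately show thesis using that[of S] m_inv_consistent[OF K] by simp
  qed
  have SK: "subgroup S G" "S \<subseteq> ?K" using S(1) normal_imp_subgroup subgroup_of_subgroup_iff[OF K] by auto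
  (* modulo S, x agrees with an element of P, so its image is a p-element of order prime to p *)
  have "x \<in> S"
  proof -
    interpret \<pi>: group_hom ?GK "?GK Mod S" "\<lambda>x. S #>\<^bsub>?GK\<^esub> x" by (rule K.quotient_group_hom[OF S(1)])
    have "x \<in> S <#> (P \<inter> R)" using SP[OF xK] modQ by blast
    then obtain s v where sv: "s \<in> S" "v \<in> P \<inter> R" "x = s \<otimes> v" by (elim set_multE)
    have c: "s \<in> ?K" "v \<in> ?K" using sv SK(2) RK by auto
    have "S #>\<^bsub>?GK\<^esub> s = S" using K.r_coset_eq_iff_mem[OF normal_imp_subgroup[OF S(1)], of s] sv(1) c(1) by simp
    moreover have "S #>\<^bsub>?GK\<^esub> x = (S #>\<^bsub>?GK\<^esub> s) \<otimes>\<^bsub>?GK Mod S\<^esub> (S #>\<^bsub>?GK\<^esub> v)"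
      using \<pi>.hom_mult[of s v] c sv(3) by simp
    ultimately have xv: "S #>\<^bsub>?GK\<^esub> x = S #>\<^bsub>?GK\<^esub> v"
      using \<pi>.H.l_one[OF \<pi>.hom_closed[of v]] c(2) by simp
    have "p_element G p v" using p_subgroup_p_element[OF sylow_imp_p_subgroup[OF P]] sv(2) by blast
    then have "p_element ?GK p v" using p_element_subgroup_iff[OF K] c(2) by blast
    then have px: "p_element (?GK Mod S) p (S #>\<^bsub>?GK\<^esub> x)" using \<pi>.p_element_hom xv by simp
    have xK': "x \<in> carrier ?GK" using xK by simp
    have xm: "x [^]\<^bsub>?GK\<^esub> m = \<one>\<^bsub>?GK\<^esub>" using x(2) by (simp add: nat_pow_consistent[symmetric])
    have "(S #>\<^bsub>?GK\<^esub> x) [^]\<^bsub>?GK Mod S\<^esub> m = \<one>\<^bsub>?GK Mod S\<^esub>"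
      by (simp only: \<pi>.hom_nat_pow[OF xK', symmetric] xm \<pi>.hom_one)
    then have "S #>\<^bsub>?GK\<^esub> x = \<one>\<^bsub>?GK Mod S\<^esub>" using \<pi>.H.p_element_coprime_pow[OF px _ x(3)] by blast
    then show "x \<in> S" using K.r_coset_eq_iff_mem[OF normal_imp_subgroup[OF S(1)], of x] xK by simp
  qed
  obtain b where b: "card Q = p ^ b" using pQ by (auto simp: p_subgroup_def)
  have "coprime (card S) (card Q)" using S(2) b by (simp add: coprime_commute)
  then have SQ: "S \<inter> Q = {\<one>}" using coprime_card_Int[OF SK(1) QN(1)] by blast
  have xQ: "x \<otimes> n = n \<otimes> x" if n: "n \<in> Q" for n
  proof -
    have nK: "n \<in> ?K" using n QK by blast
    have nG: "n \<in> carrier G" using subgroup.mem_carrier[OF QN(1) n] .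
    have "inv x \<in> S" using \<open>x \<in> S\<close> subgroup.m_inv_closed[OF SK(1)] by blast
    then have "n \<otimes> inv x \<otimes> inv n \<in> S"
      using normal.inv_op_closed2[OF S(1), of n "inv x"] nK m_inv_consistent[OF K nK] by simp
    then have "x \<otimes> (n \<otimes> inv x \<otimes> inv n) \<in> S" using \<open>x \<in> S\<close> subgroup.m_closed[OF SK(1)] by blast
    then have "x \<otimes> n \<otimes> inv x \<otimes> inv n \<in> S" using x(1) nG by (simp add: m_assoc)
    moreover have "x \<otimes> n \<otimes> inv x \<otimes> inv n \<in> Q"
      using normal.inv_op_closed2[OF Qn x(1) n] subgroup.m_closed[OF QN(1)] subgroup.m_inv_closed[OF QN(1) n] by blast
    ultimately have "x \<otimes> n \<otimes> inv x \<otimes> inv n = \<one>" using SQ by blast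
    then show ?thesis by (rule commute_if_commutator_one[OF x(1) nG])
  qed
  have uG: "u \<in> carrier G" using subgroup.mem_carrier[OF PG u] .
  show ?thesis
  proof (rule coprime_action_trivial[OF x(1) uG p_subgroup_p_element[OF pQ modQ[OF u]] xQ[OF modQ[OF u]] _ x(2,3)])
    show "x \<otimes> u \<otimes> inv x = x \<otimes> u \<otimes> inv x \<otimes> inv u \<otimes> u" using x(1) uG by (simp add: m_assoc)
  qed
qed

text \<open>Otherwise a Sylow \<open>p\<close>-subgroup \<open>Q\<close> of the Frattini subgroup is a Sylow
\<open>p\<close>-subgroup of \<open>R\<close>. All elements of \<open>R\<close> centralize \<open>Q\<close>
modulo \<open>Q\<close>, so \<open>R = SQ\<close> with \<open>S\<close> of order prime to \<open>p\<close>.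
As \<open>Q\<close> consists of nongenerators, \<open>R = S\<close>, which is impossible.\<close>

lemma (in group) prime_dvd_card_frattini:
  assumes fin: "finite (carrier G)" and p: "prime p" and R: "R \<lhd> G" "solvable_seq G R"
    and dvd: "p dvd card (frattini (G\<lparr>carrier := R\<rparr>))"
  shows "p dvd order (G Mod frattini (G\<lparr>carrier := R\<rparr>))"
proof -
  let ?N = "frattini (G\<lparr>carrier := R\<rparr>)"
  let ?GR = "G\<lparr>carrier := R\<rparr>"
  have N: "?N \<lhd> G" and NR: "?N \<subseteq> R" using frattini_normal[OF R(1)] by auto
  have RG: "subgroup R G" and NG: "subgroup ?N G" using R(1) N normal_imp_subgroup by auto
  have finR: "finite R" using fin subgroup.subset[OF RG] finite_subset by blast
  have finN: "finite ?N" using NR finR finite_subset by blast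
  interpret R: group ?GR by (rule subgroup_imp_group[OF RG])
  interpret N: group "G\<lparr>carrier := ?N\<rparr>" by (rule subgroup_imp_group[OF NG])
  obtain k where k: "card R = card ?N * k" using card_subgroup_dvd_card[OF NG RG NR] by blast
  have nz: "card R \<noteq> 0" using finR subgroup.one_closed[OF RG] by auto
  have "p dvd k"
  proof (rule ccontr)
    assume "\<not> p dvd k"
    obtain Q where Q: "sylow_subgroup p Q (G\<lparr>carrier := ?N\<rparr>)" using N.sylow_subgroup_exists[OF _ p] finN by auto
    have Qn: "Q \<lhd> G" by (rule sylow_frattini_normal[OF fin p R(1) Q])
    have QN: "subgroup Q G" "Q \<subseteq> ?N" and cQ: "card Q = p ^ multiplicity p (card ?N)"
      using Q subgroup_of_subgroup_iff[OF NG] by (auto simp: sylow_subgroup_def order_def)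
    have QR: "Q \<subseteq> R" using QN NR by blast
    have pQR: "p_subgroup p Q ?GR" using cQ QN QR subgroup_of_subgroup_iff[OF RG] by (auto simp: p_subgroup_def)
    have "multiplicity p k = 0" using \<open>\<not> p dvd k\<close> by (rule not_dvd_imp_multiplicity_0)
    moreover have "multiplicity p (card R) = multiplicity p (card ?N) + multiplicity p k"
      unfolding k using nz k p by (intro prime_elem_multiplicity_mult_distrib) auto
    ultimately have sQ: "sylow_subgroup p Q ?GR"
      using pQR cQ by (simp add: sylow_subgroup_def p_subgroup_def order_def)
    have ng: "H = carrier ?GR" if H: "subgroup H ?GR" and eq: "Q <#>\<^bsub>?GR\<^esub> H = carrier ?GR" for H
    proof -
      have "subgroup H G" "H \<subseteq> R" using H subgroup_of_subgroup_iff[OF RG] by auto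
      then have "H = R" by (rule frattini_normal_nongenerator[OF fin R(1) QN(2) RG subset_refl]) (use eq in simp)
      then show ?thesis by simp
    qed
    have solR: "solvable ?GR" using solvable_subgroup_iff[OF RG] R(2) by blast
    have QnR: "Q \<lhd> ?GR" by (rule normal_restrict_supergroup[OF RG Qn QR])
    obtain S where S: "S \<lhd> ?GR" "coprime p (card S)"
      and SP: "\<And>y. y \<in> R \<Longrightarrow> (\<forall>u\<in>Q. y \<otimes> u \<otimes> inv y \<otimes> inv u \<in> Q) \<Longrightarrow> y \<in> S <#> Q"
    proof -
      have "inv\<^bsub>?GR\<^esub> v = inv v" if "v \<in> Q" for v using m_inv_consistent[OF RG] that QR by blast
      moreover obtain S where "S \<lhd> ?GR" "coprime p (card S)"
        "\<forall>y\<in>carrier ?GR. (\<forall>u\<in>Q. y \<otimes>\<^bsub>?GR\<^esub> u \<otimes>\<^bsub>?GR\<^esub> inv\<^bsub>?GR\<^esub> y \<otimes>\<^bsub>?GR\<^esub> inv\<^bsub>?GR\<^esub> u \<in> Q)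
          \<longrightarrow> y \<in> S <#>\<^bsub>?GR\<^esub> Q"
        using R.mod_frattini_core[OF _ p solR QnR pQR ng sQ] finR by auto
      ultimately show thesis using that[of S] m_inv_consistent[OF RG] by simp
    qed
    have SR: "subgroup S ?GR" using S(1) normal_imp_subgroup by blast
    have "R \<subseteq> S <#> Q"
    proof
      fix y assume y: "y \<in> R"
      have "y \<otimes> u \<otimes> inv y \<otimes> inv u \<in> Q" if u: "u \<in> Q" for u
        using normal.inv_op_closed2[OF Qn subgroup.mem_carrier[OF RG y] u]
          subgroup.m_closed[OF QN(1)] subgroup.m_inv_closed[OF QN(1) u] by blast
      then show "y \<in> S <#> Q" using SP[OF y] by blast
    qed
    have "R \<subseteq> Q <#> S"
    proof
      fix y assume y: "y \<in> R"
      then have iy: "inv y \<in> S <#> Q" using \<open>R \<subseteq> S <#> Q\<close> subgroup.m_inv_closed[OF RG] by blast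
      have S': "subgroup S G" using SR subgroup_of_subgroup_iff[OF RG] by blast
      obtain s q where sq: "s \<in> S" "q \<in> Q" "inv y = s \<otimes> q" using iy by (elim set_multE)
      have "y = inv (s \<otimes> q)" using sq(3) inv_inv[OF subgroup.mem_carrier[OF RG y]] by simp
      also have "\<dots> = inv q \<otimes> inv s"
        using subgroup.mem_carrier[OF S' sq(1)] subgroup.mem_carrier[OF QN(1) sq(2)] by (rule inv_mult_group)
      finally show "y \<in> Q <#> S"
        using set_multI[OF subgroup.m_inv_closed[OF QN(1) sq(2)] subgroup.m_inv_closed[OF S' sq(1)]] by simp
    qed
    moreover have "Q <#> S \<subseteq> R"
      by (rule set_mult_subset_subgroup[OF RG QR]) (use SR subgroup_of_subgroup_iff[OF RG] in blast)
    ultimately have "S = R" using ng[OF SR] by simp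
    moreover have "p dvd card R" using dvd k by simp
    ultimately show False using S(2) p by (metis coprime_absorb_left not_prime_unit)
  qed
  obtain j where j: "order G = card R * j" using card_subgroup_dvd[OF RG] by blast
  have "card (rcosets ?N) * card ?N = card ?N * (k * j)" using lagrange[OF NG] j k by simp
  then have "card (rcosets ?N) = k * j" using nz k by simp
  then show ?thesis using \<open>p dvd k\<close> by (simp add: order_def FactGroup_def)
qed

section \<open>Arcs of the Sylow graph\<close>

lemma (in group) mem_subgroup_of_coprime_pow:
  assumes D: "subgroup D G" and x: "x \<in> carrier G" "x [^] (m::nat) \<in> D" "x [^] (n::nat) = \<one>" "coprime m n" "m \<noteq> 0"
  shows "x \<in> D"
proof -
  obtain a b where ab: "m * a = n * b + 1" using bezout_nat[OF x(5), of n] x(4) by auto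
  have "(x [^] m) [^] a = x [^] (n * b + 1)" using x(1) ab by (simp add: nat_pow_pow)
  also have "\<dots> = (x [^] n) [^] b \<otimes> x" using x(1) by (simp add: nat_pow_mult[symmetric] nat_pow_pow[symmetric])
  also have "\<dots> = x" using x by simp
  finally show ?thesis using nat_pow_mem_subgroup[OF D x(2), of a] by simp
qed

lemma (in group) p_element_prime_dvd_order:
  assumes fin: "finite (carrier G)" and q: "prime q" and x: "p_element G q x" "x \<noteq> \<one>"
  shows "q dvd order G"
proof -
  have xG: "x \<in> carrier G" using x by (simp add: p_element_def)
  have s: "p_subgroup q (generate G {x}) G" using p_element_generate[OF x(1) q] .
  then obtain k where k: "card (generate G {x}) = q ^ k" by (auto simp: p_subgroup_def)
  have "k \<noteq> 0"
  proof
    assume "k = 0"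
    then have "card (generate G {x}) = 1" using k by simp
    then obtain z where "generate G {x} = {z}" using card_1_singletonE by blast
    then show False using x(2) mem_generate_self[of x] generate.one[of G "{x}"] by auto
  qed
  then have "q dvd card (generate G {x})" using k by (simp add: dvd_power)
  then show ?thesis using card_subgroup_dvd s dvd_trans unfolding p_subgroup_def by blast
qed

lemma (in group) sylow_conj_action:
  assumes fin: "finite (carrier G)" and p: "prime p" and P: "sylow_subgroup p P G" "sylow_subgroup p P' G"
    and x: "p_element G q x" "\<And>u. u \<in> P \<Longrightarrow> x \<otimes> u \<otimes> inv x \<in> P"
    and u: "u \<in> P" "x \<otimes> u \<noteq> u \<otimes> x"
  shows "\<exists>y. p_element G q y \<and> (\<forall>u\<in>P'. y \<otimes> u \<otimes> inv y \<in> P') \<and> (\<exists>u\<in>P'. y \<otimes> u \<noteq> u \<otimes> y)"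
proof -
  obtain g where g: "g \<in> carrier G" "(\<lambda>x. g \<otimes> x \<otimes> inv g) ` P = P'"
    using sylow_conjugate[OF fin p P(2,1)] by blast
  interpret c: group_hom G G "\<lambda>x. g \<otimes> x \<otimes> inv g"
    using g(1) by unfold_locales (auto simp: hom_def conj_mult)
  let ?y = "g \<otimes> x \<otimes> inv g"
  have PG: "subgroup P G" using P by (simp add: sylow_subgroup_def)
  have xG: "x \<in> carrier G" using x by (simp add: p_element_def)
  have uG: "v \<in> carrier G" if "v \<in> P" for v using subgroup.mem_carrier[OF PG that] .
  have "?y \<otimes> w \<otimes> inv ?y \<in> P'" if "w \<in> P'" for w
  proof -
    obtain v where v: "v \<in> P" "w = g \<otimes> v \<otimes> inv g" using \<open>w \<in> P'\<close> g(2) by blast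
    have "g \<otimes> (x \<otimes> v \<otimes> inv x) \<otimes> inv g \<in> P'" using x(2)[OF v(1)] g(2) by blast
    moreover have "g \<otimes> (x \<otimes> v \<otimes> inv x) \<otimes> inv g = ?y \<otimes> w \<otimes> inv ?y"
      unfolding v(2) using g(1) xG uG[OF v(1)] by (simp add: m_assoc inv_mult_group inv_mult_cancel)
    ultimately show ?thesis by simp
  qed
  moreover have "?y \<otimes> (g \<otimes> u \<otimes> inv g) \<noteq> (g \<otimes> u \<otimes> inv g) \<otimes> ?y"
  proof
    assume "?y \<otimes> (g \<otimes> u \<otimes> inv g) = (g \<otimes> u \<otimes> inv g) \<otimes> ?y"
    then have "g \<otimes> (x \<otimes> u) \<otimes> inv g = g \<otimes> (u \<otimes> x) \<otimes> inv g"
      by (simp only: conj_mult[OF g(1) xG uG[OF u(1)]] conj_mult[OF g(1) uG[OF u(1)] xG])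
    then show False
      using conj_eq_iff[OF g(1) m_closed[OF xG uG[OF u(1)]] m_closed[OF uG[OF u(1)] xG]] u(2) by blast
  qed
  moreover have "g \<otimes> u \<otimes> inv g \<in> P'" using g(2) u(1) by blast
  ultimately show ?thesis using c.p_element_hom[OF x(1)] by blast
qed

lemma (in group) mult_centralizer_normal:
  assumes fin: "finite (carrier G)" and P: "subgroup P G"
  shows "P <#> centralizer G P \<lhd> G\<lparr>carrier := normalizer G P\<rparr>"
proof -
  let ?N = "normalizer G P"
  let ?C = "centralizer G P"
  have PG: "P \<subseteq> carrier G" using subgroup.subset[OF P] .
  have finP: "finite P" using fin PG finite_subset by blast
  note niff = normalizer_iff[OF finP PG]
  have N: "subgroup ?N G" using normalizer_imp_subgroup[OF PG] .
  interpret N: group "G\<lparr>carrier := ?N\<rparr>" by (rule subgroup_imp_group[OF N])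
  have C: "subgroup ?C G" using centralizer_subgroup[OF PG] .
  have comm: "c \<otimes> u = u \<otimes> c" if "c \<in> ?C" "u \<in> P" for c u using that by (simp add: centralizer_def)
  have CN: "?C \<subseteq> ?N"
  proof
    fix c assume c: "c \<in> ?C"
    have cG: "c \<in> carrier G" using subgroup.mem_carrier[OF C c] .
    have "c \<otimes> u \<otimes> inv c = u" if "u \<in> P" for u
      using comm[OF c that] cG PG that by (simp add: m_assoc subset_iff)
    then show "c \<in> ?N" using niff cG by simp
  qed
  have PN: "P \<subseteq> ?N" using subgroup_le_normalizer[OF fin P] .
  have conjP: "n \<otimes> u \<otimes> inv n \<in> P" if "n \<in> ?N" "u \<in> P" for n u using that niff by blast
  have conjC: "n \<otimes> c \<otimes> inv n \<in> ?C" if n: "n \<in> ?N" and c: "c \<in> ?C" for n c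
  proof -
    have cG: "c \<in> carrier G" and nG: "n \<in> carrier G"
      using subgroup.mem_carrier[OF C c] subgroup.mem_carrier[OF N n] by auto
    have "(n \<otimes> c \<otimes> inv n) \<otimes> u = u \<otimes> (n \<otimes> c \<otimes> inv n)" if u: "u \<in> P" for u
    proof -
      define v where "v = inv n \<otimes> u \<otimes> n"
      have "v \<in> P" using conjP[OF subgroup.m_inv_closed[OF N n] u] nG by (simp add: v_def)
      have uG: "u \<in> carrier G" and vG: "v \<in> carrier G" using u \<open>v \<in> P\<close> PG by auto
      have uv: "u = n \<otimes> v \<otimes> inv n" using nG uG by (simp add: v_def m_assoc inv_mult_cancel)
      show ?thesis
        unfolding uv using conj_mult[OF nG cG vG] conj_mult[OF nG vG cG] comm[OF c \<open>v \<in> P\<close>] by simp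
    qed
    then show ?thesis using nG cG by (simp add: centralizer_def)
  qed
  have L: "subgroup (P <#> ?C) G"
    using subgroup_set_mult[OF P C] conjP CN by blast
  have LN: "P <#> ?C \<subseteq> ?N" using set_mult_subset_subgroup[OF N PN CN] .
  have "x \<otimes> l \<otimes> inv x \<in> P <#> ?C" if x: "x \<in> ?N" and l: "l \<in> P <#> ?C" for x l
  proof -
    obtain u c where uc: "u \<in> P" "c \<in> ?C" "l = u \<otimes> c" using l by (elim set_multE)
    have xG: "x \<in> carrier G" using subgroup.mem_carrier[OF N x] .
    have "x \<otimes> l \<otimes> inv x = (x \<otimes> u \<otimes> inv x) \<otimes> (x \<otimes> c \<otimes> inv x)"
      unfolding uc(3) using conj_mult[OF xG] subgroup.mem_carrier[OF P uc(1)] subgroup.mem_carrier[OF C uc(2)] by blast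
    then show ?thesis using set_multI[OF conjP[OF x uc(1)] conjC[OF x uc(2)]] by simp
  qed
  then show ?thesis
    unfolding N.normal_inv_iff using subgroup_of_subgroup_iff[OF N] L LN m_inv_consistent[OF N] by simp
qed

lemma (in group) prime_divisors_iff:
  assumes "finite (carrier G)"
  shows "p \<in> prime_divisors G \<longleftrightarrow> prime p \<and> p dvd order G"
  using assms order_gt_0_iff_finite by (auto simp: prime_divisors_def in_prime_factors_iff)

text \<open>The elementary description of arcs. If \<open>q\<close> divides the order of
\<open>N(P)/PC(P)\<close>, take a preimage \<open>y\<close> of an element of order \<open>q\<close>; its
\<open>q\<close>-part is outside \<open>PC(P)\<close>. Conversely, if a \<open>q\<close>-element \<open>x =
vc\<close> were in \<open>PC(P)\<close>, its power \<open>x\<^sup>|\<^sup>P\<^sup>|\<close> would be a power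
of \<open>c\<close>, and \<open>x\<close> would lie in \<open>C(P)\<close>. The primes are distinct because
\<open>P\<close> is a Sylow subgroup.\<close>

lemma (in group) sylow_graph_arc_iff:
  assumes fin: "finite (carrier G)"
  shows "(p, q) \<in> parcs (sylow_graph G) \<longleftrightarrow> prime p \<and> prime q \<and> p \<noteq> q \<and>
    (\<exists>P x. sylow_subgroup p P G \<and> p_element G q x \<and> (\<forall>u\<in>P. x \<otimes> u \<otimes> inv x \<in> P) \<and> (\<exists>u\<in>P. x \<otimes> u \<noteq> u \<otimes> x))"
    (is "?L \<longleftrightarrow> ?R")
proof -
  have step: "q \<in> prime_divisors (G\<lparr>carrier := normalizer G P\<rparr> Mod (P <#> centralizer G P)) \<longleftrightarrow>
      prime q \<and> p \<noteq> q \<and> (\<exists>x. p_element G q x \<and> (\<forall>u\<in>P. x \<otimes> u \<otimes> inv x \<in> P) \<and> (\<exists>u\<in>P. x \<otimes> u \<noteq> u \<otimes> x))"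
    (is "?Q \<longleftrightarrow> ?X") if p: "prime p" and P: "sylow_subgroup p P G" for P
  proof -
    let ?N = "normalizer G P"
    let ?C = "centralizer G P"
    let ?L = "P <#> ?C"
    let ?GN = "G\<lparr>carrier := ?N\<rparr>"
    have PG: "subgroup P G" and cP: "card P = p ^ multiplicity p (order G)" using P by (auto simp: sylow_subgroup_def)
    have finP: "finite P" using fin subgroup.subset[OF PG] finite_subset by blast
    note niff = normalizer_iff[OF finP subgroup.subset[OF PG]]
    have N: "subgroup ?N G" using normalizer_imp_subgroup[OF subgroup.subset[OF PG]] .
    interpret N: group ?GN by (rule subgroup_imp_group[OF N])
    have C: "subgroup ?C G" using centralizer_subgroup[OF subgroup.subset[OF PG]] .
    have Ln: "?L \<lhd> ?GN" by (rule mult_centralizer_normal[OF fin PG])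
    have LN: "subgroup ?L G" "?L \<subseteq> ?N"
      using normal_imp_subgroup[OF Ln] subgroup_of_subgroup_iff[OF N] by auto
    interpret \<pi>: group_hom ?GN "?GN Mod ?L" "\<lambda>x. ?L #>\<^bsub>?GN\<^esub> x" by (rule N.quotient_group_hom[OF Ln])
    have finQ: "finite (carrier (?GN Mod ?L))"
      using finite_subset[OF subgroup.subset[OF N] fin] by (simp add: carrier_FactGroup)
    have mem: "?L #>\<^bsub>?GN\<^esub> y = \<one>\<^bsub>?GN Mod ?L\<^esub> \<longleftrightarrow> y \<in> ?L" if "y \<in> ?N" for y
      using N.r_coset_eq_iff_mem[OF normal_imp_subgroup[OF Ln], of y] that by simp
    have PL: "P \<subseteq> ?L" by (rule subset_set_mult_left[OF subgroup.subset[OF PG] C])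
    have CL: "?C \<subseteq> ?L" by (rule subset_set_mult_right[OF PG subgroup.subset[OF C]])
    show ?thesis
    proof
      assume ?Q
      then have q: "prime q" "q dvd order (?GN Mod ?L)" using \<pi>.H.prime_divisors_iff[OF finQ] by auto
      have "p \<noteq> q"
      proof
        assume "p = q"
        have "order (?GN Mod ?L) * card ?L = card ?N"
          using N.lagrange[OF normal_imp_subgroup[OF Ln]] by (simp add: order_def FactGroup_def)
        then have "p * card P dvd card ?N"
          using q(2) card_subgroup_dvd_card[OF PG LN(1) PL] \<open>p = q\<close> by (metis mult_dvd_mono)
        then have "p ^ Suc (multiplicity p (order G)) dvd order G"
          using card_subgroup_dvd[OF N] cP by (metis power_Suc dvd_trans)
        moreover have "order G \<noteq> 0" using fin order_gt_0_iff_finite by simp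
        ultimately show False using p by (metis multiplicity_geI not_less_eq_eq order_refl not_prime_unit)
      qed
      obtain X where X: "X \<in> carrier (?GN Mod ?L)" "X \<noteq> \<one>\<^bsub>?GN Mod ?L\<^esub>" "X [^]\<^bsub>?GN Mod ?L\<^esub> q = \<one>\<^bsub>?GN Mod ?L\<^esub>"
        using \<pi>.H.cauchy[OF finQ q] by blast
      obtain y where y: "y \<in> ?N" "X = ?L #>\<^bsub>?GN\<^esub> y" using X(1) by (auto simp: carrier_FactGroup)
      have yG: "y \<in> carrier G" using subgroup.mem_carrier[OF N y(1)] .
      obtain m where m: "order G = q ^ multiplicity q (order G) * m" "\<not> q dvd m"
        using multiplicity_decompose'[of "order G" q] fin order_gt_0_iff_finite q(1) by (metis not_prime_unit not_gr_zero)
      (* m is the part of |G| prime to q, so ?x is the q-part of y up to a power *)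
      let ?x = "y [^] m"
      have "?x [^] q ^ multiplicity q (order G) = \<one>"
        using pow_order_eq_1[OF yG] nat_pow_pow[OF yG] m(1) by (metis mult.commute)
      then have px: "p_element G q ?x" using yG by (auto simp: p_element_def)
      have xN: "?x \<in> ?N" using nat_pow_mem_subgroup[OF N y(1)] .
      have "?x \<notin> ?C"
      proof
        assume "?x \<in> ?C"
        then have "?L #>\<^bsub>?GN\<^esub> ?x = \<one>\<^bsub>?GN Mod ?L\<^esub>" using CL mem[OF xN] by blast
        moreover have "?L #>\<^bsub>?GN\<^esub> (y [^]\<^bsub>?GN\<^esub> m) = X [^]\<^bsub>?GN Mod ?L\<^esub> m"
          using \<pi>.hom_nat_pow[of y m] y by simp
        moreover have "y [^]\<^bsub>?GN\<^esub> m = ?x" by (simp add: nat_pow_consistent[symmetric])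
        ultimately have "X [^]\<^bsub>?GN Mod ?L\<^esub> m = \<one>\<^bsub>?GN Mod ?L\<^esub>" by (simp only:)
        then have "X = \<one>\<^bsub>?GN Mod ?L\<^esub>"
          using \<pi>.H.pow_coprime_eq_one[OF X(1) X(3)] m(2) q(1) by (metis prime_imp_coprime)
        then show False using X(2) by blast
      qed
      then obtain u where "u \<in> P" "?x \<otimes> u \<noteq> u \<otimes> ?x" using px by (auto simp: centralizer_def p_element_def)
      then show ?X using q(1) \<open>p \<noteq> q\<close> px xN niff by blast
    next
      assume ?X
      then obtain x u where q: "prime q" "p \<noteq> q" and x: "p_element G q x" "\<And>u. u \<in> P \<Longrightarrow> x \<otimes> u \<otimes> inv x \<in> P"
        and u: "u \<in> P" "x \<otimes> u \<noteq> u \<otimes> x" by blast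
      have xG: "x \<in> carrier G" using x by (simp add: p_element_def)
      have xN: "x \<in> ?N" using niff xG x(2) by blast
      have xC: "x \<notin> ?C" using u by (auto simp: centralizer_def)
      have "x \<notin> ?L"
      proof
        assume "x \<in> ?L"
        then obtain v c where vc: "v \<in> P" "c \<in> ?C" "x = v \<otimes> c" by (elim set_multE)
        have c: "v \<in> carrier G" "c \<in> carrier G" using subgroup.mem_carrier[OF PG vc(1)] subgroup.mem_carrier[OF C vc(2)] by auto
        have "v \<otimes> c = c \<otimes> v" using vc by (simp add: centralizer_def)
        then have "x [^] card P = v [^] card P \<otimes> c [^] card P" unfolding vc(3) by (rule pow_mult_distrib[OF _ c])
        also have "\<dots> = c [^] card P" using pow_card_subgroup_eq_one[OF PG vc(1)] c by simp
        finally have 1: "x [^] card P \<in> ?C" using nat_pow_mem_subgroup[OF C vc(2)] by simp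
        obtain k where k: "x [^] q ^ k = \<one>" using x(1) by (auto simp: p_element_def)
        have "coprime (card P) (q ^ k)" "card P \<noteq> 0" using cP p q by (auto simp: primes_coprime)
        then have "x \<in> ?C" using mem_subgroup_of_coprime_pow[OF C xG 1 k] by blast
        then show False using xC by blast
      qed
      then have "?L #>\<^bsub>?GN\<^esub> x \<noteq> \<one>\<^bsub>?GN Mod ?L\<^esub>" using mem[OF xN] by blast
      moreover have "p_element (?GN Mod ?L) q (?L #>\<^bsub>?GN\<^esub> x)"
        using \<pi>.p_element_hom p_element_subgroup_iff[OF N] xN x(1) by blast
      ultimately have "q dvd order (?GN Mod ?L)" using \<pi>.H.p_element_prime_dvd_order[OF finQ q(1)] by blast
      then show ?Q using \<pi>.H.prime_divisors_iff[OF finQ] q(1) by blast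
    qed
  qed
  have dvd: "p dvd order G" if p: "prime p" and P: "sylow_subgroup p P G" and u: "u \<in> P" "x \<otimes> u \<noteq> u \<otimes> x" "x \<in> carrier G" for P x u
  proof -
    have "p_element G p u" using p_subgroup_p_element[OF sylow_imp_p_subgroup[OF P] u(1)] .
    moreover have "u \<noteq> \<one>" using u by auto
    ultimately show ?thesis by (rule p_element_prime_dvd_order[OF fin p])
  qed
  have "?L \<longleftrightarrow> p \<in> prime_divisors G \<and> (\<exists>P. sylow_subgroup p P G \<and>
      q \<in> prime_divisors (G\<lparr>carrier := normalizer G P\<rparr> Mod (P <#> centralizer G P)))"
    by (simp add: sylow_graph_def)
  also have "\<dots> \<longleftrightarrow> ?R"
    using step dvd unfolding prime_divisors_iff[OF fin] p_element_def by (intro iffI) (blast, blast)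
  finally show ?thesis .
qed

text \<open>By conjugacy, an arc is witnessed at every Sylow subgroup. This is how arcs are excluded
below.\<close>

lemma (in group) sylow_graph_arc_at_sylow:
  assumes fin: "finite (carrier G)" and a: "(p, q) \<in> parcs (sylow_graph G)" and P: "sylow_subgroup p P G"
  shows "\<exists>x. p_element G q x \<and> (\<forall>u\<in>P. x \<otimes> u \<otimes> inv x \<in> P) \<and> (\<exists>u\<in>P. x \<otimes> u \<noteq> u \<otimes> x)"
proof -
  obtain P' x u where "prime p" "sylow_subgroup p P' G" "p_element G q x" "\<And>u. u \<in> P' \<Longrightarrow> x \<otimes> u \<otimes> inv x \<in> P'"
      "u \<in> P'" "x \<otimes> u \<noteq> u \<otimes> x"
    using a unfolding sylow_graph_arc_iff[OF fin] by blast
  then show ?thesis using sylow_conj_action[OF fin _ _ P] by blast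
qed

lemma (in group) sylow_graph_arc_verts:
  assumes fin: "finite (carrier G)" and a: "(p, q) \<in> parcs (sylow_graph G)"
  shows "p \<in> pverts (sylow_graph G)" "q \<in> pverts (sylow_graph G)"
proof -
  show "p \<in> pverts (sylow_graph G)" using a by (simp add: sylow_graph_def)
  obtain x P u where q: "prime q" "p_element G q x" and u: "sylow_subgroup p P G" "u \<in> P" "x \<otimes> u \<noteq> u \<otimes> x"
    using a unfolding sylow_graph_arc_iff[OF fin] by blast
  have "u \<in> carrier G" using u subgroup.mem_carrier[of P G u] by (simp add: sylow_subgroup_def)
  then have "x \<noteq> \<one>" using u(3) by auto
  then have "q dvd order G" using p_element_prime_dvd_order[OF fin q] by blast
  then show "q \<in> pverts (sylow_graph G)" using q prime_divisors_iff[OF fin] by (simp add: sylow_graph_def)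
qed

lemma sylow_graph_arcs_iso_subset:
  assumes G: "finite_group G" and H: "group H" and h: "h \<in> iso G H"
  shows "parcs (sylow_graph G) \<subseteq> parcs (sylow_graph H)"
proof -
  interpret G: group G using G by (simp add: finite_group_def)
  interpret H: group H by (rule H)
  interpret h: group_hom G H h using h by unfold_locales (simp add: iso_def)
  have finG: "finite (carrier G)" using G by (simp add: finite_group_def)
  have inj: "inj_on h (carrier G)" and surj: "h ` carrier G = carrier H"
    using h by (auto simp: iso_def bij_betw_def)
  have finH: "finite (carrier H)" using finG surj finite_imageI by metis
  have o: "order H = order G" using inj surj card_image unfolding order_def by metis
  have "(p, q) \<in> parcs (sylow_graph H)" if a: "(p, q) \<in> parcs (sylow_graph G)" for p q
  proof -
    obtain P x u where pq: "prime p" "prime q" "p \<noteq> q" and P: "sylow_subgroup p P G" and x: "p_element G q x"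
      and norm: "\<And>u. u \<in> P \<Longrightarrow> x \<otimes>\<^bsub>G\<^esub> u \<otimes>\<^bsub>G\<^esub> inv\<^bsub>G\<^esub> x \<in> P"
      and u: "u \<in> P" "x \<otimes>\<^bsub>G\<^esub> u \<noteq> u \<otimes>\<^bsub>G\<^esub> x"
      using a unfolding G.sylow_graph_arc_iff[OF finG] by blast
    have PG: "subgroup P G" using P by (simp add: sylow_subgroup_def)
    note c = subgroup.mem_carrier[OF PG]
    have xG: "x \<in> carrier G" using x by (simp add: p_element_def)
    have "sylow_subgroup p (h ` P) H" by (rule h.sylow_img[OF finG pq(1) P surj])
    moreover have "p_element H q (h x)" by (rule h.p_element_hom[OF x])
    moreover have "h x \<otimes>\<^bsub>H\<^esub> w \<otimes>\<^bsub>H\<^esub> inv\<^bsub>H\<^esub> h x \<in> h ` P" if w: "w \<in> h ` P" for w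
    proof -
      obtain v where v: "v \<in> P" "w = h v" using w by blast
      have "h (x \<otimes>\<^bsub>G\<^esub> v \<otimes>\<^bsub>G\<^esub> inv\<^bsub>G\<^esub> x) \<in> h ` P" using norm[OF v(1)] by blast
      then show ?thesis using v xG c[OF v(1)] by simp
    qed
    moreover have "h x \<otimes>\<^bsub>H\<^esub> h u \<noteq> h u \<otimes>\<^bsub>H\<^esub> h x"
    proof
      assume "h x \<otimes>\<^bsub>H\<^esub> h u = h u \<otimes>\<^bsub>H\<^esub> h x"
      then have "h (x \<otimes>\<^bsub>G\<^esub> u) = h (u \<otimes>\<^bsub>G\<^esub> x)" using xG c[OF u(1)] by simp
      then show False using inj_onD[OF inj] xG c[OF u(1)] u(2) by auto
    qed
    ultimately show ?thesis unfolding H.sylow_graph_arc_iff[OF finH] using pq u(1) by blast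
  qed
  then show ?thesis by auto
qed

lemma sylow_graph_iso:
  assumes G: "finite_group G" and H: "group H" and iso: "G \<cong> H"
  shows "sylow_graph G = sylow_graph H"
proof -
  obtain h where h: "h \<in> iso G H" using iso by (auto simp: is_iso_def)
  obtain h' where h': "h' \<in> iso H G" using group.iso_sym[of G H] iso G by (auto simp: is_iso_def finite_group_def)
  have c: "card (carrier G) = card (carrier H)" using iso iso_same_card by blast
  have "finite (carrier H)" using h G bij_betw_finite by (auto simp: iso_def finite_group_def)
  then have H': "finite_group H" using H by (simp add: finite_group_def)
  have "parcs (sylow_graph G) = parcs (sylow_graph H)"
    using sylow_graph_arcs_iso_subset[OF G H h] sylow_graph_arcs_iso_subset[OF H' _ h'] G
    by (auto simp: finite_group_def)
  moreover have "pverts (sylow_graph G) = pverts (sylow_graph H)"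
    using c by (simp add: sylow_graph_def prime_divisors_def order_def)
  ultimately show ?thesis by (intro pair_pre_digraph.equality) auto
qed

lemma (in group) sylow_graph_nilpotent:
  assumes fin: "finite (carrier G)" and nil: "nilpotent_group G"
  shows "parcs (sylow_graph G) = {}"
proof -
  have False if a: "(p, q) \<in> parcs (sylow_graph G)" for p q
  proof -
    obtain P x u where pq: "prime p" "prime q" "p \<noteq> q" and P: "sylow_subgroup p P G" and x: "p_element G q x"
      and norm: "\<And>u. u \<in> P \<Longrightarrow> x \<otimes> u \<otimes> inv x \<in> P" and u: "u \<in> P" "x \<otimes> u \<noteq> u \<otimes> x"
      using a unfolding sylow_graph_arc_iff[OF fin] by blast
    obtain k where k: "x \<in> carrier G" "x [^] q ^ k = \<one>" using x by (auto simp: p_element_def)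
    have "coprime p (q ^ k)" using pq by (simp add: primes_coprime)
    then show False
      using nilpotent_coprime_commute[OF nil sylow_imp_p_subgroup[OF P] k _ norm u(1)] u(2) by blast
  qed
  then show ?thesis by auto
qed

lemma (in group) sylow_graph_two_primes:
  assumes fin: "finite (carrier G)" and pq: "prime p" "prime q" "p \<noteq> q" and ord: "order G = p ^ a * q ^ b"
    and arc: "(p, q) \<in> parcs (sylow_graph G)" and no_arc: "(q, p) \<notin> parcs (sylow_graph G)"
  shows "sylow_graph G = \<lparr>pverts = {p, q}, parcs = {(p, q)}\<rparr>"
proof -
  have v: "s = p \<or> s = q" if "s \<in> pverts (sylow_graph G)" for s
  proof -
    have s: "prime s" "s dvd p ^ a * q ^ b"
      using that prime_divisors_iff[OF fin] ord by (auto simp: sylow_graph_def)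
    then have "s dvd p \<or> s dvd q" using prime_dvd_mult_iff prime_dvd_power by metis
    then show ?thesis using s(1) pq primes_dvd_imp_eq by metis
  qed
  then have "pverts (sylow_graph G) = {p, q}" using sylow_graph_arc_verts[OF fin arc] by blast
  moreover have "(s, t) = (p, q)" if st: "(s, t) \<in> parcs (sylow_graph G)" for s t
  proof -
    have "s \<noteq> t" using st sylow_graph_arc_iff[OF fin] by blast
    moreover have "s = p \<or> s = q" "t = p \<or> t = q" using v sylow_graph_arc_verts[OF fin st] by auto
    ultimately show ?thesis using st no_arc by auto
  qed
  then have "e = (p, q)" if "e \<in> parcs (sylow_graph G)" for e using that by (cases e) blast
  then have "parcs (sylow_graph G) = {(p, q)}" using arc by blast
  ultimately show ?thesis by (intro pair_pre_digraph.equality) auto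
qed

lemma (in group) p_by_cyclic_q:
  assumes fin: "finite (carrier G)" and pq: "prime p" "prime q" "p \<noteq> q"
    and P: "p_subgroup p P G" and x: "p_element G q x" and norm: "\<And>u. u \<in> P \<Longrightarrow> x \<otimes> u \<otimes> inv x \<in> P"
  shows "subgroup (P <#> generate G {x}) G" "P \<subseteq> P <#> generate G {x}" "x \<in> P <#> generate G {x}"
    and "sylow_subgroup p P (G\<lparr>carrier := P <#> generate G {x}\<rparr>)"
    and "sylow_subgroup q (generate G {x}) (G\<lparr>carrier := P <#> generate G {x}\<rparr>)"
    and "P \<lhd> G\<lparr>carrier := P <#> generate G {x}\<rparr>"
    and "\<exists>a b. card (P <#> generate G {x}) = p ^ a * q ^ b"
proof -
  let ?X = "generate G {x}"
  let ?K = "P <#> ?X"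
  have PG: "subgroup P G" using P by (simp add: p_subgroup_def)
  have finP: "finite P" using fin subgroup.subset[OF PG] finite_subset by blast
  have xG: "x \<in> carrier G" using x by (simp add: p_element_def)
  have pX: "p_subgroup q ?X G" by (rule p_element_generate[OF x pq(2)])
  have X: "subgroup ?X G" using pX by (simp add: p_subgroup_def)
  have normX: "y \<otimes> u \<otimes> inv y \<in> P" if "u \<in> P" "y \<in> ?X" for u y
    using generate_singleton_normalizes[OF xG subgroup.subset[OF PG] finP norm that(2,1)] by blast
  show K: "subgroup ?K G" by (rule subgroup_set_mult[OF PG X normX])
  show PK: "P \<subseteq> ?K" by (rule subset_set_mult_left[OF subgroup.subset[OF PG] X])
  have XK: "?X \<subseteq> ?K" by (rule subset_set_mult_right[OF PG subgroup.subset[OF X]])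
  show "x \<in> ?K" using XK mem_generate_self by blast
  obtain a where a: "card P = p ^ a" using P by (auto simp: p_subgroup_def)
  obtain b where b: "card ?X = q ^ b" using pX by (auto simp: p_subgroup_def)
  have "coprime (card P) (card ?X)" using a b pq by (simp add: primes_coprime)
  then have "P \<inter> ?X = {\<one>}" by (rule coprime_card_Int[OF PG X])
  then have cK: "card ?K = p ^ a * q ^ b" using card_set_mult[OF PG X] a b by simp
  then show "\<exists>a b. card ?K = p ^ a * q ^ b" by blast
  have m: "multiplicity p (card ?K) = a" "multiplicity q (card ?K) = b"
    unfolding cK by (rule multiplicity_two_primes[OF pq])+
  show "sylow_subgroup p P (G\<lparr>carrier := ?K\<rparr>)" "sylow_subgroup q ?X (G\<lparr>carrier := ?K\<rparr>)"
    using m a b PK XK PG X subgroup_of_subgroup_iff[OF K] by (auto simp: sylow_subgroup_def order_def)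
  interpret K: group "G\<lparr>carrier := ?K\<rparr>" by (rule subgroup_imp_group[OF K])
  have "k \<otimes> u \<otimes> inv k \<in> P" if k: "k \<in> ?K" and u: "u \<in> P" for k u
  proof -
    obtain v y where vy: "v \<in> P" "y \<in> ?X" "k = v \<otimes> y" using k by (elim set_multE)
    have "v \<otimes> (y \<otimes> u \<otimes> inv y) \<otimes> inv v \<in> P"
      using normX[OF u vy(2)] vy(1) subgroup.m_closed[OF PG] subgroup.m_inv_closed[OF PG] by blast
    then show ?thesis
      unfolding vy(3) using conj_conj[of v y u] subgroup.mem_carrier[OF PG] subgroup.mem_carrier[OF X] vy u by simp
  qed
  then show "P \<lhd> G\<lparr>carrier := ?K\<rparr>"
    unfolding K.normal_inv_iff using PG PK subgroup_of_subgroup_iff[OF K] m_inv_consistent[OF K] by simp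
qed

text \<open>There is no arc \<open>q \<rightarrow> p\<close>: a \<open>p\<close>-element \<open>y\<close>
that normalizes \<open>\<langle>x\<rangle>\<close> lies in the normal Sylow subgroup \<open>P\<close>, so
its commutators with \<open>\<langle>x\<rangle>\<close> lie in \<open>P \<inter> \<langle>x\<rangle> =
1\<close>.\<close>

lemma (in group) sylow_graph_p_by_cyclic_q:
  assumes fin: "finite (carrier G)" and pq: "prime p" "prime q" "p \<noteq> q"
    and P: "p_subgroup p P G" and x: "p_element G q x" and norm: "\<And>u. u \<in> P \<Longrightarrow> x \<otimes> u \<otimes> inv x \<in> P"
    and u: "u \<in> P" "x \<otimes> u \<noteq> u \<otimes> x"
  shows "sylow_graph (G\<lparr>carrier := P <#> generate G {x}\<rparr>) = \<lparr>pverts = {p, q}, parcs = {(p, q)}\<rparr>"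
proof -
  let ?X = "generate G {x}"
  let ?K = "P <#> ?X"
  let ?GK = "G\<lparr>carrier := ?K\<rparr>"
  note K = p_by_cyclic_q[OF fin pq P x norm]
  interpret K: group ?GK by (rule subgroup_imp_group[OF K(1)])
  have PG: "subgroup P G" using P by (simp add: p_subgroup_def)
  have X: "subgroup ?X G" using p_element_generate[OF x pq(2)] by (simp add: p_subgroup_def)
  have xG: "x \<in> carrier G" using x by (simp add: p_element_def)
  have finK: "finite (carrier ?GK)" using finite_subset[OF subgroup.subset[OF K(1)] fin] by simp
  obtain a b where ab: "order ?GK = p ^ a * q ^ b" using K(7) by (auto simp: order_def)
  have pxK: "p_element ?GK q x" using x K(3) p_element_subgroup_iff[OF K(1)] by blast
  have "(p, q) \<in> parcs (sylow_graph ?GK)"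
    unfolding K.sylow_graph_arc_iff[OF finK] using pq K(4) pxK norm u m_inv_consistent[OF K(1) K(3)]
    by (intro conjI exI[of _ P] exI[of _ x]) auto
  moreover have "(q, p) \<notin> parcs (sylow_graph ?GK)"
  proof
    assume qp: "(q, p) \<in> parcs (sylow_graph ?GK)"
    obtain y w where y: "p_element ?GK p y" and yX: "\<forall>v\<in>?X. y \<otimes> v \<otimes> inv\<^bsub>?GK\<^esub> y \<in> ?X"
      and w: "w \<in> ?X" "y \<otimes> w \<noteq> w \<otimes> y"
      using K.sylow_graph_arc_at_sylow[OF finK qp K(5)] by auto
    have yP: "y \<in> P" by (rule K.p_element_in_normal_sylow[OF finK pq(1) K(4) K(6) y])
    have yK: "y \<in> ?K" using yP K(2) by blast
    have wK: "w \<in> ?K" using w(1) K.subgroupE(1) K(5) by (auto simp: sylow_subgroup_def dest: subgroup.subset)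
    have yG: "y \<in> carrier G" and wG: "w \<in> carrier G"
      using subgroup.mem_carrier[OF PG yP] subgroup.mem_carrier[OF X w(1)] by auto
    have 1: "y \<otimes> w \<otimes> inv y \<otimes> inv w \<in> ?X"
      using yX w(1) m_inv_consistent[OF K(1) yK] subgroup.m_closed[OF X] subgroup.m_inv_closed[OF X w(1)] by simp
    have "w \<otimes> inv y \<otimes> inv w \<in> P"
      using normal.inv_op_closed2[OF K(6), of w "inv y"] wK yP subgroup.m_inv_closed[OF PG yP]
        m_inv_consistent[OF K(1) wK] by simp
    then have "y \<otimes> (w \<otimes> inv y \<otimes> inv w) \<in> P" using yP subgroup.m_closed[OF PG] by blast
    then have 2: "y \<otimes> w \<otimes> inv y \<otimes> inv w \<in> P" using yG wG by (simp add: m_assoc)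
    have "y \<otimes> w \<otimes> inv y \<otimes> inv w = \<one>"
      using p_element_unique[OF p_subgroup_p_element[OF P 2] p_subgroup_p_element[OF p_element_generate[OF x pq(2)] 1] pq] .
    then have "y \<otimes> w = w \<otimes> y" by (rule commute_if_commutator_one[OF yG wG])
    then show False using w(2) by contradiction
  qed
  ultimately show ?thesis by (rule K.sylow_graph_two_primes[OF finK pq ab])
qed

section \<open>Sylow graphs of direct products\<close>

lemma DirProd_pow:
  assumes "group G" "group H" "a \<in> carrier G" "b \<in> carrier H"
  shows "(a, b) [^]\<^bsub>G \<times>\<times> H\<^esub> (n::nat) = (a [^]\<^bsub>G\<^esub> n, b [^]\<^bsub>H\<^esub> n)"
proof -
  interpret G: group G by fact
  interpret H: group H by fact
  show ?thesis by (induction n) (simp_all add: nat_pow_def)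
qed

lemma p_element_DirProd_iff:
  assumes "group G" "group H"
  shows "p_element (G \<times>\<times> H) p (a, b) \<longleftrightarrow> p_element G p a \<and> p_element H p b"
proof -
  interpret G: group G by fact
  interpret H: group H by fact
  have "\<exists>k. a [^]\<^bsub>G\<^esub> p ^ k = \<one>\<^bsub>G\<^esub> \<and> b [^]\<^bsub>H\<^esub> p ^ k = \<one>\<^bsub>H\<^esub>"
    if "a \<in> carrier G" "b \<in> carrier H" "a [^]\<^bsub>G\<^esub> p ^ i = \<one>\<^bsub>G\<^esub>" "b [^]\<^bsub>H\<^esub> p ^ j = \<one>\<^bsub>H\<^esub>" for i j
  proof (intro exI conjI)
    show "a [^]\<^bsub>G\<^esub> p ^ (i + j) = \<one>\<^bsub>G\<^esub>" using that by (simp add: power_add G.nat_pow_pow[symmetric])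
    show "b [^]\<^bsub>H\<^esub> p ^ (i + j) = \<one>\<^bsub>H\<^esub>"
      using that by (simp add: power_add mult.commute[of "p ^ i"] H.nat_pow_pow[symmetric])
  qed
  then show ?thesis
    unfolding p_element_def by (auto simp: DirProd_pow[OF assms])
qed

lemma sylow_subgroup_DirProd:
  assumes G: "finite_group G" and H: "finite_group H" and p: "prime p"
    and P: "sylow_subgroup p P G" and Q: "sylow_subgroup p Q H"
  shows "sylow_subgroup p (P \<times> Q) (G \<times>\<times> H)"
proof -
  interpret G: group G using G by (simp add: finite_group_def)
  interpret H: group H using H by (simp add: finite_group_def)
  have "order G \<noteq> 0" "order H \<noteq> 0"
    using G H G.order_gt_0_iff_finite H.order_gt_0_iff_finite by (auto simp: finite_group_def)
  then have "multiplicity p (order (G \<times>\<times> H)) = multiplicity p (order G) + multiplicity p (order H)"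
    using p by (simp add: order_def DirProd_def card_cartesian_product prime_elem_multiplicity_mult_distrib)
  then show ?thesis
    using P Q DirProd_subgroups[OF G.is_group _ H.is_group]
    by (simp add: sylow_subgroup_def card_cartesian_product power_add)
qed

lemma sylow_graph_arcs_DirProd_left:
  assumes G: "finite_group G" and H: "finite_group H"
  shows "parcs (sylow_graph G) \<subseteq> parcs (sylow_graph (G \<times>\<times> H))"
proof -
  interpret G: group G using G by (simp add: finite_group_def)
  interpret H: group H using H by (simp add: finite_group_def)
  interpret D: group "G \<times>\<times> H" by (rule DirProd_group[OF G.is_group H.is_group])
  have fG: "finite (carrier G)" and fH: "finite (carrier H)" using G H by (auto simp: finite_group_def)
  have fD: "finite (carrier (G \<times>\<times> H))" using fG fH by simp
  have "(p, q) \<in> parcs (sylow_graph (G \<times>\<times> H))" if a: "(p, q) \<in> parcs (sylow_graph G)" for p q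
  proof -
    have pq: "prime p" "prime q" "p \<noteq> q" using a G.sylow_graph_arc_iff[OF fG] by blast+
    obtain P where P: "sylow_subgroup p P G" using G.sylow_subgroup_exists[OF fG pq(1)] by blast
    obtain Q where Q: "sylow_subgroup p Q H" using H.sylow_subgroup_exists[OF fH pq(1)] by blast
    note PQ = P Q sylow_subgroup_DirProd[OF G H pq(1) P Q]
    have sub: "subgroup P G" "subgroup Q H" using PQ by (auto simp: sylow_subgroup_def)
    obtain x u where x: "p_element G q x" and xn: "\<forall>u\<in>P. x \<otimes>\<^bsub>G\<^esub> u \<otimes>\<^bsub>G\<^esub> inv\<^bsub>G\<^esub> x \<in> P" and u: "u \<in> P" "x \<otimes>\<^bsub>G\<^esub> u \<noteq> u \<otimes>\<^bsub>G\<^esub> x"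
      using G.sylow_graph_arc_at_sylow[OF fG a PQ(1)] by blast
    have xG: "x \<in> carrier G" using x by (simp add: p_element_def)
    have "p_element H q \<one>\<^bsub>H\<^esub>" by (auto simp: p_element_def)
    then have "p_element (G \<times>\<times> H) q (x, \<one>\<^bsub>H\<^esub>)" using p_element_DirProd_iff[OF G.is_group H.is_group] x by blast
    moreover have "(x, \<one>\<^bsub>H\<^esub>) \<otimes>\<^bsub>G \<times>\<times> H\<^esub> w \<otimes>\<^bsub>G \<times>\<times> H\<^esub> inv\<^bsub>G \<times>\<times> H\<^esub> (x, \<one>\<^bsub>H\<^esub>) \<in> P \<times> Q" if "w \<in> P \<times> Q" for w
      using that xn subgroup.mem_carrier[OF sub(2)] xG by (auto simp: inv_DirProd[OF G.is_group H.is_group])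
    moreover have "(u, \<one>\<^bsub>H\<^esub>) \<in> P \<times> Q" using u subgroup.one_closed[OF sub(2)] by blast
    moreover have "(x, \<one>\<^bsub>H\<^esub>) \<otimes>\<^bsub>G \<times>\<times> H\<^esub> (u, \<one>\<^bsub>H\<^esub>) \<noteq> (u, \<one>\<^bsub>H\<^esub>) \<otimes>\<^bsub>G \<times>\<times> H\<^esub> (x, \<one>\<^bsub>H\<^esub>)" using u(2) by simp
    ultimately show ?thesis unfolding D.sylow_graph_arc_iff[OF fD] using pq PQ(3) by blast
  qed
  then show ?thesis by auto
qed

lemma sylow_graph_DirProd:
  assumes G: "finite_group G" and H: "finite_group H"
  shows "pverts (sylow_graph (G \<times>\<times> H)) = pverts (sylow_graph G) \<union> pverts (sylow_graph H)"
    and "parcs (sylow_graph (G \<times>\<times> H)) = parcs (sylow_graph G) \<union> parcs (sylow_graph H)"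
proof -
  interpret G: group G using G by (simp add: finite_group_def)
  interpret H: group H using H by (simp add: finite_group_def)
  interpret D: group "G \<times>\<times> H" by (rule DirProd_group[OF G.is_group H.is_group])
  have fG: "finite (carrier G)" and fH: "finite (carrier H)" using G H by (auto simp: finite_group_def)
  have fD: "finite (carrier (G \<times>\<times> H))" using fG fH by simp
  have "order (G \<times>\<times> H) = order G * order H" by (simp add: order_def DirProd_def card_cartesian_product)
  then show "pverts (sylow_graph (G \<times>\<times> H)) = pverts (sylow_graph G) \<union> pverts (sylow_graph H)"
    by (auto simp: sylow_graph_def G.prime_divisors_iff[OF fG] H.prime_divisors_iff[OF fH]
        D.prime_divisors_iff[OF fD] prime_dvd_mult_iff)
  have ex: "\<exists>P Q. sylow_subgroup p P G \<and> sylow_subgroup p Q H \<and> sylow_subgroup p (P \<times> Q) (G \<times>\<times> H)"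
    if "prime p" for p
    using G.sylow_subgroup_exists[OF fG that] H.sylow_subgroup_exists[OF fH that] sylow_subgroup_DirProd[OF G H that] by blast
  have "(p, q) \<in> parcs (sylow_graph G) \<union> parcs (sylow_graph H)" if a: "(p, q) \<in> parcs (sylow_graph (G \<times>\<times> H))" for p q
  proof -
    have pq: "prime p" "prime q" "p \<noteq> q" using a D.sylow_graph_arc_iff[OF fD] by blast+
    obtain P Q where PQ: "sylow_subgroup p P G" "sylow_subgroup p Q H" "sylow_subgroup p (P \<times> Q) (G \<times>\<times> H)"
      using ex[OF pq(1)] by blast
    have sub: "subgroup P G" "subgroup Q H" using PQ by (auto simp: sylow_subgroup_def)
    obtain z w where z: "p_element (G \<times>\<times> H) q z"
      and zn: "\<forall>u\<in>P \<times> Q. z \<otimes>\<^bsub>G \<times>\<times> H\<^esub> u \<otimes>\<^bsub>G \<times>\<times> H\<^esub> inv\<^bsub>G \<times>\<times> H\<^esub> z \<in> P \<times> Q"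
      and w: "w \<in> P \<times> Q" "z \<otimes>\<^bsub>G \<times>\<times> H\<^esub> w \<noteq> w \<otimes>\<^bsub>G \<times>\<times> H\<^esub> z"
      using D.sylow_graph_arc_at_sylow[OF fD a PQ(3)] by blast
    obtain x y u v where xy: "z = (x, y)" and uv: "w = (u, v)" by (metis surj_pair)
    have x: "p_element G q x" and y: "p_element H q y"
      using z p_element_DirProd_iff[OF G.is_group H.is_group] xy by auto
    have c: "x \<in> carrier G" "y \<in> carrier H" using x y by (auto simp: p_element_def)
    have iz: "inv\<^bsub>G \<times>\<times> H\<^esub> (x, y) = (inv\<^bsub>G\<^esub> x, inv\<^bsub>H\<^esub> y)"
      by (rule inv_DirProd[OF G.is_group H.is_group c])
    have xn: "x \<otimes>\<^bsub>G\<^esub> s \<otimes>\<^bsub>G\<^esub> inv\<^bsub>G\<^esub> x \<in> P" "y \<otimes>\<^bsub>H\<^esub> t \<otimes>\<^bsub>H\<^esub> inv\<^bsub>H\<^esub> y \<in> Q" if "s \<in> P" "t \<in> Q" for s t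
      using bspec[OF zn, of "(s, t)"] that unfolding xy iz by simp_all
    have one: "\<one>\<^bsub>G\<^esub> \<in> P" "\<one>\<^bsub>H\<^esub> \<in> Q" using sub subgroup.one_closed by auto
    have uv': "u \<in> P" "v \<in> Q" using w(1) uv by auto
    have "x \<otimes>\<^bsub>G\<^esub> u \<noteq> u \<otimes>\<^bsub>G\<^esub> x \<or> y \<otimes>\<^bsub>H\<^esub> v \<noteq> v \<otimes>\<^bsub>H\<^esub> y" using w(2) xy uv by auto
    then show ?thesis
    proof
      assume "x \<otimes>\<^bsub>G\<^esub> u \<noteq> u \<otimes>\<^bsub>G\<^esub> x"
      then have "(p, q) \<in> parcs (sylow_graph G)"
        unfolding G.sylow_graph_arc_iff[OF fG] using pq PQ(1) x xn(1)[OF _ one(2)] uv'(1) by blast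
      then show ?thesis by blast
    next
      assume "y \<otimes>\<^bsub>H\<^esub> v \<noteq> v \<otimes>\<^bsub>H\<^esub> y"
      then have "(p, q) \<in> parcs (sylow_graph H)"
        unfolding H.sylow_graph_arc_iff[OF fH] using pq PQ(2) y xn(2)[OF one(1)] uv'(2) by blast
      then show ?thesis by blast
    qed
  qed
  moreover have "parcs (sylow_graph H) \<subseteq> parcs (sylow_graph (G \<times>\<times> H))"
  proof -
    have "H \<times>\<times> G \<cong> G \<times>\<times> H" by (rule DirProd_commute_iso)
    moreover have "finite_group (H \<times>\<times> G)"
      using fG fH DirProd_group[OF H.is_group G.is_group] by (simp add: finite_group_def)
    ultimately have "sylow_graph (H \<times>\<times> G) = sylow_graph (G \<times>\<times> H)" by (intro sylow_graph_iso D.is_group)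
    then show ?thesis using sylow_graph_arcs_DirProd_left[OF H G] by simp
  qed
  ultimately show "parcs (sylow_graph (G \<times>\<times> H)) = parcs (sylow_graph G) \<union> parcs (sylow_graph H)"
    using sylow_graph_arcs_DirProd_left[OF G H] by auto
qed

section \<open>A group with a reversed action\<close>

text \<open>The regular wreath product: \<open>H\<close> acts by translation on the functions from
\<open>H\<close> to \<open>A\<close>. These form the base, which is the kernel of the second
projection.\<close>

definition wreath :: "('a, 'c) monoid_scheme \<Rightarrow> ('b, 'd) monoid_scheme \<Rightarrow> (('b \<Rightarrow> 'a) \<times> 'b) monoid" where
  "wreath A H = \<lparr>carrier = (carrier H \<rightarrow>\<^sub>E carrier A) \<times> carrier H,
     monoid.mult = (\<lambda>(f, h) (g, k). (\<lambda>y\<in>carrier H. f y \<otimes>\<^bsub>A\<^esub> g (inv\<^bsub>H\<^esub> h \<otimes>\<^bsub>H\<^esub> y), h \<otimes>\<^bsub>H\<^esub> k)),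
     one = (\<lambda>y\<in>carrier H. \<one>\<^bsub>A\<^esub>, \<one>\<^bsub>H\<^esub>)\<rparr>"

definition wreath_top :: "('a, 'c) monoid_scheme \<Rightarrow> ('b, 'd) monoid_scheme \<Rightarrow> 'b \<Rightarrow> ('b \<Rightarrow> 'a) \<times> 'b" where
  "wreath_top A H h = (\<lambda>y\<in>carrier H. \<one>\<^bsub>A\<^esub>, h)"

lemma wreath_mult:
  "(f, h) \<otimes>\<^bsub>wreath A H\<^esub> (g, k) = (\<lambda>y\<in>carrier H. f y \<otimes>\<^bsub>A\<^esub> g (inv\<^bsub>H\<^esub> h \<otimes>\<^bsub>H\<^esub> y), h \<otimes>\<^bsub>H\<^esub> k)"
  by (simp add: wreath_def)

lemma wreath_carrier: "carrier (wreath A H) = (carrier H \<rightarrow>\<^sub>E carrier A) \<times> carrier H"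
  by (simp add: wreath_def)

lemma wreath_one: "\<one>\<^bsub>wreath A H\<^esub> = (\<lambda>y\<in>carrier H. \<one>\<^bsub>A\<^esub>, \<one>\<^bsub>H\<^esub>)"
  by (simp add: wreath_def)

lemma group_wreath:
  assumes "group A" "group H"
  shows "group (wreath A H)"
proof -
  interpret A: group A by fact
  interpret H: group H by fact
  have app: "f y \<in> carrier A" if "f \<in> carrier H \<rightarrow>\<^sub>E carrier A" "y \<in> carrier H" for f y
    using that by (rule PiE_mem)
  show ?thesis
  proof (rule groupI)
    fix x y assume "x \<in> carrier (wreath A H)" "y \<in> carrier (wreath A H)"
    then show "x \<otimes>\<^bsub>wreath A H\<^esub> y \<in> carrier (wreath A H)"
      by (cases x; cases y) (auto simp: wreath_carrier wreath_mult app intro!: A.m_closed app)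
  next
    show "\<one>\<^bsub>wreath A H\<^esub> \<in> carrier (wreath A H)" by (simp add: wreath_carrier wreath_one)
  next
    fix x y z assume xyz: "x \<in> carrier (wreath A H)" "y \<in> carrier (wreath A H)" "z \<in> carrier (wreath A H)"
    obtain f h g k e l where eq: "x = (f, h)" "y = (g, k)" "z = (e, l)" by (metis surj_pair)
    have c: "f \<in> carrier H \<rightarrow>\<^sub>E carrier A" "g \<in> carrier H \<rightarrow>\<^sub>E carrier A" "e \<in> carrier H \<rightarrow>\<^sub>E carrier A"
      "h \<in> carrier H" "k \<in> carrier H" "l \<in> carrier H"
      using xyz by (auto simp: eq wreath_carrier)
    have "f s \<otimes>\<^bsub>A\<^esub> g (inv\<^bsub>H\<^esub> h \<otimes>\<^bsub>H\<^esub> s) \<otimes>\<^bsub>A\<^esub> e (inv\<^bsub>H\<^esub> (h \<otimes>\<^bsub>H\<^esub> k) \<otimes>\<^bsub>H\<^esub> s)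
        = f s \<otimes>\<^bsub>A\<^esub> (g (inv\<^bsub>H\<^esub> h \<otimes>\<^bsub>H\<^esub> s) \<otimes>\<^bsub>A\<^esub> e (inv\<^bsub>H\<^esub> k \<otimes>\<^bsub>H\<^esub> (inv\<^bsub>H\<^esub> h \<otimes>\<^bsub>H\<^esub> s)))"
      if s: "s \<in> carrier H" for s
      using c s app by (simp add: H.inv_mult_group H.m_assoc A.m_assoc)
    then show "x \<otimes>\<^bsub>wreath A H\<^esub> y \<otimes>\<^bsub>wreath A H\<^esub> z = x \<otimes>\<^bsub>wreath A H\<^esub> (y \<otimes>\<^bsub>wreath A H\<^esub> z)"
      using c by (simp add: eq wreath_mult H.m_assoc restrict_def fun_eq_iff)
  next
    fix x assume x: "x \<in> carrier (wreath A H)"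
    obtain f h where eq: "x = (f, h)" by (metis surj_pair)
    have c: "f \<in> carrier H \<rightarrow>\<^sub>E carrier A" "h \<in> carrier H" using x by (auto simp: eq wreath_carrier)
    have ext: "f y = undefined" if "y \<notin> carrier H" for y using c(1) that by (rule PiE_arb)
    show "\<one>\<^bsub>wreath A H\<^esub> \<otimes>\<^bsub>wreath A H\<^esub> x = x"
      using c app ext by (simp add: eq wreath_mult wreath_one restrict_def fun_eq_iff)
    show "\<exists>y\<in>carrier (wreath A H). y \<otimes>\<^bsub>wreath A H\<^esub> x = \<one>\<^bsub>wreath A H\<^esub>"
    proof
      let ?y = "(\<lambda>y\<in>carrier H. inv\<^bsub>A\<^esub> (f (h \<otimes>\<^bsub>H\<^esub> y)), inv\<^bsub>H\<^esub> h)"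
      show "?y \<in> carrier (wreath A H)" using c app by (simp add: wreath_carrier)
      show "?y \<otimes>\<^bsub>wreath A H\<^esub> x = \<one>\<^bsub>wreath A H\<^esub>"
        using c app by (simp add: eq wreath_mult wreath_one restrict_def fun_eq_iff)
    qed
  qed
qed

lemma finite_wreath:
  assumes "finite (carrier A)" "finite (carrier H)"
  shows "finite (carrier (wreath A H))"
  using assms by (simp add: wreath_carrier finite_PiE)

lemma order_wreath:
  assumes "finite (carrier H)"
  shows "order (wreath A H) = order A ^ order H * order H"
  using assms by (simp add: order_def wreath_carrier card_cartesian_product card_PiE)

lemma wreath_snd_hom:
  assumes "group A" "group H"
  shows "group_hom (wreath A H) H snd"
proof -
  interpret H: group H by fact
  interpret W: group "wreath A H" by (rule group_wreath[OF assms])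
  show ?thesis by unfold_locales (auto simp: hom_def wreath_carrier wreath_mult)
qed

lemma wreath_top_hom:
  assumes "group A" "group H"
  shows "group_hom H (wreath A H) (wreath_top A H)"
proof -
  interpret A: group A by fact
  interpret H: group H by fact
  interpret W: group "wreath A H" by (rule group_wreath[OF assms])
  show ?thesis
    by unfold_locales (auto simp: hom_def wreath_top_def wreath_carrier wreath_mult restrict_def fun_eq_iff)
qed

text \<open>The action on the base is faithful: \<open>h\<close> moves a function that is supported at the
identity.\<close>

lemma wreath_top_not_commute:
  assumes "group A" "group H" and a: "a \<in> carrier A" "a \<noteq> \<one>\<^bsub>A\<^esub>" and h: "h \<in> carrier H" "h \<noteq> \<one>\<^bsub>H\<^esub>"
  shows "\<exists>b\<in>kernel (wreath A H) H snd. wreath_top A H h \<otimes>\<^bsub>wreath A H\<^esub> b \<noteq> b \<otimes>\<^bsub>wreath A H\<^esub> wreath_top A H h"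
proof -
  interpret A: group A by fact
  interpret H: group H by fact
  let ?f = "\<lambda>y\<in>carrier H. if y = \<one>\<^bsub>H\<^esub> then a else \<one>\<^bsub>A\<^esub>"
  have "(?f, \<one>\<^bsub>H\<^esub>) \<in> kernel (wreath A H) H snd" using a by (auto simp: kernel_def wreath_carrier)
  moreover have "wreath_top A H h \<otimes>\<^bsub>wreath A H\<^esub> (?f, \<one>\<^bsub>H\<^esub>) \<noteq> (?f, \<one>\<^bsub>H\<^esub>) \<otimes>\<^bsub>wreath A H\<^esub> wreath_top A H h"
  proof
    assume "wreath_top A H h \<otimes>\<^bsub>wreath A H\<^esub> (?f, \<one>\<^bsub>H\<^esub>) = (?f, \<one>\<^bsub>H\<^esub>) \<otimes>\<^bsub>wreath A H\<^esub> wreath_top A H h"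
    then have "fst (wreath_top A H h \<otimes>\<^bsub>wreath A H\<^esub> (?f, \<one>\<^bsub>H\<^esub>)) h = fst ((?f, \<one>\<^bsub>H\<^esub>) \<otimes>\<^bsub>wreath A H\<^esub> wreath_top A H h) h"
      by simp
    then show False using a h by (simp add: wreath_top_def wreath_mult)
  qed
  ultimately show ?thesis by blast
qed

lemma wreath_base_commute:
  assumes "comm_group A" "group H"
    and "b \<in> kernel (wreath A H) H snd" "c \<in> kernel (wreath A H) H snd"
  shows "b \<otimes>\<^bsub>wreath A H\<^esub> c = c \<otimes>\<^bsub>wreath A H\<^esub> b"
proof -
  interpret A: comm_group A by fact
  interpret H: group H by fact
  obtain f g where eq: "b = (f, \<one>\<^bsub>H\<^esub>)" "c = (g, \<one>\<^bsub>H\<^esub>)" and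
    fg: "f \<in> carrier H \<rightarrow>\<^sub>E carrier A" "g \<in> carrier H \<rightarrow>\<^sub>E carrier A"
    using assms(3,4) by (auto simp: kernel_def wreath_carrier)
  have "f y \<otimes>\<^bsub>A\<^esub> g y = g y \<otimes>\<^bsub>A\<^esub> f y" if "y \<in> carrier H" for y
    using that PiE_mem[OF fg(1)] PiE_mem[OF fg(2)] A.m_comm by blast
  then show ?thesis by (simp add: eq wreath_mult restrict_def fun_eq_iff)
qed

lemma card_wreath_base:
  assumes "group A" "group H" "finite (carrier H)"
  shows "card (kernel (wreath A H) H snd) = order A ^ order H"
proof -
  interpret H: group H by fact
  have "kernel (wreath A H) H snd = (carrier H \<rightarrow>\<^sub>E carrier A) \<times> {\<one>\<^bsub>H\<^esub>}"
    by (auto simp: kernel_def wreath_carrier)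
  then show ?thesis using assms(3) by (simp add: order_def card_cartesian_product card_PiE)
qed

text \<open>Since \<open>B\<close> is abelian, \<open>b \<mapsto> [x,b]\<close> is a homomorphism, and
\<open>D\<close> is its image. If \<open>x\<close> centralizes \<open>[x,b]\<close>, then \<open>[x,b] =
1\<close> by the lemma on coprime action, so \<open>x\<close> has no nontrivial fixed point in
\<open>D\<close>.\<close>

lemma (in group) commutator_with_coprime_element:
  assumes fin: "finite (carrier G)" and pq: "prime p" "prime q" "p \<noteq> q"
    and B: "p_subgroup p B G" and comm: "\<And>b c. b \<in> B \<Longrightarrow> c \<in> B \<Longrightarrow> b \<otimes> c = c \<otimes> b"
    and x: "p_element G q x" and norm: "\<And>b. b \<in> B \<Longrightarrow> x \<otimes> b \<otimes> inv x \<in> B"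
    and b: "b \<in> B" "x \<otimes> b \<noteq> b \<otimes> x"
  shows "\<exists>D. p_subgroup p D G \<and> (\<forall>d\<in>D. x \<otimes> d \<otimes> inv x \<in> D) \<and> D \<noteq> {\<one>}
    \<and> (\<forall>d\<in>D. x \<otimes> d = d \<otimes> x \<longrightarrow> d = \<one>)"
proof -
  let ?\<phi> = "\<lambda>b. x \<otimes> b \<otimes> inv x \<otimes> inv b"
  let ?D = "?\<phi> ` B"
  have BG: "subgroup B G" using B by (simp add: p_subgroup_def)
  note c = subgroup.mem_carrier[OF BG]
  have xG: "x \<in> carrier G" using x by (simp add: p_element_def)
  have phiB: "?\<phi> b \<in> B" if "b \<in> B" for b
    using norm[OF that] that subgroup.m_closed[OF BG] subgroup.m_inv_closed[OF BG] by blast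
  interpret B: group "G\<lparr>carrier := B\<rparr>" by (rule subgroup_imp_group[OF BG])
  interpret \<phi>: group_hom "G\<lparr>carrier := B\<rparr>" G ?\<phi>
  proof unfold_locales
    show "?\<phi> \<in> hom (G\<lparr>carrier := B\<rparr>) G"
    proof (rule homI)
      show "?\<phi> b \<in> carrier G" if "b \<in> carrier (G\<lparr>carrier := B\<rparr>)" for b using that c xG by simp
    next
      fix b d assume bd: "b \<in> carrier (G\<lparr>carrier := B\<rparr>)" "d \<in> carrier (G\<lparr>carrier := B\<rparr>)"
      then have bd': "b \<in> B" "d \<in> B" by auto
      have bG: "b \<in> carrier G" "d \<in> carrier G" using bd' c by auto
      have "?\<phi> (b \<otimes> d) = (x \<otimes> b \<otimes> inv x) \<otimes> (?\<phi> d \<otimes> inv b)"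
        using bG xG by (simp add: m_assoc inv_mult_group inv_mult_cancel)
      also have "?\<phi> d \<otimes> inv b = inv b \<otimes> ?\<phi> d"
        using comm[OF phiB[OF bd'(2)] subgroup.m_inv_closed[OF BG bd'(1)]] .
      also have "(x \<otimes> b \<otimes> inv x) \<otimes> (inv b \<otimes> ?\<phi> d) = ?\<phi> b \<otimes> ?\<phi> d"
        using bG xG by (simp add: m_assoc)
      finally show "?\<phi> (b \<otimes>\<^bsub>G\<lparr>carrier := B\<rparr>\<^esub> d) = ?\<phi> b \<otimes> ?\<phi> d" by simp
    qed
  qed
  have D: "subgroup ?D G" using \<phi>.subgroup_img_is_subgroup[OF B.subgroup_self] by simp
  have DB: "?D \<subseteq> B" using phiB by blast
  have "p_subgroup p ?D G"
    using p_subgroup_if_p_elements[OF fin pq(1) D] p_subgroup_p_element[OF B] DB by blast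
  moreover have "x \<otimes> d \<otimes> inv x \<in> ?D" if d: "d \<in> ?D" for d
  proof -
    obtain b where b: "b \<in> B" "d = ?\<phi> b" using d by blast
    have "x \<otimes> d \<otimes> inv x = ?\<phi> (x \<otimes> b \<otimes> inv x)"
      unfolding b(2) using xG c[OF b(1)] by (simp add: m_assoc inv_mult_group inv_mult_cancel)
    then show ?thesis using norm[OF b(1)] by blast
  qed
  moreover have "d = \<one>" if d: "d \<in> ?D" "x \<otimes> d = d \<otimes> x" for d
  proof -
    obtain b where b: "b \<in> B" "d = ?\<phi> b" using d by blast
    obtain k where k: "x [^] q ^ k = \<one>" using x by (auto simp: p_element_def)
    have "coprime p (q ^ k)" using pq by (simp add: primes_coprime)
    moreover have "p_element G p d" using p_subgroup_p_element[OF B] d(1) DB by blast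
    moreover have "x \<otimes> b \<otimes> inv x = d \<otimes> b" using b xG c[OF b(1)] by (simp add: m_assoc)
    ultimately have "x \<otimes> b \<otimes> inv x = b" using coprime_action_trivial[OF xG c[OF b(1)] _ d(2) _ k] by blast
    then show ?thesis using b c[OF b(1)] by simp
  qed
  moreover have "?\<phi> b \<noteq> \<one>"
  proof
    assume "?\<phi> b = \<one>"
    then have "x \<otimes> b = b \<otimes> x" by (rule commute_if_commutator_one[OF xG c[OF b(1)]])
    then show False using b(2) by contradiction
  qed
  then have "?D \<noteq> {\<one>}" using b(1) by blast
  ultimately show ?thesis by blast
qed

text \<open>Write \<open>h = dy\<close> with \<open>d \<in> D\<close> and \<open>y \<in>
\<langle>x\<rangle>\<close>. Then \<open>d\<close> normalizes \<open>\<langle>x\<rangle>\<close>, so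
\<open>[d,x]\<close> lies in \<open>D \<inter> \<langle>x\<rangle> = 1\<close> and \<open>d\<close> is a
fixed point of \<open>x\<close>.\<close>

lemma (in group) coprime_cyclic_self_normalizing:
  assumes pq: "prime p" "prime q" "p \<noteq> q"
    and D: "p_subgroup p D G" and x: "p_element G q x" and norm: "\<And>d. d \<in> D \<Longrightarrow> x \<otimes> d \<otimes> inv x \<in> D"
    and fixed: "\<And>d. d \<in> D \<Longrightarrow> x \<otimes> d = d \<otimes> x \<Longrightarrow> d = \<one>"
    and h: "h \<in> D <#> generate G {x}"
    and hn: "\<And>s. s \<in> generate G {x} \<Longrightarrow> h \<otimes> s \<otimes> inv h \<in> generate G {x}"
  shows "h \<in> generate G {x}"
proof -
  let ?Q = "generate G {x}"
  have pQ: "p_subgroup q ?Q G" by (rule p_element_generate[OF x pq(2)])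
  have DG: "subgroup D G" and QG: "subgroup ?Q G" using D pQ by (auto simp: p_subgroup_def)
  have xG: "x \<in> carrier G" using x by (simp add: p_element_def)
  obtain d y where dy: "d \<in> D" "y \<in> ?Q" "h = d \<otimes> y" using h by (elim set_multE)
  have c: "d \<in> carrier G" "y \<in> carrier G" using subgroup.mem_carrier[OF DG dy(1)] subgroup.mem_carrier[OF QG dy(2)] by auto
  have xQ: "x \<in> ?Q" by (rule mem_generate_self)
  have "inv y \<otimes> x \<otimes> y \<in> ?Q"
    using dy(2) xQ subgroup.m_closed[OF QG] subgroup.m_inv_closed[OF QG] by blast
  then have "h \<otimes> (inv y \<otimes> x \<otimes> y) \<otimes> inv h \<in> ?Q" by (rule hn)
  then have "d \<otimes> x \<otimes> inv d \<in> ?Q"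
    unfolding dy(3) using c xG by (simp add: m_assoc inv_mult_group inv_mult_cancel)
  then have 1: "d \<otimes> x \<otimes> inv d \<otimes> inv x \<in> ?Q"
    using subgroup.m_inv_closed[OF QG xQ] subgroup.m_closed[OF QG] by blast
  have "d \<otimes> (x \<otimes> inv d \<otimes> inv x) \<in> D"
    using dy(1) norm[OF subgroup.m_inv_closed[OF DG dy(1)]] subgroup.m_closed[OF DG] by blast
  then have 2: "d \<otimes> x \<otimes> inv d \<otimes> inv x \<in> D" using c xG by (simp add: m_assoc)
  have "d \<otimes> x \<otimes> inv d \<otimes> inv x = \<one>"
    using p_element_unique[OF p_subgroup_p_element[OF D 2] p_subgroup_p_element[OF pQ 1] pq] .
  then have "d \<otimes> x = x \<otimes> d" by (rule commute_if_commutator_one[OF c(1) xG])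
  then have "d = \<one>" using fixed[OF dy(1)] by simp
  then show ?thesis using dy c by simp
qed

lemma integer_mod_group_order: "n \<noteq> 0 \<Longrightarrow> order (integer_mod_group n) = n"
  by (simp add: order_def carrier_integer_mod_group)

lemma p_element_integer_mod_group:
  assumes "p \<noteq> 0" "x \<in> carrier (integer_mod_group p)"
  shows "p_element (integer_mod_group p) p x"
proof -
  interpret group "integer_mod_group p" by simp
  have "x [^]\<^bsub>integer_mod_group p\<^esub> p ^ 1 = \<one>\<^bsub>integer_mod_group p\<^esub>"
    using pow_order_eq_1[OF assms(2)] integer_mod_group_order[OF assms(1)] by (simp del: one_integer_mod_group)
  then show ?thesis unfolding p_element_def using assms(2) by blast
qed

text \<open>In the wreath product of \<open>Z\<^sub>p\<close> by \<open>Z\<^sub>q\<close> let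
\<open>x\<close> generate the top group, and let \<open>D\<close> be the commutator of the base with
\<open>x\<close>. The group sought is \<open>D\<langle>x\<rangle>\<close>.\<close>

lemma exists_self_normalizing_sylow:
  assumes pq: "prime p" "prime q" "p \<noteq> q"
  shows "\<exists>(H :: ((int \<Rightarrow> int) \<times> int) monoid) D Q x.
    finite_group H \<and> (\<exists>a b. order H = p ^ a * q ^ b) \<and> sylow_subgroup p D H \<and> sylow_subgroup q Q H
    \<and> D \<noteq> {\<one>\<^bsub>H\<^esub>} \<and> (\<forall>h\<in>carrier H. (\<forall>s\<in>Q. h \<otimes>\<^bsub>H\<^esub> s \<otimes>\<^bsub>H\<^esub> inv\<^bsub>H\<^esub> h \<in> Q) \<longrightarrow> h \<in> Q)
    \<and> p_element H q x \<and> (\<forall>d\<in>D. x \<otimes>\<^bsub>H\<^esub> d \<otimes>\<^bsub>H\<^esub> inv\<^bsub>H\<^esub> x \<in> D) \<and> (\<exists>d\<in>D. x \<otimes>\<^bsub>H\<^esub> d \<noteq> d \<otimes>\<^bsub>H\<^esub> x)"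
proof -
  let ?A = "integer_mod_group p"
  let ?Z = "integer_mod_group q"
  let ?W = "wreath ?A ?Z"
  let ?x = "wreath_top ?A ?Z 1"
  have gt: "p > 1" "q > 1" using pq prime_gt_1_nat by auto
  have finZ: "finite (carrier ?Z)" "finite (carrier ?A)" using gt by (auto simp: carrier_integer_mod_group)
  interpret W: group ?W by (rule group_wreath) simp_all
  interpret s: group_hom ?W ?Z snd by (rule wreath_snd_hom) simp_all
  interpret t: group_hom ?Z ?W "wreath_top ?A ?Z" by (rule wreath_top_hom) simp_all
  have finW: "finite (carrier ?W)" by (rule finite_wreath[OF finZ(2,1)])
  let ?B = "kernel ?W ?Z snd"
  have oA: "order ?A = p" using gt integer_mod_group_order by simp
  have cB: "card ?B = p ^ order ?Z" using card_wreath_base[of ?A ?Z] finZ oA by simp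
  have pB: "p_subgroup p ?B ?W" using s.subgroup_kernel cB by (auto simp: p_subgroup_def)
  have "p_element ?Z q 1" by (rule p_element_integer_mod_group) (use gt in auto)
  then have x: "p_element ?W q ?x" by (rule t.p_element_hom)
  have xW: "?x \<in> carrier ?W" using x by (simp add: p_element_def)
  have normB: "?x \<otimes>\<^bsub>?W\<^esub> b \<otimes>\<^bsub>?W\<^esub> inv\<^bsub>?W\<^esub> ?x \<in> ?B" if "b \<in> ?B" for b
    using normal.inv_op_closed2[OF s.normal_kernel xW that] .
  obtain b where b: "b \<in> ?B" "?x \<otimes>\<^bsub>?W\<^esub> b \<noteq> b \<otimes>\<^bsub>?W\<^esub> ?x"
    using wreath_top_not_commute[of ?A ?Z 1 1] gt by auto
  have commB: "b \<otimes>\<^bsub>?W\<^esub> c = c \<otimes>\<^bsub>?W\<^esub> b" if "b \<in> ?B" "c \<in> ?B" for b c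
    by (rule wreath_base_commute[OF _ _ that]) simp_all
  obtain D where D: "p_subgroup p D ?W" and Dx: "\<And>d. d \<in> D \<Longrightarrow> ?x \<otimes>\<^bsub>?W\<^esub> d \<otimes>\<^bsub>?W\<^esub> inv\<^bsub>?W\<^esub> ?x \<in> D"
    and Dne: "D \<noteq> {\<one>\<^bsub>?W\<^esub>}" and Df: "\<And>d. d \<in> D \<Longrightarrow> ?x \<otimes>\<^bsub>?W\<^esub> d = d \<otimes>\<^bsub>?W\<^esub> ?x \<Longrightarrow> d = \<one>\<^bsub>?W\<^esub>"
    using W.commutator_with_coprime_element[OF finW pq pB commB x normB b] by blast
  have DW: "subgroup D ?W" using D by (simp add: p_subgroup_def)
  let ?Q = "generate ?W {?x}"
  let ?K = "D <#>\<^bsub>?W\<^esub> ?Q"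
  let ?H = "?W\<lparr>carrier := ?K\<rparr>"
  note K = W.p_by_cyclic_q[OF finW pq D x Dx]
  interpret H: group ?H by (rule W.subgroup_imp_group[OF K(1)])
  have invK: "inv\<^bsub>?H\<^esub> h = inv\<^bsub>?W\<^esub> h" if "h \<in> ?K" for h using W.m_inv_consistent[OF K(1) that] .
  have "h \<in> ?Q" if "h \<in> ?K" "\<And>s. s \<in> ?Q \<Longrightarrow> h \<otimes>\<^bsub>?W\<^esub> s \<otimes>\<^bsub>?W\<^esub> inv\<^bsub>?W\<^esub> h \<in> ?Q" for h
    using W.coprime_cyclic_self_normalizing[OF pq D x Dx Df that] by blast
  then have self: "\<forall>h\<in>carrier ?H. (\<forall>s\<in>?Q. h \<otimes>\<^bsub>?H\<^esub> s \<otimes>\<^bsub>?H\<^esub> inv\<^bsub>?H\<^esub> h \<in> ?Q) \<longrightarrow> h \<in> ?Q"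
    using invK by simp
  obtain d where d: "d \<in> D" "d \<noteq> \<one>\<^bsub>?W\<^esub>" using Dne subgroup.one_closed[OF DW] by blast
  have "finite_group ?H"
    using finite_subset[OF subgroup.subset[OF K(1)] finW] H.is_group by (simp add: finite_group_def)
  moreover have "\<exists>a b. order ?H = p ^ a * q ^ b" using K(7) by (simp add: order_def)
  moreover have "p_element ?H q ?x" using W.p_element_subgroup_iff[OF K(1)] x K(3) by blast
  moreover have "\<forall>d\<in>D. ?x \<otimes>\<^bsub>?H\<^esub> d \<otimes>\<^bsub>?H\<^esub> inv\<^bsub>?H\<^esub> ?x \<in> D" using Dx invK[OF K(3)] by simp
  moreover have "?x \<otimes>\<^bsub>?W\<^esub> d \<noteq> d \<otimes>\<^bsub>?W\<^esub> ?x" using d Df by blast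
  then have "\<exists>d\<in>D. ?x \<otimes>\<^bsub>?H\<^esub> d \<noteq> d \<otimes>\<^bsub>?H\<^esub> ?x" using d(1) by (intro bexI[of _ d]) simp_all
  moreover have "D \<noteq> {\<one>\<^bsub>?H\<^esub>}" using Dne by simp
  ultimately show ?thesis using K(4) K(5) self by blast
qed

text \<open>In the wreath product \<open>W\<close> of \<open>Z\<^sub>q\<close> by the group \<open>H\<close>
just constructed, the Sylow \<open>q\<close>-subgroup above a self-normalizing Sylow subgroup of
\<open>H\<close> is self-normalizing, so no arc starts at \<open>q\<close>. Yet the
\<open>p\<close>-elements of \<open>H\<close> act nontrivially on the base \<open>B\<close>, which is a
\<open>q\<close>-group.\<close>

lemma exists_group_with_reversed_action:
  assumes pq: "prime p" "prime q" "p \<noteq> q"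
  shows "\<exists>(W :: ((((int \<Rightarrow> int) \<times> int) \<Rightarrow> int) \<times> ((int \<Rightarrow> int) \<times> int)) monoid) B y b.
    finite_group W \<and> sylow_graph W = \<lparr>pverts = {p, q}, parcs = {(p, q)}\<rparr> \<and>
    p_subgroup q B W \<and> p_element W p y \<and> (\<forall>b\<in>B. y \<otimes>\<^bsub>W\<^esub> b \<otimes>\<^bsub>W\<^esub> inv\<^bsub>W\<^esub> y \<in> B) \<and>
    b \<in> B \<and> y \<otimes>\<^bsub>W\<^esub> b \<noteq> b \<otimes>\<^bsub>W\<^esub> y"
proof -
  obtain H :: "((int \<Rightarrow> int) \<times> int) monoid" and D Q x where H: "finite_group H" "\<exists>a b. order H = p ^ a * q ^ b"
    and D: "sylow_subgroup p D H" "D \<noteq> {\<one>\<^bsub>H\<^esub>}" and Q: "sylow_subgroup q Q H"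
    and self: "\<forall>h\<in>carrier H. (\<forall>s\<in>Q. h \<otimes>\<^bsub>H\<^esub> s \<otimes>\<^bsub>H\<^esub> inv\<^bsub>H\<^esub> h \<in> Q) \<longrightarrow> h \<in> Q"
    and x: "p_element H q x" "\<forall>d\<in>D. x \<otimes>\<^bsub>H\<^esub> d \<otimes>\<^bsub>H\<^esub> inv\<^bsub>H\<^esub> x \<in> D" "\<exists>d\<in>D. x \<otimes>\<^bsub>H\<^esub> d \<noteq> d \<otimes>\<^bsub>H\<^esub> x"
    using exists_self_normalizing_sylow[OF pq] by blast
  interpret H: group H using H by (simp add: finite_group_def)
  have finH: "finite (carrier H)" using H by (simp add: finite_group_def)
  let ?A = "integer_mod_group q"
  let ?W = "wreath ?A H"
  let ?t = "wreath_top ?A H"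
  have gt: "q > 1" using pq prime_gt_1_nat by auto
  have oA: "order ?A = q" using gt integer_mod_group_order by simp
  have finA: "finite (carrier ?A)" using gt by (auto simp: carrier_integer_mod_group)
  interpret W: group ?W by (rule group_wreath) (simp_all add: H.is_group)
  interpret s: group_hom ?W H snd by (rule wreath_snd_hom) (simp_all add: H.is_group)
  interpret t: group_hom H ?W ?t by (rule wreath_top_hom) (simp_all add: H.is_group)
  have finW: "finite (carrier ?W)" by (rule finite_wreath[OF finA finH])
  have oW: "order ?W = q ^ order H * order H" using order_wreath[OF finH] oA by metis
  obtain a b where ab: "order H = p ^ a * q ^ b" using H(2) by blast
  have ordW: "order ?W = p ^ a * q ^ (order H + b)" using oW ab by (simp add: power_add)
  note mult = multiplicity_two_primes[OF pq]
  have tinj: "inj_on ?t (carrier H)" by (auto simp: inj_on_def wreath_top_def)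
  have DH: "subgroup D H" and QH: "subgroup Q H" using D Q by (auto simp: sylow_subgroup_def)
  have "card (?t ` D) = card D" using card_image[OF inj_on_subset[OF tinj subgroup.subset[OF DH]]] .
  then have sD: "sylow_subgroup p (?t ` D) ?W"
    using D(1) t.subgroup_img_is_subgroup[OF DH] mult ab ordW by (simp add: sylow_subgroup_def)
  have xH: "x \<in> carrier H" using x(1) by (simp add: p_element_def)
  have tmult: "?t h \<otimes>\<^bsub>?W\<^esub> ?t k = ?t (h \<otimes>\<^bsub>H\<^esub> k)" if "h \<in> carrier H" "k \<in> carrier H" for h k
    using t.hom_mult[OF that] by simp
  have "(p, q) \<in> parcs (sylow_graph ?W)"
  proof -
    have "?t x \<otimes>\<^bsub>?W\<^esub> u \<otimes>\<^bsub>?W\<^esub> inv\<^bsub>?W\<^esub> ?t x \<in> ?t ` D" if "u \<in> ?t ` D" for u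
    proof -
      obtain d where d: "d \<in> D" "u = ?t d" using \<open>u \<in> ?t ` D\<close> by blast
      have "?t (x \<otimes>\<^bsub>H\<^esub> d \<otimes>\<^bsub>H\<^esub> inv\<^bsub>H\<^esub> x) \<in> ?t ` D" using x(2) d(1) by blast
      then show ?thesis using d xH subgroup.mem_carrier[OF DH d(1)] by simp
    qed
    moreover obtain d where d: "d \<in> D" "x \<otimes>\<^bsub>H\<^esub> d \<noteq> d \<otimes>\<^bsub>H\<^esub> x" using x(3) by blast
    moreover have "?t x \<otimes>\<^bsub>?W\<^esub> ?t d \<noteq> ?t d \<otimes>\<^bsub>?W\<^esub> ?t x"
    proof
      assume "?t x \<otimes>\<^bsub>?W\<^esub> ?t d = ?t d \<otimes>\<^bsub>?W\<^esub> ?t x"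
      then have "?t (x \<otimes>\<^bsub>H\<^esub> d) = ?t (d \<otimes>\<^bsub>H\<^esub> x)"
        by (simp only: tmult[OF xH subgroup.mem_carrier[OF DH d(1)]] tmult[OF subgroup.mem_carrier[OF DH d(1)] xH])
      then show False using inj_onD[OF tinj] xH subgroup.mem_carrier[OF DH d(1)] d(2) by auto
    qed
    ultimately show ?thesis
      unfolding W.sylow_graph_arc_iff[OF finW] using pq sD t.p_element_hom[OF x(1)] by blast
  qed
  moreover have "(q, p) \<notin> parcs (sylow_graph ?W)"
  proof
    assume qp: "(q, p) \<in> parcs (sylow_graph ?W)"
    (* the preimage of Q, a Sylow q-subgroup that inherits self-normalization from Q *)
    let ?S = "{w \<in> carrier ?W. snd w \<in> Q}"
    have S: "subgroup ?S ?W" by (rule s.vimage_subgroup[OF QH])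
    have img: "snd ` ?S = Q"
    proof (intro equalityI subsetI)
      fix s assume s: "s \<in> Q"
      then have "?t s \<in> ?S" using subgroup.mem_carrier[OF QH s] t.hom_closed by (simp add: wreath_top_def)
      then show "s \<in> snd ` ?S" by (force simp: wreath_top_def)
    qed auto
    have "?S \<inter> kernel ?W H snd = kernel ?W H snd"
      using subgroup.one_closed[OF QH] by (auto simp: kernel_def)
    then have "card ?S = card Q * q ^ order H"
      using s.card_subgroup_img_mult[OF S] img card_wreath_base[OF _ H.is_group finH, of ?A] oA by simp
    moreover have "card Q = q ^ b" using Q mult ab by (simp add: sylow_subgroup_def)
    ultimately have sS: "sylow_subgroup q ?S ?W"
      using S mult(2) by (simp add: sylow_subgroup_def ordW power_add[symmetric] add.commute)
    then obtain y w where y: "p_element ?W p y" and yS: "\<And>u. u \<in> ?S \<Longrightarrow> y \<otimes>\<^bsub>?W\<^esub> u \<otimes>\<^bsub>?W\<^esub> inv\<^bsub>?W\<^esub> y \<in> ?S"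
      and w: "w \<in> ?S" "y \<otimes>\<^bsub>?W\<^esub> w \<noteq> w \<otimes>\<^bsub>?W\<^esub> y"
      using W.sylow_graph_arc_at_sylow[OF finW qp] by meson
    have yW: "y \<in> carrier ?W" using y by (simp add: p_element_def)
    have "snd y \<otimes>\<^bsub>H\<^esub> s \<otimes>\<^bsub>H\<^esub> inv\<^bsub>H\<^esub> snd y \<in> Q" if s: "s \<in> Q" for s
    proof -
      obtain u where u: "u \<in> ?S" "s = snd u" using s img by blast
      then have uW: "u \<in> carrier ?W" by blast
      have "snd (y \<otimes>\<^bsub>?W\<^esub> u \<otimes>\<^bsub>?W\<^esub> inv\<^bsub>?W\<^esub> y) \<in> Q" using yS[OF u(1)] by blast
      then show ?thesis using u(2) uW yW by simp
    qed
    then have "snd y \<in> Q" using self s.hom_closed[OF yW] by blast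
    then have "y \<in> ?S" using yW by blast
    then have "p_element ?W q y" by (rule W.p_subgroup_p_element[OF sylow_imp_p_subgroup[OF sS]])
    then have "y = \<one>\<^bsub>?W\<^esub>" using W.p_element_unique[OF y _ pq] by blast
    then show False using w by simp
  qed
  ultimately have graph: "sylow_graph ?W = \<lparr>pverts = {p, q}, parcs = {(p, q)}\<rparr>"
    by (rule W.sylow_graph_two_primes[OF finW pq ordW])
  let ?B = "kernel ?W H snd"
  have pB: "p_subgroup q ?B ?W"
    using s.subgroup_kernel card_wreath_base[OF _ H.is_group finH, of ?A] oA by (auto simp: p_subgroup_def)
  obtain d where d: "d \<in> D" "d \<noteq> \<one>\<^bsub>H\<^esub>" using D(2) subgroup.one_closed[OF DH] by blast
  have dH: "d \<in> carrier H" using subgroup.mem_carrier[OF DH d(1)] .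
  have "p_element ?W p (?t d)"
    using t.p_element_hom[OF H.p_subgroup_p_element[OF sylow_imp_p_subgroup[OF D(1)] d(1)]] .
  moreover have "\<forall>b\<in>?B. ?t d \<otimes>\<^bsub>?W\<^esub> b \<otimes>\<^bsub>?W\<^esub> inv\<^bsub>?W\<^esub> ?t d \<in> ?B"
    using normal.inv_op_closed2[OF s.normal_kernel t.hom_closed[OF dH]] by blast
  moreover obtain b where "b \<in> ?B" "?t d \<otimes>\<^bsub>?W\<^esub> b \<noteq> b \<otimes>\<^bsub>?W\<^esub> ?t d"
    using wreath_top_not_commute[of ?A H 1 d] H.is_group gt dH d(2) by auto
  moreover have "finite_group ?W" using finW W.is_group by (simp add: finite_group_def)
  ultimately show ?thesis using graph pB by blast
qed

section \<open>Classes recognized by their Sylow graphs\<close>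

lemma in_class_finite_group:
  assumes F: "group_class F" and G: "in_class G F" "group G"
  shows "finite_group G"
proof -
  obtain K where K: "K \<in> F" "G \<cong> K" using G(1) by (auto simp: in_class_def)
  have "finite (carrier K)" using F K(1) by (auto simp: group_class_def finite_group_def)
  moreover obtain h where "h \<in> iso G K" using K(2) by (auto simp: is_iso_def)
  ultimately have "finite (carrier G)" using bij_betw_finite by (auto simp: iso_def)
  then show ?thesis using G(2) by (simp add: finite_group_def)
qed

lemma in_class_subgroup:
  assumes F: "hereditary F" "group_class F" and G: "in_class G F" "group G" and H: "subgroup H G"
  shows "in_class (G\<lparr>carrier := H\<rparr>) F"
proof -
  obtain K h where K: "K \<in> F" and h: "h \<in> iso G K" using G(1) by (auto simp: in_class_def is_iso_def)
  have "group K" using F(2) K by (auto simp: group_class_def finite_group_def)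
  then interpret h: group_hom G K h
    using h G(2) by (simp add: group_hom_def group_hom_axioms_def iso_def)
  have "subgroup (h ` H) K" by (rule h.subgroup_img_is_subgroup[OF H])
  then have "K\<lparr>carrier := h ` H\<rparr> \<in> F" using F(1) K by (auto simp: hereditary_def)
  moreover have "h \<in> iso (G\<lparr>carrier := H\<rparr>) (K\<lparr>carrier := h ` H\<rparr>)"
    using h subgroup.subset[OF H] subgroup.mem_carrier[OF H] inj_on_subset[of h "carrier G" H]
    by (auto simp: iso_def hom_def bij_betw_def)
  ultimately show ?thesis by (auto simp: in_class_def is_iso_def)
qed

lemma group_hom_comp:
  assumes "group_hom H G h" "group_hom G C e"
  shows "group_hom H C (\<lambda>x. e (h x))"
proof -
  interpret h: group_hom H G h by fact
  interpret e: group_hom G C e by fact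
  show ?thesis by unfold_locales (auto simp: hom_def)
qed

lemma in_class_Mod_kernel:
  assumes "group_hom G A f" "f ` carrier G = carrier A" "in_class A F"
  shows "in_class (G Mod kernel G A f) F"
  using assms group_hom.FactGroup_iso iso_trans unfolding in_class_def by blast

text \<open>The two kernels intersect trivially, so closure under subdirect products applies to a copy of
\<open>G\<close> with elements in \<open>nat\<close>.\<close>

lemma in_class_subdirect:
  assumes F: "formation F" and G: "finite_group G"
    and f: "group_hom G A f" "f ` carrier G = carrier A" and A: "in_class A F"
    and g: "group_hom G B g" "g ` carrier G = carrier B" and B: "in_class B F"
    and ker: "\<And>x. x \<in> carrier G \<Longrightarrow> f x = \<one>\<^bsub>A\<^esub> \<Longrightarrow> g x = \<one>\<^bsub>B\<^esub> \<Longrightarrow> x = \<one>\<^bsub>G\<^esub>"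
  shows "in_class G F"
proof -
  obtain H :: "nat monoid" where H: "finite_group H" "G \<cong> H" using finite_group_iso_nat[OF G] by blast
  obtain h where h: "h \<in> iso H G"
    using group.iso_sym[OF _ H(2)] G by (auto simp: finite_group_def is_iso_def)
  have inj: "inj_on h (carrier H)" and surj: "h ` carrier H = carrier G" using h by (auto simp: iso_def bij_betw_def)
  interpret h: group_hom H G h
    using h G H by (simp add: group_hom_def group_hom_axioms_def iso_def finite_group_def)
  have fh: "group_hom H A (\<lambda>x. f (h x))" by (rule group_hom_comp[OF h.group_hom_axioms f(1)])
  have gh: "group_hom H B (\<lambda>x. g (h x))" by (rule group_hom_comp[OF h.group_hom_axioms g(1)])
  have fs: "(\<lambda>x. f (h x)) ` carrier H = carrier A" using surj f(2) by (metis image_image)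
  have gs: "(\<lambda>x. g (h x)) ` carrier H = carrier B" using surj g(2) by (metis image_image)
  let ?M = "kernel H A (\<lambda>x. f (h x))"
  let ?N = "kernel H B (\<lambda>x. g (h x))"
  have "x = \<one>\<^bsub>H\<^esub>" if x: "x \<in> ?M" "x \<in> ?N" for x
  proof -
    have xH: "x \<in> carrier H" "f (h x) = \<one>\<^bsub>A\<^esub>" "g (h x) = \<one>\<^bsub>B\<^esub>" using x by (auto simp: kernel_def)
    then have "h x = h \<one>\<^bsub>H\<^esub>" using ker[OF h.hom_closed] by simp
    then show ?thesis using inj_onD[OF inj] xH(1) by blast
  qed
  moreover have "\<one>\<^bsub>H\<^esub> \<in> ?M" "\<one>\<^bsub>H\<^esub> \<in> ?N"
    using subgroup.one_closed[OF group_hom.subgroup_kernel[OF fh]] subgroup.one_closed[OF group_hom.subgroup_kernel[OF gh]]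
    by blast+
  ultimately have "?M \<inter> ?N = {\<one>\<^bsub>H\<^esub>}" by blast
  then have "\<Inter>{?M, ?N} = {\<one>\<^bsub>H\<^esub>}" by simp
  moreover have "\<forall>K\<in>{?M, ?N}. K \<lhd> H \<and> in_class (H Mod K) F"
    using group_hom.normal_kernel[OF fh] group_hom.normal_kernel[OF gh]
      in_class_Mod_kernel[OF fh fs A] in_class_Mod_kernel[OF gh gs B] by simp
  ultimately have "finite_group H \<and> finite {?M, ?N} \<and> {?M, ?N} \<noteq> {} \<and>
      (\<forall>K\<in>{?M, ?N}. K \<lhd> H \<and> in_class (H Mod K) F) \<and> \<Inter>{?M, ?N} = {\<one>\<^bsub>H\<^esub>}"
    using H(1) by blast
  then have "H \<in> F" using F unfolding formation_def by blast
  then show ?thesis using H(2) by (auto simp: in_class_def)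
qed

lemma in_class_DirProd:
  assumes F: "formation F" and A: "A \<in> F" and B: "B \<in> F"
  shows "in_class (A \<times>\<times> B) F"
proof -
  have gc: "group_class F" using F by (simp add: formation_def)
  then have fin: "finite_group A" "finite_group B" using A B by (auto simp: group_class_def)
  interpret A: group A using fin by (simp add: finite_group_def)
  interpret B: group B using fin by (simp add: finite_group_def)
  interpret D: group "A \<times>\<times> B" by (rule DirProd_group[OF A.is_group B.is_group])
  have cls: "in_class A F" "in_class B F"
    using in_class_iff[OF gc A.is_group] in_class_iff[OF gc B.is_group] A B by auto
  have "finite_group (A \<times>\<times> B)" using fin D.is_group by (simp add: finite_group_def)
  moreover have "group_hom (A \<times>\<times> B) A fst" "group_hom (A \<times>\<times> B) B snd"
    by (unfold_locales; auto simp: hom_def)+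
  moreover have "fst ` carrier (A \<times>\<times> B) = carrier A" "snd ` carrier (A \<times>\<times> B) = carrier B"
    using A.one_closed B.one_closed by force+
  ultimately show ?thesis
    by (intro in_class_subdirect[OF F _ _ _ cls(1) _ _ cls(2), of _ fst snd]) auto
qed

lemma sylow_graph_in_class:
  assumes F: "group_class F" and G: "in_class G F" "group G"
  shows "pverts (sylow_graph G) \<subseteq> pverts (class_sylow_graph F)"
    and "parcs (sylow_graph G) \<subseteq> parcs (class_sylow_graph F)"
    and "\<exists>K\<in>F. sylow_graph K = sylow_graph G"
proof -
  obtain K where K: "K \<in> F" "G \<cong> K" using G(1) by (auto simp: in_class_def)
  have "group K" using F K(1) by (auto simp: group_class_def finite_group_def)
  then have eq: "sylow_graph G = sylow_graph K"
    using sylow_graph_iso[OF in_class_finite_group[OF F G] _ K(2)] by blast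
  then show "\<exists>K\<in>F. sylow_graph K = sylow_graph G" using K(1) by metis
  show "pverts (sylow_graph G) \<subseteq> pverts (class_sylow_graph F)"
    "parcs (sylow_graph G) \<subseteq> parcs (class_sylow_graph F)"
    unfolding eq class_sylow_graph_def using K(1) by auto
qed

text \<open>The subgroup \<open>P\<langle>x\<rangle>\<close> belongs to the class, and the action is its
only arc. So an arc of the class graph can be detected at arbitrary \<open>p\<close>-subgroups.\<close>

lemma action_in_class:
  assumes F: "hereditary F" "group_class F" and G: "in_class G F" "group G"
    and pq: "prime p" "prime q" "p \<noteq> q"
    and P: "p_subgroup p P G" and x: "p_element G q x"
    and norm: "\<And>u. u \<in> P \<Longrightarrow> x \<otimes>\<^bsub>G\<^esub> u \<otimes>\<^bsub>G\<^esub> inv\<^bsub>G\<^esub> x \<in> P"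
    and u: "u \<in> P" "x \<otimes>\<^bsub>G\<^esub> u \<noteq> u \<otimes>\<^bsub>G\<^esub> x"
  shows "(p, q) \<in> parcs (class_sylow_graph F)"
    and "\<exists>K\<in>F. sylow_graph K = \<lparr>pverts = {p, q}, parcs = {(p, q)}\<rparr>"
proof -
  interpret G: group G by (rule G(2))
  have fin: "finite (carrier G)" using in_class_finite_group[OF F(2) G] by (simp add: finite_group_def)
  let ?K = "P <#>\<^bsub>G\<^esub> generate G {x}"
  have K: "subgroup ?K G" using G.p_by_cyclic_q[OF fin pq P x norm] by blast
  have graph: "sylow_graph (G\<lparr>carrier := ?K\<rparr>) = \<lparr>pverts = {p, q}, parcs = {(p, q)}\<rparr>"
    by (rule G.sylow_graph_p_by_cyclic_q[OF fin pq P x norm u])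
  note cls = sylow_graph_in_class[OF F(2) in_class_subgroup[OF F G K] G.subgroup_imp_group[OF K]]
  show "(p, q) \<in> parcs (class_sylow_graph F)" using cls(2) graph by simp
  show "\<exists>K\<in>F. sylow_graph K = \<lparr>pverts = {p, q}, parcs = {(p, q)}\<rparr>" using cls(3) graph by simp
qed

lemma class_arc_realized:
  assumes F: "hereditary F" "group_class F" and a: "(p, q) \<in> parcs (class_sylow_graph F)"
  shows "prime p" "prime q" "p \<noteq> q"
    and "\<exists>K\<in>F. sylow_graph K = \<lparr>pverts = {p, q}, parcs = {(p, q)}\<rparr>"
proof -
  obtain G where G: "G \<in> F" "(p, q) \<in> parcs (sylow_graph G)" using a by (auto simp: class_sylow_graph_def)
  have fin: "finite (carrier G)" and grp: "group G" using F G(1) by (auto simp: group_class_def finite_group_def)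
  interpret G: group G by (rule grp)
  obtain P x u where pq: "prime p" "prime q" "p \<noteq> q" and P: "sylow_subgroup p P G" and x: "p_element G q x"
      and norm: "\<And>u. u \<in> P \<Longrightarrow> x \<otimes>\<^bsub>G\<^esub> u \<otimes>\<^bsub>G\<^esub> inv\<^bsub>G\<^esub> x \<in> P"
      and u: "u \<in> P" "x \<otimes>\<^bsub>G\<^esub> u \<noteq> u \<otimes>\<^bsub>G\<^esub> x"
    using G(2) unfolding G.sylow_graph_arc_iff[OF fin] by blast
  show "prime p" "prime q" "p \<noteq> q" by fact+
  have "in_class G F" using in_class_iff[OF F(2) grp] G(1) by blast
  then show "\<exists>K\<in>F. sylow_graph K = \<lparr>pverts = {p, q}, parcs = {(p, q)}\<rparr>"
    using action_in_class(2)[OF F _ grp pq sylow_imp_p_subgroup[OF P] x norm u] by blast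
qed

lemma class_vertex_realized:
  assumes F: "hereditary F" "group_class F" and v: "p \<in> pverts (class_sylow_graph F)"
  shows "\<exists>K\<in>F. sylow_graph K = \<lparr>pverts = {p}, parcs = {}\<rparr>"
proof -
  obtain G where G: "G \<in> F" "p \<in> pverts (sylow_graph G)" using v by (auto simp: class_sylow_graph_def)
  have fin: "finite (carrier G)" and grp: "group G" using F G(1) by (auto simp: group_class_def finite_group_def)
  interpret G: group G by (rule grp)
  have p: "prime p" "p dvd order G" using G(2) G.prime_divisors_iff[OF fin] by (auto simp: sylow_graph_def)
  obtain H where H: "subgroup H G" "card H = p" using G.subgroup_of_prime_order[OF fin p] by blast
  let ?H = "G\<lparr>carrier := H\<rparr>"
  interpret H: group ?H by (rule G.subgroup_imp_group[OF H(1)])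
  have finH: "finite (carrier ?H)" using finite_subset[OF subgroup.subset[OF H(1)] fin] by simp
  have "pverts (sylow_graph ?H) = {p}"
    using p(1) H(2) H.prime_divisors_iff[OF finH] primes_dvd_imp_eq by (auto simp: sylow_graph_def order_def)
  moreover have "False" if "(s, t) \<in> parcs (sylow_graph ?H)" for s t
    using H.sylow_graph_arc_verts[OF finH that] H.sylow_graph_arc_iff[OF finH] that calculation by simp
  then have "parcs (sylow_graph ?H) = {}" by auto
  ultimately have "sylow_graph ?H = \<lparr>pverts = {p}, parcs = {}\<rparr>" by (intro pair_pre_digraph.equality) auto
  moreover have "?H \<in> F" using F(1) G(1) H(1) by (auto simp: hereditary_def)
  ultimately show ?thesis by blast
qed

lemma class_graph_union:
  assumes F: "formation F" and A: "A \<in> F" and B: "B \<in> F"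
  shows "\<exists>K\<in>F. pverts (sylow_graph K) = pverts (sylow_graph A) \<union> pverts (sylow_graph B)
    \<and> parcs (sylow_graph K) = parcs (sylow_graph A) \<union> parcs (sylow_graph B)"
proof -
  have cls: "group_class F" using F by (simp add: formation_def)
  have fin: "finite_group A" "finite_group B" using cls A B by (auto simp: group_class_def)
  have "group (A \<times>\<times> B)" using fin DirProd_group by (auto simp: finite_group_def)
  then show ?thesis
    using sylow_graph_in_class(3)[OF cls in_class_DirProd[OF F A B]] sylow_graph_DirProd[OF fin] by metis
qed

text \<open>Take the direct product of members that realize single vertices and single arcs.\<close>

lemma class_subgraph_realized:
  assumes F: "formation F" "hereditary F"
    and V: "finite V" "V \<subseteq> pverts (class_sylow_graph F)"
    and E: "finite E" "E \<subseteq> parcs (class_sylow_graph F)" "fst ` E \<union> snd ` E \<subseteq> V"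
  shows "\<exists>K\<in>F. sylow_graph K = \<lparr>pverts = V, parcs = E\<rparr>"
proof -
  have cls: "group_class F" using F by (simp add: formation_def)
  have "\<exists>K\<in>F. pverts (sylow_graph K) = V \<and> parcs (sylow_graph K) = {}"
    using V
  proof (induction V rule: finite_induct)
    case empty
    have "F \<noteq> {}" using F(1) unfolding formation_def by (elim conjE)
    then obtain G where G: "G \<in> F" by blast
    interpret G: group G using cls G by (auto simp: group_class_def finite_group_def)
    let ?T = "G\<lparr>carrier := {\<one>\<^bsub>G\<^esub>}\<rparr>"
    have sub: "subgroup {\<one>\<^bsub>G\<^esub>} G" by (rule G.triv_subgroup)
    interpret T: group ?T by (rule G.subgroup_imp_group[OF sub])
    have "?T \<in> F" using F(2) G sub by (auto simp: hereditary_def)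
    moreover have "pverts (sylow_graph ?T) = {}"
      by (simp add: sylow_graph_def prime_divisors_def order_def)
    then have "parcs (sylow_graph ?T) = {}" using T.sylow_graph_arc_verts by fastforce
    ultimately show ?case using \<open>pverts (sylow_graph ?T) = {}\<close> by blast
  next
    case (insert p V)
    then obtain A where A: "A \<in> F" "pverts (sylow_graph A) = V" "parcs (sylow_graph A) = {}" by auto
    obtain B where B: "B \<in> F" "sylow_graph B = \<lparr>pverts = {p}, parcs = {}\<rparr>"
      using class_vertex_realized[OF F(2) cls] insert.prems by blast
    show ?case using class_graph_union[OF F(1) B(1) A(1)] A(2,3) B(2) by simp
  qed
  moreover have "\<exists>K\<in>F. pverts (sylow_graph K) = V \<and> parcs (sylow_graph K) = E"
    if "\<exists>K\<in>F. pverts (sylow_graph K) = V \<and> parcs (sylow_graph K) = {}"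
    using E
  proof (induction E rule: finite_induct)
    case empty
    then show ?case using that by blast
  next
    case (insert e E)
    obtain p q where e: "e = (p, q)" by (cases e)
    obtain A where A: "A \<in> F" "pverts (sylow_graph A) = V" "parcs (sylow_graph A) = E" using insert by auto
    have "(p, q) \<in> parcs (class_sylow_graph F)" using insert.prems e by blast
    then obtain B where B: "B \<in> F" "sylow_graph B = \<lparr>pverts = {p, q}, parcs = {(p, q)}\<rparr>"
      using class_arc_realized(4)[OF F(2) cls] by blast
    have "{p, q} \<union> V = V" using insert.prems e by auto
    then show ?case using class_graph_union[OF F(1) B(1) A(1)] A(2,3) B(2) e by simp
  qed
  ultimately obtain K where K: "K \<in> F" "pverts (sylow_graph K) = V" "parcs (sylow_graph K) = E" by blast
  then have "sylow_graph K = \<lparr>pverts = V, parcs = E\<rparr>" by (intro pair_pre_digraph.equality) auto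
  then show ?thesis using K(1) by blast
qed

text \<open>Some member of the class has the same graph as \<open>G\<close>, so recognition applies to
\<open>G\<close>.\<close>

lemma in_class_if_subgraph:
  assumes F: "formation F" "hereditary F" "recognized_by F sylow_graph" and G: "finite_group G"
    and V: "pverts (sylow_graph G) \<subseteq> pverts (class_sylow_graph F)"
    and E: "parcs (sylow_graph G) \<subseteq> parcs (class_sylow_graph F)"
  shows "in_class G F"
proof -
  have cls: "group_class F" using F(1) by (simp add: formation_def)
  interpret G: group G using G by (simp add: finite_group_def)
  have fin: "finite (carrier G)" using G by (simp add: finite_group_def)
  have finV: "finite (pverts (sylow_graph G))" by (simp add: sylow_graph_def prime_divisors_def)
  have ends: "fst ` parcs (sylow_graph G) \<union> snd ` parcs (sylow_graph G) \<subseteq> pverts (sylow_graph G)"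
    using G.sylow_graph_arc_verts[OF fin] by auto
  then have "parcs (sylow_graph G) \<subseteq> pverts (sylow_graph G) \<times> pverts (sylow_graph G)" by force
  then have "finite (parcs (sylow_graph G))" using finV by (meson finite_SigmaI finite_subset)
  then obtain K where K: "K \<in> F" "sylow_graph K = sylow_graph G"
    using class_subgraph_realized[OF F(1,2) finV V _ E ends] by auto
  obtain H :: "nat monoid" where H: "finite_group H" "G \<cong> H" using finite_group_iso_nat[OF G] by blast
  have "sylow_graph H = sylow_graph G" using sylow_graph_iso[OF G _ H(2)] H(1) by (simp add: finite_group_def)
  moreover have "finite_group K" using cls K(1) by (simp add: group_class_def)
  ultimately have "H \<in> F" using F(3) H(1) K unfolding recognized_by_def by metis
  then show ?thesis using H(2) by (auto simp: in_class_def)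
qed

text \<open>The group \<open>W\<close> with the single arc \<open>p \<rightarrow> q\<close> is in the class
by its graph, and the action of a \<open>p\<close>-element on its \<open>q\<close>-subgroup \<open>B\<close>
yields the arc \<open>q \<rightarrow> p\<close>.\<close>

lemma undirected_class_sylow_graph:
  assumes F: "formation F" "hereditary F" "recognized_by F sylow_graph"
  shows "undirected (class_sylow_graph F)"
proof -
  have cls: "group_class F" using F(1) by (simp add: formation_def)
  have "(q, p) \<in> parcs (class_sylow_graph F)" if a: "(p, q) \<in> parcs (class_sylow_graph F)" for p q
  proof -
    note pq = class_arc_realized(1-3)[OF F(2) cls a]
    obtain K where K: "K \<in> F" "sylow_graph K = \<lparr>pverts = {p, q}, parcs = {(p, q)}\<rparr>"
      using class_arc_realized(4)[OF F(2) cls a] by blast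
    have "pverts (sylow_graph K) \<subseteq> pverts (class_sylow_graph F)"
      using K(1) by (auto simp: class_sylow_graph_def)
    then have V: "{p, q} \<subseteq> pverts (class_sylow_graph F)" by (simp add: K(2))
    obtain W :: "((((int \<Rightarrow> int) \<times> int) \<Rightarrow> int) \<times> ((int \<Rightarrow> int) \<times> int)) monoid" and B y b where
      W: "finite_group W" "sylow_graph W = \<lparr>pverts = {p, q}, parcs = {(p, q)}\<rparr>"
      and B: "p_subgroup q B W" "p_element W p y" "\<forall>b\<in>B. y \<otimes>\<^bsub>W\<^esub> b \<otimes>\<^bsub>W\<^esub> inv\<^bsub>W\<^esub> y \<in> B"
      "b \<in> B" "y \<otimes>\<^bsub>W\<^esub> b \<noteq> b \<otimes>\<^bsub>W\<^esub> y"
      using exists_group_with_reversed_action[OF pq] by blast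
    have "in_class W F" by (rule in_class_if_subgraph[OF F W(1)]) (use W(2) V a in auto)
    moreover have "group W" using W(1) by (simp add: finite_group_def)
    ultimately show ?thesis
      using action_in_class(1)[OF F(2) cls _ _ pq(2) pq(1) pq(3)[symmetric] B(1,2) _ B(4,5)] B(3) by blast
  qed
  then show ?thesis unfolding undirected_def by blast
qed

lemma (in group) action_mod_normal:
  assumes N: "N \<lhd> G" and p: "prime p" and P: "p_subgroup p P G" and x: "p_element G q x"
    and norm: "\<And>u. u \<in> P \<Longrightarrow> x \<otimes> u \<otimes> inv x \<in> P" and v: "v \<in> P" "x \<otimes> v \<otimes> inv x \<otimes> inv v \<notin> N"
  defines "\<pi> \<equiv> \<lambda>y. N #> y"
  shows "p_subgroup p (\<pi> ` P) (G Mod N)" "p_element (G Mod N) q (\<pi> x)"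
    and "\<And>w. w \<in> \<pi> ` P \<Longrightarrow> \<pi> x \<otimes>\<^bsub>G Mod N\<^esub> w \<otimes>\<^bsub>G Mod N\<^esub> inv\<^bsub>G Mod N\<^esub> \<pi> x \<in> \<pi> ` P"
    and "\<pi> v \<in> \<pi> ` P" "\<pi> x \<otimes>\<^bsub>G Mod N\<^esub> \<pi> v \<noteq> \<pi> v \<otimes>\<^bsub>G Mod N\<^esub> \<pi> x"
proof -
  interpret \<pi>: group_hom G "G Mod N" \<pi> unfolding \<pi>_def by (rule quotient_group_hom[OF N])
  have c: "v \<in> carrier G" if "v \<in> P" for v
    using P subgroup.mem_carrier[of P G v] that by (simp add: p_subgroup_def)
  have xG: "x \<in> carrier G" using x by (simp add: p_element_def)
  show "p_subgroup p (\<pi> ` P) (G Mod N)" by (rule \<pi>.p_subgroup_img[OF P p])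
  show "p_element (G Mod N) q (\<pi> x)" by (rule \<pi>.p_element_hom[OF x])
  show "\<pi> v \<in> \<pi> ` P" using v(1) by blast
  show "\<pi> x \<otimes>\<^bsub>G Mod N\<^esub> w \<otimes>\<^bsub>G Mod N\<^esub> inv\<^bsub>G Mod N\<^esub> \<pi> x \<in> \<pi> ` P" if "w \<in> \<pi> ` P" for w
  proof -
    obtain s where s: "s \<in> P" "w = \<pi> s" using \<open>w \<in> \<pi> ` P\<close> by blast
    have "\<pi> (x \<otimes> s \<otimes> inv x) \<in> \<pi> ` P" using norm[OF s(1)] by blast
    moreover have "\<pi> (x \<otimes> s \<otimes> inv x) = \<pi> x \<otimes>\<^bsub>G Mod N\<^esub> w \<otimes>\<^bsub>G Mod N\<^esub> inv\<^bsub>G Mod N\<^esub> \<pi> x"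
      unfolding s(2) by (simp only: \<pi>.hom_mult \<pi>.hom_inv m_closed inv_closed xG c[OF s(1)])
    ultimately show ?thesis by simp
  qed
  show "\<pi> x \<otimes>\<^bsub>G Mod N\<^esub> \<pi> v \<noteq> \<pi> v \<otimes>\<^bsub>G Mod N\<^esub> \<pi> x"
    using v(2) commutes_mod_iff[OF N xG c[OF v(1)]] by (simp add: \<pi>_def)
qed

text \<open>All vertices and arcs of \<open>G\<close> come from \<open>G/N\<close>: the vertices by the
lemma on prime divisors of the Frattini subgroup, and an arc because a \<open>q\<close>-element that acts
trivially on a Sylow \<open>p\<close>-subgroup modulo \<open>N\<close> acts trivially on it.\<close>

lemma solubly_saturated_if_recognized:
  assumes F: "formation F" "hereditary F" "recognized_by F sylow_graph"
  shows "solubly_saturated F"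
  unfolding solubly_saturated_def
proof (intro allI impI)
  fix G :: "nat monoid"
  let ?R = "soluble_radical G"
  let ?N = "frattini (G\<lparr>carrier := ?R\<rparr>)"
  assume "finite_group G \<and> in_class (G Mod ?N) F"
  then have G: "finite_group G" and Q: "in_class (G Mod ?N) F" by auto
  have cls: "group_class F" using F(1) by (simp add: formation_def)
  interpret G: group G using G by (simp add: finite_group_def)
  have fin: "finite (carrier G)" using G by (simp add: finite_group_def)
  note R = G.soluble_radical_normal_solvable[OF fin]
  have N: "?N \<lhd> G" using G.frattini_normal[OF R(1)] by blast
  have NG: "subgroup ?N G" using N normal_imp_subgroup by blast
  interpret \<pi>: group_hom G "G Mod ?N" "\<lambda>x. ?N #>\<^bsub>G\<^esub> x" by (rule G.quotient_group_hom[OF N])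
  have finQ: "finite (carrier (G Mod ?N))" using fin by (simp add: carrier_FactGroup)
  have "pverts (sylow_graph G) \<subseteq> pverts (sylow_graph (G Mod ?N))"
  proof
    fix r assume "r \<in> pverts (sylow_graph G)"
    then have r: "prime r" "r dvd order G" using G.prime_divisors_iff[OF fin] by (auto simp: sylow_graph_def)
    have "order G = order (G Mod ?N) * card ?N" using G.lagrange[OF NG] by (simp add: order_def FactGroup_def)
    then have "r dvd order (G Mod ?N) \<or> r dvd card ?N" using r prime_dvd_mult_iff by metis
    then have "r dvd order (G Mod ?N)" using G.prime_dvd_card_frattini[OF fin r(1) R] by blast
    then show "r \<in> pverts (sylow_graph (G Mod ?N))"
      using \<pi>.H.prime_divisors_iff[OF finQ] r(1) by (simp add: sylow_graph_def)
  qed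
  then have V: "pverts (sylow_graph G) \<subseteq> pverts (class_sylow_graph F)"
    using sylow_graph_in_class(1)[OF cls Q \<pi>.H.is_group] by blast
  have E: "(p, q) \<in> parcs (class_sylow_graph F)" if a: "(p, q) \<in> parcs (sylow_graph G)" for p q
  proof -
    obtain P x u where pq: "prime p" "prime q" "p \<noteq> q" and P: "sylow_subgroup p P G" and x: "p_element G q x"
        and norm: "\<And>u. u \<in> P \<Longrightarrow> x \<otimes>\<^bsub>G\<^esub> u \<otimes>\<^bsub>G\<^esub> inv\<^bsub>G\<^esub> x \<in> P"
        and u: "u \<in> P" "x \<otimes>\<^bsub>G\<^esub> u \<noteq> u \<otimes>\<^bsub>G\<^esub> x"
      using a unfolding G.sylow_graph_arc_iff[OF fin] by blast
    have c: "v \<in> carrier G" if "v \<in> P" for v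
      using P subgroup.mem_carrier[of P G v] that by (simp add: sylow_subgroup_def)
    obtain k where k: "x \<in> carrier G" "x [^]\<^bsub>G\<^esub> q ^ k = \<one>\<^bsub>G\<^esub>" using x by (auto simp: p_element_def)
    have cop: "coprime p (q ^ k)" using pq by (simp add: primes_coprime)
    have "\<not> (\<forall>v\<in>P. x \<otimes>\<^bsub>G\<^esub> v \<otimes>\<^bsub>G\<^esub> inv\<^bsub>G\<^esub> x \<otimes>\<^bsub>G\<^esub> inv\<^bsub>G\<^esub> v \<in> ?N)"
    proof
      assume "\<forall>v\<in>P. x \<otimes>\<^bsub>G\<^esub> v \<otimes>\<^bsub>G\<^esub> inv\<^bsub>G\<^esub> x \<otimes>\<^bsub>G\<^esub> inv\<^bsub>G\<^esub> v \<in> ?N"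
      then have "x \<otimes>\<^bsub>G\<^esub> u \<otimes>\<^bsub>G\<^esub> inv\<^bsub>G\<^esub> x = u"
        using G.coprime_action_trivial_mod_frattini[OF fin pq(1) R P k cop norm _ u(1)] by blast
      then have "x \<otimes>\<^bsub>G\<^esub> u = u \<otimes>\<^bsub>G\<^esub> x" using k(1) c[OF u(1)] G.inv_solve_right' by simp
      then show False using u(2) by contradiction
    qed
    then obtain v where v: "v \<in> P" "x \<otimes>\<^bsub>G\<^esub> v \<otimes>\<^bsub>G\<^esub> inv\<^bsub>G\<^esub> x \<otimes>\<^bsub>G\<^esub> inv\<^bsub>G\<^esub> v \<notin> ?N" by blast
    note mod = G.action_mod_normal[OF N pq(1) sylow_imp_p_subgroup[OF P] x norm v]
    show ?thesis by (rule action_in_class(1)[OF F(2) cls Q \<pi>.H.is_group pq mod])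
  qed
  have "in_class G F" by (rule in_class_if_subgraph[OF F G V]) (use E in auto)
  then show "G \<in> F" using in_class_iff[OF cls G.is_group] by blast
qed

lemma (in group) nilpotent_if_sylows_commute:
  assumes fin: "finite (carrier G)" and pq: "prime p" "prime q" "p \<noteq> q" and ord: "order G dvd p ^ a * q ^ b"
    and A: "sylow_subgroup p A G" and B: "sylow_subgroup q B G"
    and comm: "\<And>x y. x \<in> A \<Longrightarrow> y \<in> B \<Longrightarrow> x \<otimes> y = y \<otimes> x"
  shows "nilpotent_group G"
proof -
  have AG: "subgroup A G" and BG: "subgroup B G" using A B by (auto simp: sylow_subgroup_def)
  obtain s t where st: "order G = s * t" "s dvd p ^ a" "t dvd q ^ b" using ord division_decomp by blast
  then obtain c d where "s = p ^ c" "t = q ^ d" using pq divides_primepow_nat by metis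
  then have oG: "order G = p ^ c * q ^ d" using st by simp
  have cAB: "card A = p ^ c" "card B = q ^ d"
    using A B multiplicity_two_primes[OF pq] oG by (auto simp: sylow_subgroup_def)
  then have "coprime (card A) (card B)" using pq by (simp add: primes_coprime)
  then have "A \<inter> B = {\<one>}" by (rule coprime_card_Int[OF AG BG])
  then have "card (A <#> B) = card (carrier G)"
    using card_set_mult[OF AG BG] cAB oG by (simp only: order_def)
  moreover have "A <#> B \<subseteq> carrier G"
    by (rule setmult_subset_G[OF subgroup.subset[OF AG] subgroup.subset[OF BG]])
  ultimately have "carrier G = A <#> B" using card_subset_eq[OF fin] by metis
  then show ?thesis
    by (rule nilpotent_commuting_product[OF fin pq(1,2) sylow_imp_p_subgroup[OF A] sylow_imp_p_subgroup[OF B] _ comm])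
qed

text \<open>A critical group that is not of prime order has an arc \<open>p \<rightarrow> q\<close> outside
the class graph. It must then be \<open>P\<langle>x\<rangle>\<close>, and its proper subgroups are products
of a \<open>p\<close>-group and a \<open>q\<close>-group that commute.\<close>

lemma shemetkov_property_if_recognized:
  assumes F: "formation F" "hereditary F" "recognized_by F sylow_graph"
  shows "shemetkov_property F"
  unfolding shemetkov_property_def
proof (intro allI impI)
  fix G :: "nat monoid"
  assume crit: "s_critical G F"
  show "schmidt_group G \<or> prime (order G)"
  proof (rule disjCI)
    assume np: "\<not> prime (order G)"
    have cls: "group_class F" using F(1) by (simp add: formation_def)
    have G: "finite_group G" "G \<notin> F" and proper: "\<And>H. proper_subgroup H G \<Longrightarrow> G\<lparr>carrier := H\<rparr> \<in> F"
      using crit by (auto simp: s_critical_def)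
    interpret G: group G using G by (simp add: finite_group_def)
    have fin: "finite (carrier G)" using G by (simp add: finite_group_def)
    have V: "pverts (sylow_graph G) \<subseteq> pverts (class_sylow_graph F)"
    proof
      fix r assume "r \<in> pverts (sylow_graph G)"
      then have r: "prime r" "r dvd order G" using G.prime_divisors_iff[OF fin] by (auto simp: sylow_graph_def)
      obtain H where H: "subgroup H G" "card H = r" using G.subgroup_of_prime_order[OF fin r] by blast
      have "H \<noteq> carrier G" using H(2) np r(1) by (auto simp: order_def)
      then have "G\<lparr>carrier := H\<rparr> \<in> F" using proper H(1) by (simp add: proper_subgroup_def)
      moreover have "r \<in> pverts (sylow_graph (G\<lparr>carrier := H\<rparr>))"
        using r(1) H(2) by (simp add: sylow_graph_def prime_divisors_def order_def in_prime_factors_iff)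
      ultimately show "r \<in> pverts (class_sylow_graph F)" by (auto simp: class_sylow_graph_def)
    qed
    have "\<not> parcs (sylow_graph G) \<subseteq> parcs (class_sylow_graph F)"
      using in_class_if_subgraph[OF F G(1) V] in_class_iff[OF cls G.is_group] G(2) by blast
    then obtain p q where a: "(p, q) \<in> parcs (sylow_graph G)" and na: "(p, q) \<notin> parcs (class_sylow_graph F)" by auto
    obtain P x u where pq: "prime p" "prime q" "p \<noteq> q" and P: "sylow_subgroup p P G" and x: "p_element G q x"
        and norm: "\<And>u. u \<in> P \<Longrightarrow> x \<otimes>\<^bsub>G\<^esub> u \<otimes>\<^bsub>G\<^esub> inv\<^bsub>G\<^esub> x \<in> P"
        and u: "u \<in> P" "x \<otimes>\<^bsub>G\<^esub> u \<noteq> u \<otimes>\<^bsub>G\<^esub> x"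
      using a unfolding G.sylow_graph_arc_iff[OF fin] by blast
    have pP: "p_subgroup p P G" by (rule sylow_imp_p_subgroup[OF P])
    let ?K = "P <#>\<^bsub>G\<^esub> generate G {x}"
    note K = G.p_by_cyclic_q[OF fin pq pP x norm]
    (* a proper subgroup P<x> would be in F and contribute the arc *)
    have "?K = carrier G"
    proof (rule ccontr)
      assume "?K \<noteq> carrier G"
      then have "G\<lparr>carrier := ?K\<rparr> \<in> F" using proper K(1) by (simp add: proper_subgroup_def)
      moreover have "(p, q) \<in> parcs (sylow_graph (G\<lparr>carrier := ?K\<rparr>))"
        using G.sylow_graph_p_by_cyclic_q[OF fin pq pP x norm u] by simp
      ultimately show False using na by (auto simp: class_sylow_graph_def)
    qed
    then have Pn: "P \<lhd> G" and ord: "\<exists>a b. order G = p ^ a * q ^ b"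
      using K(6,7) by (auto simp: order_def)
    have "\<not> nilpotent_group G" using G.sylow_graph_nilpotent[OF fin] a by auto
    moreover have "nilpotent_group (G\<lparr>carrier := H\<rparr>)" if H: "proper_subgroup H G" for H
    proof -
      let ?H = "G\<lparr>carrier := H\<rparr>"
      have HG: "subgroup H G" using H by (simp add: proper_subgroup_def)
      interpret H: group ?H by (rule G.subgroup_imp_group[OF HG])
      have finH: "finite (carrier ?H)" using finite_subset[OF subgroup.subset[OF HG] fin] by simp
      have HF: "in_class ?H F" using proper[OF H] in_class_iff[OF cls H.is_group] by blast
      obtain A where A: "sylow_subgroup p A ?H" using H.sylow_subgroup_exists[OF finH pq(1)] by blast
      obtain B where B: "sylow_subgroup q B ?H" using H.sylow_subgroup_exists[OF finH pq(2)] by blast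
      have pA: "p_subgroup p A ?H" and qB: "p_subgroup q B ?H" using A B sylow_imp_p_subgroup by auto
      have BH: "subgroup B ?H" using B by (simp add: sylow_subgroup_def)
      have PH: "H \<inter> P \<lhd> ?H" using G.normal_Int_subgroup[OF HG Pn] by (simp add: Int_commute)
      have PHs: "subgroup (H \<inter> P) ?H" using PH normal_imp_subgroup by blast
      have peH: "p_element ?H p y \<longleftrightarrow> y \<in> H \<and> p_element G p y" for y by (rule G.p_element_subgroup_iff[OF HG])
      have "p_subgroup p (H \<inter> P) ?H"
        using H.p_subgroup_if_p_elements[OF finH pq(1) PHs] G.p_subgroup_p_element[OF pP] peH by blast
      then have "H \<inter> P \<subseteq> A" by (rule H.normal_p_subgroup_le_sylow[OF finH pq(1) A _ PH])
      moreover have "A \<subseteq> H \<inter> P"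
        using H.p_subgroup_p_element[OF pA] peH G.p_element_in_normal_sylow[OF fin pq(1) P Pn] by blast
      (* P is the set of all p-elements of G, so the Sylow p-subgroup of H is the normal subgroup H Int P *)
      ultimately have AP: "A = H \<inter> P" by blast
      have comm: "a \<otimes>\<^bsub>?H\<^esub> b = b \<otimes>\<^bsub>?H\<^esub> a" if ab: "a \<in> A" "b \<in> B" for a b
      proof (rule ccontr)
        assume nc: "a \<otimes>\<^bsub>?H\<^esub> b \<noteq> b \<otimes>\<^bsub>?H\<^esub> a"
        have bH: "b \<in> carrier ?H" using subgroup.mem_carrier[OF BH ab(2)] .
        have "b \<otimes>\<^bsub>?H\<^esub> v \<otimes>\<^bsub>?H\<^esub> inv\<^bsub>?H\<^esub> b \<in> A" if "v \<in> A" for v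
          using normal.inv_op_closed2[OF PH bH] that AP by blast
        then have "(p, q) \<in> parcs (class_sylow_graph F)"
          using action_in_class(1)[OF F(2) cls HF H.is_group pq pA H.p_subgroup_p_element[OF qB ab(2)] _ ab(1)] nc
          by metis
        then show False using na by contradiction
      qed
      obtain a b where ab: "order G = p ^ a * q ^ b" using ord by blast
      have "order ?H dvd p ^ a * q ^ b" using G.card_subgroup_dvd[OF HG] ab by (simp add: order_def)
      then show ?thesis by (rule H.nilpotent_if_sylows_commute[OF finH pq _ A B comm])
    qed
    ultimately show "schmidt_group G" by (simp add: schmidt_group_def)
  qed
qed

theorem theorem4p5:
  fixes F :: "nat monoid set"
  assumes "formation F"
    and "hereditary F"
    and "recognized_by F sylow_graph"
  shows "undirected (class_sylow_graph F)
    \<and> (formation F \<and> solubly_saturated F \<and> shemetkov_property F)"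
  using undirected_class_sylow_graph[OF assms] solubly_saturated_if_recognized[OF assms]
    shemetkov_property_if_recognized[OF assms] assms(1) by blast

end
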